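(* For $N\ge2$, let $M_N$ be a random variable with $$\mathbb{P}(M_N=n)=\frac{1}{N-1},\qquad 2\le n\le N,$$ and let $Z_N=\omega'(M_N)$. Then the sequence $(Z_N)$ converges strongly in the mod-Poisson sense with parameters $\lambda_N=\log\log N$ and limiting function $$\Phi(u)=\frac{1}{\Gamma(e^{iu}+1)}\prod_p\left(1-\frac1p\right)^{e^{iu}}\left(1+\frac{e^{iu}}{p-1}\right),$$ the product being over all prime numbers $p$.
   Context: For an integer $n\ge2$, $\omega(n)$ is the number of distinct prime divisors of $n$ and $\omega'(n)=\omega(n)-1$. The function $1/\Gamma$ is understood as an entire function. A sequence $(Z_N)$ of real random variables converges strongly in the mod-Poisson sense with parameters $\lambda_N$ (positive for $N$ large) and limiting function $\Phi$ if $$\lim_{N\to+\infty}\exp(\lambda_N(1-e^{iu}))\,\mathbb{E}(e^{iuZ_N})=\Phi(u)$$ for every $u\in\mathbb{R}$, and the convergence is locally uniform in $u$. *)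

theory Defs
  imports "HOL-Probability.Probability"
    "HOL-Computational_Algebra.Computational_Algebra"
begin

definition omega :: "nat \<Rightarrow> nat" where
  "omega n = card (prime_factors n)"

definition omega' :: "nat \<Rightarrow> int" where
  "omega' n = int (omega n) - 1"

(* The N-th variable Z N lives on its own space P N. The first two conditions are only
   required eventually, so that sequences indexed by N >= N0 are covered (for the parameters
   this is "positive for N large"). *)
definition strongly_mod_poisson ::
  "(nat \<Rightarrow> 'a measure) \<Rightarrow> (nat \<Rightarrow> 'a \<Rightarrow> real) \<Rightarrow> (nat \<Rightarrow> real) \<Rightarrow> (real \<Rightarrow> complex) \<Rightarrow> bool" where
  "strongly_mod_poisson P Z l \<Phi> \<longleftrightarrow>
     (\<forall>\<^sub>F N in sequentially. prob_space (P N) \<and> Z N \<in> borel_measurable (P N)) \<and>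
     (\<forall>\<^sub>F N in sequentially. l N > 0) \<and>
     (let F = (\<lambda>N u. exp (complex_of_real (l N) * (1 - iexp u)) *
                     integral\<^sup>L (P N) (\<lambda>x. iexp (u * Z N x)))
      in (\<forall>u. (\<lambda>N. F N u) \<longlonglongrightarrow> \<Phi> u) \<and>
         (\<forall>u. \<exists>U. open U \<and> u \<in> U \<and> uniform_limit U F \<Phi> sequentially))"

(* Products over primes are taken over all naturals, in increasing order, with factor 1 at
   the non-primes. *)
definition euler_factor :: "real \<Rightarrow> nat \<Rightarrow> complex" where
  "euler_factor u p =
     (if prime p
      then complex_of_real (1 - 1 / real p) powr iexp u * (1 + iexp u / complex_of_real (real p - 1))
      else 1)"

definition limit_fun :: "real \<Rightarrow> complex" where
  "limit_fun u = rGamma (iexp u + 1) * (\<Prod>p. euler_factor u p)"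

end

theory Submission
  imports Defs "HOL-Complex_Analysis.Complex_Analysis" "HOL-Real_Asymp.Real_Asymp"
begin

text \<open>
  For \<open>|z| = 1\<close> one needs the sum of \<open>z\<close> to the power \<open>\<omega>(n)\<close> over \<open>n \<le> N\<close> with an error which is smaller than
  \<open>N / (ln N)\<^sup>2\<close>, uniformly in \<open>z\<close>. Its Dirichlet series is \<open>F = \<zeta>\<^sup>z G\<close> with an Euler product \<open>G\<close> that is bounded for
  \<open>Re s > 3/4\<close>. All the analysis takes place in \<open>Re s > 1\<close>: the classical 3-4-1 argument shows that all
  derivatives of \<open>F\<close> are bounded by powers of \<open>ln |t|\<close> up to the line \<open>Re s = 1\<close> away from \<open>s = 1\<close>, and near \<open>s = 1\<close> they behave
  like those of \<open>G(1)\<close> times \<open>s - 1\<close> to the power \<open>-z\<close>.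

  The Laplace transform of \<open>f(v)\<close>, the sum up to \<open>exp v\<close> divided by \<open>exp v\<close>, is \<open>F(1 + \<xi>) / (1 + \<xi>)\<close>, and taking \<open>k\<close>
  derivatives multiplies \<open>f\<close> by \<open>(-v)\<^sup>k\<close>. Hence the transform of \<open>v\<^sup>k f(v)\<close> minus the expected main term is of
  lower order at \<open>\<xi> = 0\<close> and grows slowly in vertical direction, independently of \<open>k\<close>. Convolving with a narrow Gaussian
  and evaluating on the line \<open>Re \<xi> = 1 / v\<close> bounds this difference. The factor \<open>v\<^sup>k\<close> gained for large \<open>k\<close> outweighs
  all losses, because \<open>f\<close> varies slowly.
\<close>

section \<open>A product over primes converging beyond the line of abscissa 1\<close>

text \<open>The required precision comes from the normalisation:
  \<open>exp (ln (ln N) * (1 - z))\<close> has modulus \<open>(ln N) powr (1 - Re z)\<close>, which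
  reaches \<open>(ln N)^2\<close> at z = -1. The series with parameter z is never continued across
  Re s = 1, where this would call for a zero-free region; differentiating k times sharpens the
  singularity at s = 1 instead, while the cost in the vertical direction stays polynomial of degree
  one. The coefficient of the main term appears as the quotient of the Pochhammer symbol of z by
  Gamma(z + k), that is 1 / Gamma(z). It is entire in z, so the point z = -1, where Gamma has a pole
  and the main term vanishes, needs no special treatment. All constants are independent of z on the
  unit circle, which yields convergence uniform in u on the whole line.\<close>

definition local_factor :: "complex \<Rightarrow> complex \<Rightarrow> complex" where
  "local_factor z q = exp (z * Ln (1 - q)) * (1 + z * q / (1 - q))"

text \<open>The factor \<^term>\<open>q\<close> in the derivative is what makes the local factors \<open>1 + O(q\<^sup>2)\<close>,
  so that their product over the primes converges beyond the line of abscissa 1.\<close>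

lemma has_field_derivative_local_factor:
  assumes "norm q < 1"
  shows "(local_factor z has_field_derivative
           exp (z * Ln (1 - q)) * (z * (1 - z) * q / (1 - q)^2)) (at q)"
proof -
  have re: "Re (1 - q) > 0"
    using assms abs_Re_le_cmod[of q] by simp
  hence ne: "1 - q \<noteq> 0" by auto
  have nr: "1 - q \<notin> \<real>\<^sub>\<le>\<^sub>0"
    using re complex_nonpos_Reals_iff by force
  have 1: "((\<lambda>q. exp (z * Ln (1 - q))) has_field_derivative exp (z * Ln (1 - q)) * (- z / (1 - q))) (at q)"
    using ne nr by (auto intro!: derivative_eq_intros simp: field_simps)
  have 2: "((\<lambda>q. 1 + z * q / (1 - q)) has_field_derivative z / (1 - q)^2) (at q)"
    using ne by (auto intro!: derivative_eq_intros simp: power2_eq_square algebra_simps)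
  have 3: "- z / (1 - q) * (1 + z * q / (1 - q)) + z / (1 - q)^2 = z * (1 - z) * q / (1 - q)^2"
    using ne by (simp add: divide_simps power2_eq_square) (simp add: algebra_simps)
  have "exp (z * Ln (1 - q)) * (- z / (1 - q)) * (1 + z * q / (1 - q)) + z / (1 - q)^2 * exp (z * Ln (1 - q))
      = exp (z * Ln (1 - q)) * (- z / (1 - q) * (1 + z * q / (1 - q)) + z / (1 - q)^2)"
    by (simp only: distrib_left mult_ac)
  with DERIV_mult[OF 1 2] show ?thesis
    unfolding 3 by (simp only: local_factor_def[abs_def])
qed

text \<open>The modulus of w contributes at most 3/2 to |Ln w| and its argument at most pi < 7/2.
  The bounds 2/5 and 8/5 are those of |1 - q| for |q| \<le> 3/5.\<close>

lemma norm_exp_mult_Ln_le: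
  fixes z w :: complex
  assumes "norm z \<le> 1" "2/5 \<le> norm w" "norm w \<le> 8/5"
  shows "norm (exp (z * Ln w)) \<le> exp 5"
proof -
  have w0: "w \<noteq> 0" using assms by auto
  have "ln (norm w) \<le> norm w - 1"
    using w0 by (intro ln_le_minus_one) auto
  moreover have "- ln (norm w) \<le> 3/2"
  proof -
    have "ln (inverse (norm w)) \<le> inverse (norm w) - 1"
      using w0 by (intro ln_le_minus_one) auto
    also have "inverse (norm w) \<le> inverse (2/5)"
      using assms by (intro le_imp_inverse_le) auto
    finally show ?thesis using w0 by (simp add: ln_inverse)
  qed
  ultimately have "\<bar>ln (norm w)\<bar> \<le> 3/2" using assms by linarith
  moreover have "\<bar>Im (Ln w)\<bar> \<le> 7/2"
    using mpi_less_Im_Ln[OF w0] Im_Ln_le_pi[OF w0] pi_less_4 pi_approx by simp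
  ultimately have "norm (Ln w) \<le> 5"
    using cmod_le[of "Ln w"] w0 by simp
  hence "norm (z * Ln w) \<le> 1 * 5"
    unfolding norm_mult using assms by (intro mult_mono) auto
  thus ?thesis
    using norm_exp[of "z * Ln w"] by (smt (verit) exp_le_cancel_iff)
qed

text \<open>Here \<open>exp 5\<close> comes from \<open>norm_exp_mult_Ln_le\<close>, and 25 is a
  generous bound for 2 / (2/5)^2, which dominates |z (1 - z)| / |1 - w|^2.\<close>

definition local_const :: real where "local_const = 25 * exp 5"

text \<open>Mean value inequality on the disc of radius |q|: one factor |q| is in the bound for the
  derivative, the other is the length of the segment from 0 to q.\<close>

lemma local_factor_bound:
  assumes z: "norm z = 1" and q: "norm q \<le> 3/5"
  shows "norm (local_factor z q - 1) \<le> local_const * norm q ^ 2"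
proof -
  let ?S = "cball (0::complex) (norm q)"
  have b: "norm (exp (z * Ln (1 - w)) * (z * (1 - z) * w / (1 - w)^2)) \<le> local_const * norm q"
    if "w \<in> ?S" for w
  proof -
    from that have w: "norm w \<le> norm q" by simp
    have l: "2/5 \<le> norm (1 - w)" "norm (1 - w) \<le> 8/5"
      using norm_triangle_ineq2[of 1 w] norm_triangle_ineq4[of 1 w] w q by auto
    have "norm (exp (z * Ln (1 - w))) \<le> exp 5"
      using z l by (intro norm_exp_mult_Ln_le) auto
    moreover have "norm (z * (1 - z) * w / (1 - w)^2) \<le> 25 * norm q"
    proof -
      have "norm (1 - z) \<le> 2" using norm_triangle_ineq4[of 1 z] z by simp
      hence "norm (z * (1 - z) * w) \<le> 1 * 2 * norm q"
        unfolding norm_mult using z w by (intro mult_mono) auto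
      moreover have "(2/5)^2 \<le> norm (1 - w)^2" using l by (intro power_mono) auto
      ultimately have "norm (z * (1 - z) * w) / norm (1 - w)^2 \<le> (1 * 2 * norm q) / (2/5)^2"
        by (intro frac_le) auto
      also have "(1 * 2 * norm q) / (2/5)^2 \<le> 25 * norm q"
        by (simp add: power2_eq_square)
      finally show ?thesis by (simp add: norm_divide norm_power)
    qed
    ultimately have "norm (exp (z * Ln (1 - w))) * norm (z * (1 - z) * w / (1 - w)^2)
        \<le> exp 5 * (25 * norm q)"
      by (intro mult_mono) auto
    thus ?thesis by (subst norm_mult) (simp only: local_const_def mult_ac)
  qed
  have "norm (local_factor z q - local_factor z 0) \<le> local_const * norm q * norm (q - 0)"
  proof (rule field_differentiable_bound[of ?S])
    fix w assume "w \<in> ?S"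
    hence "norm w < 1" using q by auto
    thus "(local_factor z has_field_derivative
        exp (z * Ln (1 - w)) * (z * (1 - z) * w / (1 - w)^2)) (at w within ?S)"
      by (rule has_field_derivative_at_within[OF has_field_derivative_local_factor])
  next
    fix w assume "w \<in> ?S"
    thus "norm (exp (z * Ln (1 - w)) * (z * (1 - z) * w / (1 - w)^2)) \<le> local_const * norm q"
      by (rule b)
  next
    show "convex ?S" by (rule convex_cball)
    show "q \<in> ?S" "0 \<in> ?S" by simp_all
  qed
  moreover have "local_factor z 0 = 1" by (simp add: local_factor_def)
  ultimately show ?thesis by (simp only: power2_eq_square mult_ac diff_zero)
qed

text \<open>The majorant b gives locally uniform convergence by the M-test, and through 1 + b \<le>
  exp b a bound of the product in terms of b alone.\<close>

lemma infinite_prod_holomorphic: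
  fixes f :: "nat \<Rightarrow> complex \<Rightarrow> complex"
  assumes A: "open A" and holo: "\<And>n. f n holomorphic_on A"
    and bound: "\<And>n s. s \<in> A \<Longrightarrow> norm (f n s - 1) \<le> b n" and b: "summable b"
  shows "(\<lambda>s. \<Prod>n. f n s) holomorphic_on A"
    and "\<And>s. s \<in> A \<Longrightarrow> convergent_prod (\<lambda>n. f n s)"
    and "\<And>s. s \<in> A \<Longrightarrow> (\<lambda>N. \<Prod>n<N. f n s) \<longlonglongrightarrow> (\<Prod>n. f n s)"
    and "\<And>s. s \<in> A \<Longrightarrow> norm (\<Prod>n. f n s) \<le> exp (suminf b)"
proof -
  have conv: "convergent_prod (\<lambda>n. f n s)" if "s \<in> A" for s
  proof (rule abs_convergent_prod_imp_convergent_prod)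
    have "summable (\<lambda>n. norm (f n s - 1))"
      by (rule summable_comparison_test[OF _ b]) (use bound that in auto)
    thus "abs_convergent_prod (\<lambda>n. f n s)"
      by (simp add: abs_convergent_prod_conv_summable)
  qed
  thus "\<And>s. s \<in> A \<Longrightarrow> convergent_prod (\<lambda>n. f n s)" .
  have lim: "(\<lambda>N. \<Prod>n<N. f n s) \<longlonglongrightarrow> (\<Prod>n. f n s)" if "s \<in> A" for s
    using conv[OF that] by (intro has_prod_imp_tendsto' convergent_prod_has_prod)
  thus "\<And>s. s \<in> A \<Longrightarrow> (\<lambda>N. \<Prod>n<N. f n s) \<longlonglongrightarrow> (\<Prod>n. f n s)" .
  show "norm (\<Prod>n. f n s) \<le> exp (suminf b)" if s: "s \<in> A" for s
  proof (rule tendsto_upperbound)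
    show "(\<lambda>N. norm (\<Prod>n<N. f n s)) \<longlonglongrightarrow> norm (\<Prod>n. f n s)"
      by (intro tendsto_norm lim s)
    have nn: "b n \<ge> 0" for n using bound[OF s, of n] norm_ge_zero by (rule order_trans[rotated])
    have "norm (\<Prod>n<N. f n s) \<le> exp (suminf b)" for N
    proof -
      have "norm (\<Prod>n<N. f n s) = (\<Prod>n<N. norm (f n s))" by (simp add: prod_norm)
      also have "\<dots> \<le> (\<Prod>n<N. exp (b n))"
      proof (rule prod_mono, safe)
        fix n
        have "norm (f n s) \<le> norm (f n s - 1) + 1"
          using norm_triangle_ineq[of "f n s - 1" 1] by simp
        also have "\<dots> \<le> 1 + b n" using bound[OF s, of n] by simp
        also have "\<dots> \<le> exp (b n)" by (rule exp_ge_add_one_self)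
        finally show "norm (f n s) \<le> exp (b n)" .
      qed auto
      also have "\<dots> = exp (\<Sum>n<N. b n)" by (simp add: exp_sum)
      also have "\<dots> \<le> exp (suminf b)"
        using b nn by (simp add: sum_le_suminf)
      finally show ?thesis .
    qed
    thus "\<forall>\<^sub>F N in sequentially. norm (\<Prod>n<N. f n s) \<le> exp (suminf b)" by simp
  qed simp
  show "(\<lambda>s. \<Prod>n. f n s) holomorphic_on A"
  proof (rule holomorphic_uniform_sequence[OF A])
    show "(\<lambda>s. \<Prod>n<N. f n s) holomorphic_on A" for N
      by (intro holomorphic_intros holo)
    fix s assume "s \<in> A"
    then obtain d where d: "d > 0" "cball s d \<subseteq> A" using A open_contains_cball by blast
    have "uniformly_convergent_on (cball s d) (\<lambda>N x. \<Prod>n<N. f n x)"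
    proof (rule uniformly_convergent_on_prod')
      show "continuous_on (cball s d) (f n)" for n
        using holo[of n] d holomorphic_on_imp_continuous_on continuous_on_subset by blast
      show "uniformly_convergent_on (cball s d) (\<lambda>N x. \<Sum>n<N. norm (f n x - 1))"
        by (rule Weierstrass_m_test'[where M = b]) (use d bound b in auto)
    qed auto
    hence "uniform_limit (cball s d) (\<lambda>N x. \<Prod>n<N. f n x) (\<lambda>x. lim (\<lambda>N. \<Prod>n<N. f n x)) sequentially"
      using uniformly_convergent_uniform_limit_iff by blast
    hence "uniform_limit (cball s d) (\<lambda>N x. \<Prod>n<N. f n x) (\<lambda>x. \<Prod>n. f n x) sequentially"
      by (rule uniform_limit_cong'[THEN iffD1, rotated -1]) (use d lim in \<open>auto intro!: limI\<close>)
    thus "\<exists>d>0. cball s d \<subseteq> A \<and> uniform_limit (cball s d) (\<lambda>N x. \<Prod>n<N. f n x) (\<lambda>x. \<Prod>n. f n x) sequentially"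
      using d by blast
  qed
qed

lemma norm_nat_powr: "norm (of_nat n powr s :: complex) = real n powr Re s"
  by (subst norm_powr_real_powr) auto

text \<open>The number 3/5 lies just above 2^(-3/4), as the fourth powers 1/8 and 81/625
  show.\<close>

lemma norm_prime_powr_le:
  assumes "n \<ge> 2" "Re s > 3/4"
  shows "norm (of_nat n powr (-s) :: complex) \<le> 3/5"
proof -
  have "real n powr (- Re s) \<le> 2 powr (- Re s)"
    using assms by (intro powr_mono2') auto
  also have "\<dots> \<le> 2 powr (- (3/4))"
    using assms by (intro powr_mono) auto
  also have "\<dots> \<le> 3/5"
  proof -
    have "(2 powr (- (3/4))) ^ 4 = (2::real) powr (-3)"
      by (simp add: powr_power)
    also have "\<dots> = 1/8" by (simp add: powr_minus powr_numeral divide_simps)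
    also have "\<dots> \<le> (3/5)^4" by (simp add: power4_eq_xxxx)
    finally show ?thesis using power_mono_iff[of "2 powr (- (3/4))" "3/5::real" 4] by simp
  qed
  finally show ?thesis by (simp add: norm_nat_powr)
qed

text \<open>The Euler factor at n of the series of z^omega, multiplied by that of zeta^(-z).\<close>

definition corr_factor :: "complex \<Rightarrow> nat \<Rightarrow> complex \<Rightarrow> complex" where
  "corr_factor z n s = (if prime n then local_factor z (of_nat n powr (-s)) else 1)"

definition corr_prod :: "complex \<Rightarrow> complex \<Rightarrow> complex" where
  "corr_prod z s = (\<Prod>n. corr_factor z n s)"

text \<open>The exponent is twice 3/4, because the factor at p differs from 1 by a multiple of p^(-2
  Re s). No z occurs, which makes the later estimates uniform on the unit circle.\<close>

definition corr_bound :: real where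
  "corr_bound = exp (\<Sum>n. local_const * real n powr (-3/2))"

lemma
  assumes z: "norm z = 1"
  shows corr_prod_holomorphic: "corr_prod z holomorphic_on {s. Re s > 3/4}"
    and corr_factor_convergent: "\<And>s. Re s > 3/4 \<Longrightarrow> convergent_prod (\<lambda>n. corr_factor z n s)"
    and corr_prod_LIMSEQ: "\<And>s. Re s > 3/4 \<Longrightarrow> (\<lambda>N. \<Prod>n<N. corr_factor z n s) \<longlonglongrightarrow> corr_prod z s"
    and norm_corr_prod_le: "\<And>s. Re s > 3/4 \<Longrightarrow> norm (corr_prod z s) \<le> corr_bound"
proof -
  let ?A = "{s. Re s > 3/4}"
  have op: "open ?A" by (rule open_halfspace_Re_gt)
  have holo: "corr_factor z n holomorphic_on ?A" for n
  proof (cases "prime n")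
    case True
    hence n: "n \<ge> 2" by (rule prime_ge_2_nat)
    have "local_factor z holomorphic_on ball 0 1"
      using has_field_derivative_local_factor
      by (subst holomorphic_on_open[OF open_ball], intro ballI)
         (simp only: mem_ball_0, blast)
    hence "(local_factor z \<circ> (\<lambda>s. of_nat n powr (-s))) holomorphic_on ?A"
    proof (rule holomorphic_on_compose_gen[rotated])
      show "(\<lambda>s. of_nat n powr (-s) :: complex) ` ?A \<subseteq> ball 0 1"
        using norm_prime_powr_le[OF n] by force
      show "(\<lambda>s. of_nat n powr (-s) :: complex) holomorphic_on ?A"
        using n by (intro holomorphic_intros) auto
    qed
    thus ?thesis using True by (simp add: corr_factor_def[abs_def] o_def)
  next
    case False
    thus ?thesis by (simp add: corr_factor_def[abs_def])
  qed
  have bd: "norm (corr_factor z n s - 1) \<le> local_const * real n powr (-3/2)" if "s \<in> ?A" for n s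
  proof (cases "prime n")
    case True
    hence n: "n \<ge> 2" by (rule prime_ge_2_nat)
    have "norm (corr_factor z n s - 1) \<le> local_const * norm (of_nat n powr (-s) :: complex) ^ 2"
      unfolding corr_factor_def using True norm_prime_powr_le[OF n] that z
      by (auto intro!: local_factor_bound)
    also have "norm (of_nat n powr (-s) :: complex) ^ 2 = real n powr (-2 * Re s)"
      by (simp add: norm_nat_powr power2_eq_square flip: powr_add)
    also have "\<dots> \<le> real n powr (-3/2)" using n that by (intro powr_mono) auto
    finally show ?thesis by (simp add: local_const_def)
  qed (auto simp: corr_factor_def local_const_def)
  have sm: "summable (\<lambda>n. local_const * real n powr (-3/2))"
    by (intro summable_mult) (simp add: summable_real_powr_iff)
  note P = infinite_prod_holomorphic[where f = "corr_factor z", OF op holo bd sm]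
  show "corr_prod z holomorphic_on ?A" using P(1) by (simp add: corr_prod_def[abs_def])
  show "\<And>s. Re s > 3/4 \<Longrightarrow> convergent_prod (\<lambda>n. corr_factor z n s)"
    and "\<And>s. Re s > 3/4 \<Longrightarrow> (\<lambda>N. \<Prod>n<N. corr_factor z n s) \<longlonglongrightarrow> corr_prod z s"
    and "\<And>s. Re s > 3/4 \<Longrightarrow> norm (corr_prod z s) \<le> corr_bound"
    using P(2-4) by (auto simp: corr_prod_def corr_bound_def)
qed

section \<open>Euler products\<close>

definition omega_coeff :: "complex \<Rightarrow> nat \<Rightarrow> complex" where
  "omega_coeff z n = (if n = 0 then 0 else z ^ omega n)"

definition omega_series :: "complex \<Rightarrow> complex \<Rightarrow> complex" where
  "omega_series z s = (\<Sum>n. omega_coeff z n * of_nat n powr (-s))"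

text \<open>As an instance of the series in z, zeta inherits its Euler product and
  factorization.\<close>

abbreviation zeta :: "complex \<Rightarrow> complex" where
  "zeta \<equiv> omega_series 1"

lemma norm_omega_coeff_le: "norm z \<le> 1 \<Longrightarrow> norm (omega_coeff z n) \<le> 1"
  by (simp add: omega_coeff_def norm_power power_le_one)

lemma norm_omega_series_term_le:
  assumes "norm z \<le> 1"
  shows "norm (omega_coeff z n * of_nat n powr (-s)) \<le> real n powr (- Re s)"
proof -
  have "norm (omega_coeff z n * of_nat n powr (-s)) \<le> 1 * real n powr (- Re s)"
    unfolding norm_mult norm_nat_powr using norm_omega_coeff_le[OF assms]
    by (intro mult_mono) auto
  thus ?thesis by simp
qed

lemma summable_nat_powr: "Re s > 1 \<Longrightarrow> summable (\<lambda>n. real n powr (- Re s))"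
  by (simp add: summable_real_powr_iff)

lemma summable_norm_omega_series:
  assumes "norm z \<le> 1" "Re s > 1"
  shows "summable (\<lambda>n. norm (omega_coeff z n * of_nat n powr (-s)))"
  by (rule summable_comparison_test'[OF summable_nat_powr[OF assms(2)], of 0])
     (use norm_omega_series_term_le[OF assms(1)] in simp)

section \<open>Summation over integers composed of finitely many primes\<close>

definition smooth_numbers :: "nat set \<Rightarrow> nat set" where
  "smooth_numbers S = {n. n > 0 \<and> prime_factors n \<subseteq> S}"

lemma smooth_numbers_empty: "smooth_numbers {} = {1}"
  by (auto simp: smooth_numbers_def prime_factorization_empty_iff)

lemma omega_prime_power_mult:
  assumes p: "prime p" "\<not> p dvd m" and m: "m > 0"
  shows "omega (p ^ k * m) = (if k = 0 then omega m else Suc (omega m))"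
proof (cases "k = 0")
  case False
  have "prime_factors (p ^ k * m) = prime_factors (p ^ k) \<union> prime_factors m"
    using p m by (subst prime_factors_product) auto
  also have "prime_factors (p ^ k) = {p}"
    using p False by (simp add: prime_factorization_prime_power)
  finally have "prime_factors (p ^ k * m) = insert p (prime_factors m)" by simp
  moreover have "p \<notin> prime_factors m" using p by auto
  ultimately show ?thesis using False by (simp add: omega_def)
qed simp

text \<open>The exponent k is recovered as the multiplicity of p, and m as the cofactor. This turns
  a sum over the larger set into a double sum.\<close>

lemma smooth_numbers_insert:
  assumes p: "prime p" "p \<notin> S"
  shows "bij_betw (\<lambda>(k, m). p ^ k * m) (UNIV \<times> smooth_numbers S) (smooth_numbers (insert p S))"
proof (rule bij_betwI')
  have nd: "\<not> p dvd m" "m > 0" if "m \<in> smooth_numbers S" for m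
    using that p by (auto simp: smooth_numbers_def prime_factors_dvd)
  fix x y :: "nat \<times> nat" assume x: "x \<in> UNIV \<times> smooth_numbers S" and y: "y \<in> UNIV \<times> smooth_numbers S"
  obtain k m where x': "x = (k :: nat, m)" "m \<in> smooth_numbers S" using x by auto
  obtain l n where y': "y = (l :: nat, n)" "n \<in> smooth_numbers S" using y by auto
  have mult: "multiplicity p (p ^ k * m) = k" "multiplicity p (p ^ l * n) = l"
    using nd[OF x'(2)] nd[OF y'(2)] p prime_gt_0_nat[OF p(1)]
    by (subst prime_elem_multiplicity_mult_distrib; simp add: not_dvd_imp_multiplicity_0)+
  show "(case x of (k, m) \<Rightarrow> p ^ k * m) = (case y of (k, m) \<Rightarrow> p ^ k * m) \<longleftrightarrow> x = y"
  proof
    assume e: "(case x of (k, m) \<Rightarrow> p ^ k * m) = (case y of (k, m) \<Rightarrow> p ^ k * m)"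
    hence "k = l" using x' y' mult by (metis old.prod.case)
    moreover from this have "m = n" using e x' y' prime_gt_0_nat[OF p(1)] by simp
    ultimately show "x = y" using x' y' by simp
  qed simp
next
  fix x :: "nat \<times> nat" assume x: "x \<in> UNIV \<times> smooth_numbers S"
  then obtain k m where x': "x = (k :: nat, m)" "m > 0" "prime_factors m \<subseteq> S"
    by (auto simp: smooth_numbers_def)
  have "prime_factors (p ^ k * m) \<subseteq> insert p S"
    using x' p prime_gt_0_nat[OF p(1)]
    by (auto simp: prime_factors_product prime_factorization_prime_power split: if_splits)
  thus "(case x of (k, m) \<Rightarrow> p ^ k * m) \<in> smooth_numbers (insert p S)"
    using x' prime_gt_0_nat[OF p(1)] by (simp add: smooth_numbers_def)
next
  fix n assume n: "n \<in> smooth_numbers (insert p S)"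
  hence n0: "n > 0" by (simp add: smooth_numbers_def)
  obtain m where m: "n = p ^ multiplicity p n * m" "\<not> p dvd m"
    using n0 p(1) by (metis multiplicity_decompose' not_prime_unit not_gr_zero)
  have "prime_factors m \<subseteq> prime_factors n"
    using m(1) n0 by (metis dvd_prime_factors dvd_triv_right not_gr_zero)
  moreover have "m > 0" using n0 m(1) by (metis gr0I mult_0_right)
  ultimately have "m \<in> smooth_numbers S"
    using n m p unfolding smooth_numbers_def by (auto simp: in_prime_factors_iff)
  thus "\<exists>x\<in>UNIV \<times> smooth_numbers S. n = (case x of (k, m) \<Rightarrow> p ^ k * m)"
    using m(1) by (intro bexI[of _ "(multiplicity p n, m)"]) auto
qed

definition omega_factor :: "complex \<Rightarrow> nat \<Rightarrow> complex \<Rightarrow> complex" where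
  "omega_factor z p s = (if prime p then 1 + z * of_nat p powr (-s) / (1 - of_nat p powr (-s)) else 1)"

text \<open>Adjoining p to S multiplies the sum by a geometric series in q = p^(-s), in which all
  terms with k > 0 carry one factor z, since omega counts p once. Unordered sums are used because
  the bijection with pairs (k, m) does not respect the order of the integers.\<close>

lemma has_sum_smooth_numbers:
  assumes z: "norm z \<le> 1" and s: "Re s > 1" and S: "finite S" "\<And>p. p \<in> S \<Longrightarrow> prime p"
  shows "((\<lambda>n. omega_coeff z n * of_nat n powr (-s)) has_sum (\<Prod>p\<in>S. omega_factor z p s)) (smooth_numbers S)"
  using S
proof (induction S rule: finite_induct)
  case empty
  show ?case
    using has_sum_finite[of "{1::nat}" "\<lambda>n. omega_coeff z n * of_nat n powr (-s)"]
    by (simp add: smooth_numbers_empty omega_coeff_def omega_def)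
next
  case (insert p S)
  define P where "P = (\<Prod>p\<in>S. omega_factor z p s)"
  define f where "f = (\<lambda>n. omega_coeff z n * of_nat n powr (-s))"
  define q where "q = (of_nat p powr (-s) :: complex)"
  have p: "prime p" using insert by auto
  have p2: "p \<ge> 2" using p by (rule prime_ge_2_nat)
  have q: "norm q < 1" using norm_prime_powr_le[OF p2, of s] s by (simp add: q_def)
  have IH: "(f has_sum P) (smooth_numbers S)"
    unfolding f_def P_def using insert by auto
  note bij = smooth_numbers_insert[OF p \<open>p \<notin> S\<close>]
  have nd: "\<not> p dvd m" "m > 0" if "m \<in> smooth_numbers S" for m
    using that p \<open>p \<notin> S\<close> by (auto simp: smooth_numbers_def prime_factors_dvd)
  have fp: "f (p ^ k * m) = (if k = 0 then 1 else z) * q ^ k * f m" if "m \<in> smooth_numbers S" for k m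
  proof -
    have "(of_nat (p ^ k * m) :: complex) powr (-s) = of_nat (p ^ k) powr (-s) * of_nat m powr (-s)"
      by (simp only: of_nat_mult) (rule powr_times_real; simp)
    also have "of_nat (p ^ k) powr (-s) = q ^ k"
      unfolding q_def using p2 by (induction k) (simp_all add: powr_times_real)
    finally show ?thesis
      using nd[OF that] p2 omega_prime_power_mult[OF p nd[OF that], of k]
      by (auto simp: f_def omega_coeff_def)
  qed
  have summ: "f summable_on A" for A
    using norm_summable_imp_summable_on[OF summable_norm_omega_series[OF z s]] summable_on_subset_banach
    unfolding f_def by blast
  have "((\<lambda>k. (if k = 0 then 1 else z) * q ^ k * P) has_sum (1 + z * q / (1 - q)) * P) UNIV"
  proof (rule norm_summable_imp_has_sum)
    have g: "(\<lambda>k. q ^ k) sums (1 / (1 - q))" using geometric_sums[OF q] .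
    \<comment> \<open>This is z times the geometric series, corrected by 1 - z at k = 0.\<close>
    have "(\<lambda>k. z * q ^ k + (if k = 0 then 1 - z else 0)) sums (z * (1 / (1 - q)) + (1 - z))"
      by (intro sums_add sums_mult g sums_single[of 0 "\<lambda>_. 1 - z"])
    also have "(\<lambda>k. z * q ^ k + (if k = 0 then 1 - z else 0)) = (\<lambda>k. (if k = 0 then 1 else z) * q ^ k)"
      by auto
    also have "z * (1 / (1 - q)) + (1 - z) = 1 + z * q / (1 - q)"
      using q by (cases "q = 1") (auto simp: field_simps)
    finally show "(\<lambda>k. (if k = 0 then 1 else z) * q ^ k * P) sums ((1 + z * q / (1 - q)) * P)"
      by (rule sums_mult2)
    show "summable (\<lambda>k. norm ((if k = 0 then 1 else z) * q ^ k * P))"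
    proof (rule summable_comparison_test')
      show "summable (\<lambda>k. norm q ^ k * norm P)"
        using q by (intro summable_mult2 summable_geometric) auto
      show "norm (norm ((if k = 0 then 1 else z) * q ^ k * P)) \<le> norm q ^ k * norm P" if "k \<ge> 0" for k
        using z mult_left_le_one_le[of "norm q ^ k * norm P" "norm z"]
        by (simp add: norm_mult norm_power mult.assoc)
    qed
  qed
  moreover have "((\<lambda>m. f (p ^ k * m)) has_sum ((if k = 0 then 1 else z) * q ^ k * P)) (smooth_numbers S)" for k
  proof -
    have "((\<lambda>m. (if k = 0 then 1 else z) * q ^ k * f m) has_sum ((if k = 0 then 1 else z) * q ^ k * P))
      (smooth_numbers S)"
      by (rule has_sum_cmult_right[OF IH])
    thus ?thesis by (rule has_sum_cong[THEN iffD1, rotated]) (simp add: fp)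
  qed
  moreover have "(\<lambda>(k, m). f (p ^ k * m)) summable_on UNIV \<times> smooth_numbers S"
    using summable_on_reindex_bij_betw[OF bij, of f] summ by (simp add: case_prod_unfold)
  ultimately have "((\<lambda>(k, m). f (p ^ k * m)) has_sum ((1 + z * q / (1 - q)) * P)) (UNIV \<times> smooth_numbers S)"
    by (intro has_sum_SigmaI[where g = "\<lambda>k. (if k = 0 then 1 else z) * q ^ k * P"]) auto
  hence "(f has_sum ((1 + z * q / (1 - q)) * P)) (smooth_numbers (insert p S))"
    using has_sum_reindex_bij_betw[OF bij, of f] by (simp add: case_prod_unfold)
  moreover have "(\<Prod>p\<in>insert p S. omega_factor z p s) = (1 + z * q / (1 - q)) * P"
    using insert p by (simp add: P_def omega_factor_def q_def)
  ultimately show ?case by (simp add: f_def)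
qed

text \<open>The product over primes below N is the sum of the series over the integers without
  larger prime factors. These sets exhaust the positive integers, and Tannery's theorem applies with
  the absolutely convergent series as majorant.\<close>

theorem omega_series_euler_product:
  assumes z: "norm z \<le> 1" and s: "Re s > 1"
  shows "(\<lambda>N. \<Prod>p<N. omega_factor z p s) \<longlonglongrightarrow> omega_series z s"
proof -
  define f where "f = (\<lambda>n. omega_coeff z n * of_nat n powr (-s))"
  define S where "S = (\<lambda>N. smooth_numbers {p. prime p \<and> p < N})"
  define a where "a = (\<lambda>n N. if n \<in> S N then f n else 0)"
  have 1: "(\<Prod>p<N. omega_factor z p s) = suminf (\<lambda>n. a n N)" for N
  proof -
    have "(\<Prod>p<N. omega_factor z p s) = (\<Prod>p\<in>{p. prime p \<and> p < N}. omega_factor z p s)"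
      by (intro prod.mono_neutral_right) (auto simp: omega_factor_def)
    moreover have "(f has_sum (\<Prod>p\<in>{p. prime p \<and> p < N}. omega_factor z p s)) (S N)"
      unfolding S_def f_def by (rule has_sum_smooth_numbers[OF z s]) auto
    moreover have "((\<lambda>n. a n N) has_sum x) UNIV \<longleftrightarrow> (f has_sum x) (S N)" for x
      by (rule has_sum_cong_neutral) (auto simp: a_def)
    ultimately have "((\<lambda>n. a n N) has_sum (\<Prod>p<N. omega_factor z p s)) UNIV"
      by simp
    thus ?thesis using has_sum_imp_sums sums_unique by blast
  qed
  have "(\<lambda>N. suminf (\<lambda>n. a n N)) \<longlonglongrightarrow> suminf f"
  proof (rule tannerys_theorem[THEN conjunct2, THEN conjunct2])
    fix n
    show "(\<lambda>N. a n N) \<longlonglongrightarrow> f n"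
    proof (cases "n = 0")
      case False
      have "\<forall>\<^sub>F N in sequentially. a n N = f n"
        using eventually_gt_at_top[of n]
      proof eventually_elim
        case (elim N)
        have "prime_factors n \<subseteq> {p. prime p \<and> p < N}"
          using False elim by (auto simp: prime_factors_dvd dest!: dvd_imp_le)
        thus ?case using False by (simp add: a_def S_def smooth_numbers_def)
      qed
      thus ?thesis by (rule tendsto_eventually)
    next
      case True
      thus ?thesis by (simp add: a_def S_def smooth_numbers_def f_def omega_coeff_def)
    qed
  next
    show "summable (\<lambda>n. norm (f n))"
      using summable_norm_omega_series[OF z s] by (simp add: f_def)
    show "\<forall>\<^sub>F (k, N) in sequentially \<times>\<^sub>F sequentially. norm (a k N) \<le> norm (f k)"
      by (intro always_eventually) (auto simp: a_def)
  qed simp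
  thus ?thesis by (simp add: 1 f_def omega_series_def)
qed

text \<open>In contrast to the version for products, the majorant may depend on the point, since the
  series in question are dominated only at a distance from the boundary line.\<close>

lemma infinite_sum_holomorphic:
  fixes f :: "nat \<Rightarrow> complex \<Rightarrow> complex"
  assumes A: "open A" and holo: "\<And>n. f n holomorphic_on A"
    and bound: "\<And>s. s \<in> A \<Longrightarrow> \<exists>d>0. \<exists>b. cball s d \<subseteq> A \<and> summable b \<and> (\<forall>w\<in>cball s d. \<forall>n. norm (f n w) \<le> b n)"
  shows "(\<lambda>s. \<Sum>n. f n s) holomorphic_on A"
proof (rule holomorphic_uniform_sequence[OF A])
  show "(\<lambda>s. \<Sum>n<N. f n s) holomorphic_on A" for N
    by (intro holomorphic_intros holo)
  fix s assume "s \<in> A"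
  from bound[OF this] obtain d b where d: "d > 0" "cball s d \<subseteq> A" "summable b"
    "\<And>w n. w \<in> cball s d \<Longrightarrow> norm (f n w) \<le> b n" by blast
  have "uniform_limit (cball s d) (\<lambda>N x. \<Sum>n<N. f n x) (\<lambda>x. \<Sum>n. f n x) sequentially"
    by (rule Weierstrass_m_test[OF d(4) d(3)])
  thus "\<exists>d>0. cball s d \<subseteq> A \<and> uniform_limit (cball s d) (\<lambda>N x. \<Sum>n<N. f n x) (\<lambda>x. \<Sum>n. f n x) sequentially"
    using d by blast
qed

section \<open>A logarithm of zeta in the half-plane of convergence\<close>

definition prime_log :: "complex \<Rightarrow> nat \<Rightarrow> complex" where
  "prime_log s n = (if prime n then - Ln (1 - of_nat n powr (-s)) else 0)"

text \<open>Adding the principal logarithms of the Euler factors gives a holomorphic branch, whereas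
  \<open>Ln (zeta s)\<close> would jump wherever zeta s crosses the negative axis.\<close>

definition log_zeta :: "complex \<Rightarrow> complex" where
  "log_zeta s = (\<Sum>n. prime_log s n)"

lemma norm_prime_powr_less_half:
  assumes "n \<ge> 2" "Re s > 1"
  shows "norm (of_nat n powr (-s) :: complex) < 1/2"
proof -
  have "real n powr (- Re s) \<le> 2 powr (- Re s)"
    using assms by (intro powr_mono2') auto
  also have "\<dots> < 2 powr (- 1)"
    using assms by (intro powr_less_mono) auto
  also have "2 powr (- 1) = (1/2 :: real)" by (simp add: powr_minus)
  finally show ?thesis by (simp add: norm_nat_powr)
qed

lemma norm_prime_log_le:
  assumes "Re s > 1"
  shows "norm (prime_log s n) \<le> 2 * real n powr (- Re s)"
proof (cases "prime n")
  case True
  have "norm (Ln (1 + (- (of_nat n powr (-s)) :: complex))) \<le> 2 * norm (- (of_nat n powr (-s)) :: complex)"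
    by (rule norm_Ln_le) (use norm_prime_powr_less_half[of n s] True assms prime_ge_2_nat in auto)
  thus ?thesis using True by (simp add: prime_log_def norm_nat_powr)
qed (auto simp: prime_log_def)

lemma summable_prime_log:
  assumes "Re s > 1"
  shows "summable (prime_log s)" "summable (\<lambda>n. norm (prime_log s n))"
proof -
  show "summable (\<lambda>n. norm (prime_log s n))"
    by (rule summable_comparison_test'[where g = "\<lambda>n. 2 * real n powr (- Re s)" and N = 0])
       (use norm_prime_log_le[OF assms] in \<open>auto intro!: summable_mult simp: summable_nat_powr assms summable_real_powr_iff\<close>)
  thus "summable (prime_log s)" by (rule summable_norm_cancel)
qed

lemma log_zeta_holomorphic: "log_zeta holomorphic_on {s. Re s > 1}"
proof -
  have "(\<lambda>s. \<Sum>n. prime_log s n) holomorphic_on {s. Re s > 1}"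
  proof (rule infinite_sum_holomorphic)
    show "open {s. Re s > 1}" by (rule open_halfspace_Re_gt)
    show "(\<lambda>s. prime_log s n) holomorphic_on {s. Re s > 1}" for n
    proof (cases "prime n")
      case True
      have "1 - of_nat n powr (-s) \<notin> \<real>\<^sub>\<le>\<^sub>0" if "Re s > 1" for s :: complex
      proof -
        have "norm (of_nat n powr (-s) :: complex) < 1/2"
          using norm_prime_powr_less_half True prime_ge_2_nat that by blast
        hence "Re (1 - of_nat n powr (-s)) > 0"
          using complex_Re_le_cmod[of "of_nat n powr (-s)"] by simp
        thus ?thesis using complex_nonpos_Reals_iff by force
      qed
      thus ?thesis using True prime_gt_0_nat[OF True] unfolding prime_log_def
        by (auto intro!: holomorphic_intros)
    qed (simp add: prime_log_def)
  next
    fix s :: complex assume "s \<in> {s. Re s > 1}"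
    hence s: "Re s > 1" by simp
    define d where "d = (Re s - 1) / 2"
    have w: "Re w \<ge> 1 + d" if "w \<in> cball s d" for w
      using that abs_Re_le_cmod[of "s - w"] unfolding mem_cball dist_norm d_def by (simp add: field_simps)
    have d: "d > 0" using s by (simp add: d_def)
    have "norm (prime_log w n) \<le> 2 * real n powr (- (1 + d))" if "w \<in> cball s d" for w n
    proof -
      have "norm (prime_log w n) \<le> 2 * real n powr (- Re w)"
        using norm_prime_log_le w[OF that] d by simp
      also have "real n powr (- Re w) \<le> real n powr (- (1 + d))"
        using w[OF that] by (cases "n = 0") (auto intro!: powr_mono)
      finally show ?thesis by simp
    qed
    moreover have "cball s d \<subseteq> {s. Re s > 1}" using w d by force
    moreover have "summable (\<lambda>n. 2 * real n powr (- (1 + d)))"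
      using d by (intro summable_mult) (simp add: summable_real_powr_iff)
    ultimately show "\<exists>d>0. \<exists>b. cball s d \<subseteq> {s. 1 < Re s} \<and> summable b \<and> (\<forall>w\<in>cball s d. \<forall>n. cmod (prime_log w n) \<le> b n)"
      using d by blast
  qed
  thus ?thesis by (simp add: log_zeta_def[abs_def])
qed

text \<open>The identity holds for each Euler factor, because \<open>exp (z * prime_log s p)\<close>
  cancels the exponential in \<open>local_factor\<close>; it remains to pass to the limit.\<close>

theorem omega_series_factorization:
  assumes z: "norm z = 1" and s: "Re s > 1"
  shows "omega_series z s = exp (z * log_zeta s) * corr_prod z s"
proof (rule LIMSEQ_unique)
  show "(\<lambda>N. \<Prod>p<N. omega_factor z p s) \<longlonglongrightarrow> omega_series z s"
    using omega_series_euler_product z s by simp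
  have "(\<lambda>N. exp (z * (\<Sum>p<N. prime_log s p)) * (\<Prod>p<N. corr_factor z p s)) \<longlonglongrightarrow> exp (z * log_zeta s) * corr_prod z s"
    unfolding log_zeta_def
    by (intro tendsto_intros summable_LIMSEQ summable_prime_log s corr_prod_LIMSEQ z) (use s in auto)
  moreover have "exp (z * (\<Sum>p<N. prime_log s p)) * (\<Prod>p<N. corr_factor z p s) = (\<Prod>p<N. omega_factor z p s)" for N
  proof -
    have "exp (z * prime_log s p) * corr_factor z p s = omega_factor z p s" for p
      by (simp add: prime_log_def corr_factor_def omega_factor_def local_factor_def exp_minus)
    thus ?thesis by (simp add: sum_distrib_left exp_sum flip: prod.distrib)
  qed
  ultimately show "(\<lambda>N. \<Prod>p<N. omega_factor z p s) \<longlonglongrightarrow> exp (z * log_zeta s) * corr_prod z s" by simp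
qed

text \<open>For z = 1 the local factor is (1 - q) (1 + q / (1 - q)) = 1. The factorization then says
  that \<open>log_zeta\<close> is indeed a logarithm of zeta.\<close>

lemma corr_prod_1:
  assumes "Re s > 3/4" shows "corr_prod 1 s = 1"
proof -
  have "corr_factor 1 n s = 1" for n
  proof (cases "prime n")
    case True
    have "norm (of_nat n powr (-s) :: complex) \<le> 3/5"
      using norm_prime_powr_le True prime_ge_2_nat assms by blast
    hence "of_nat n powr (-s) \<noteq> (1 :: complex)" by auto
    thus ?thesis using True by (simp add: corr_factor_def local_factor_def field_simps)
  qed (simp add: corr_factor_def)
  thus ?thesis by (simp add: corr_prod_def)
qed

lemma exp_log_zeta:
  assumes "Re s > 1" shows "exp (log_zeta s) = zeta s"
  using omega_series_factorization[of 1 s] corr_prod_1[of s] assms by simp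

text \<open>The term with k = 0 is a division by zero, hence 0, so the sum effectively begins at k =
  1.\<close>

lemma neg_Ln_sums:
  assumes "norm (q :: complex) < 1"
  shows "(\<lambda>k. q ^ k / of_nat k) sums (- Ln (1 - q))"
  using sums_minus[OF Ln_series'[of "-q"]] assms by simp

lemma neg_ln_sums:
  assumes "0 \<le> r" "r < 1"
  shows "(\<lambda>k. r ^ k / of_nat k) sums (- ln (1 - r :: real))"
  using sums_minus[OF ln_series'[of "-r"]] assms by simp

text \<open>The power series has nonnegative coefficients.\<close>

lemma norm_neg_Ln_le:
  assumes "norm q < 1"
  shows "norm (- Ln (1 - q)) \<le> - ln (1 - norm q)"
proof -
  have 1: "(\<lambda>k. norm q ^ k / of_nat k) sums (- ln (1 - norm q))"
    using assms by (intro neg_ln_sums) auto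
  have 2: "(\<lambda>k. q ^ k / of_nat k) sums (- Ln (1 - q))" by (rule neg_Ln_sums[OF assms])
  have 3: "(\<lambda>k. norm (q ^ k / of_nat k)) = (\<lambda>k. norm q ^ k / of_nat k)"
    by (simp add: norm_divide norm_power)
  have "norm (suminf (\<lambda>k. q ^ k / of_nat k)) \<le> suminf (\<lambda>k. norm (q ^ k / of_nat k))"
    by (rule summable_norm) (use 1 3 in \<open>simp add: sums_iff\<close>)
  thus ?thesis using 1 2 3 by (simp add: sums_iff)
qed

section \<open>The 3-4-1 inequality\<close>

lemma cos_341: "3 + 4 * cos x + cos (2 * x) \<ge> (0 :: real)"
proof -
  have "3 + 4 * cos x + cos (2 * x) = 2 * (1 + cos x)^2"
    unfolding cos_double_cos by (simp add: power2_eq_square algebra_simps)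
  thus ?thesis by simp
qed

text \<open>As a power series in r, the left side has the coefficients (3 + 4 cos(k \<theta>) +
  cos(2 k \<theta>)) / k, which are nonnegative by \<open>cos_341\<close>.\<close>

lemma Ln_341:
  fixes r \<theta> :: real
  assumes "0 \<le> r" "r < 1"
  shows "3 * (- ln (1 - r)) + 4 * Re (- Ln (1 - r * cis \<theta>)) + Re (- Ln (1 - r * cis (2 * \<theta>))) \<ge> 0"
proof -
  have c: "(\<lambda>k. r ^ k * cos (k * x) / of_nat k) sums Re (- Ln (1 - r * cis x))" for x :: real
  proof -
    have "(\<lambda>k. Re ((r * cis x) ^ k / of_nat k)) sums Re (- Ln (1 - r * cis x))"
      by (intro sums_Re neg_Ln_sums) (use assms in \<open>simp add: norm_mult\<close>)
    moreover have "Re ((r * cis x) ^ k / of_nat k) = r ^ k * cos (k * x) / of_nat k" for k :: nat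
    proof -
      have "(r * cis x) ^ k = of_real (r ^ k) * cis (k * x)"
        by (simp only: power_mult_distrib Complex.DeMoivre of_real_power)
      thus ?thesis by (simp only: Re_divide_of_nat) simp
    qed
    ultimately show ?thesis by (simp only:)
  qed
  have "(\<lambda>k. 3 * (r ^ k / of_nat k) + 4 * (r ^ k * cos (k * \<theta>) / of_nat k) + r ^ k * cos (k * (2 * \<theta>)) / of_nat k)
     sums (3 * (- ln (1 - r)) + 4 * Re (- Ln (1 - r * cis \<theta>)) + Re (- Ln (1 - r * cis (2 * \<theta>))))"
    by (intro sums_add sums_mult neg_ln_sums assms c)
  moreover have "3 * (r ^ k / of_nat k) + 4 * (r ^ k * cos (k * \<theta>) / of_nat k) + r ^ k * cos (k * (2 * \<theta>)) / of_nat k \<ge> 0" for k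
  proof -
    have "3 * (r ^ k / of_nat k) + 4 * (r ^ k * cos (k * \<theta>) / of_nat k) + r ^ k * cos (k * (2 * \<theta>)) / of_nat k
      = r ^ k / of_nat k * (3 + 4 * cos (k * \<theta>) + cos (2 * (k * \<theta>)))"
      by (simp add: algebra_simps add_divide_distrib)
    also have "\<dots> \<ge> 0" using assms cos_341 by (intro mult_nonneg_nonneg) auto
    finally show ?thesis .
  qed
  ultimately show ?thesis by (metis (no_types, lifting) sums_le sums_zero)
qed

lemma nat_powr_minus_Complex:
  assumes "n > 0"
  shows "(of_nat n :: complex) powr (- Complex \<sigma> t) = of_real (real n powr (-\<sigma>)) * cis (- t * ln n)"
proof -
  have "(of_nat n :: complex) powr (- Complex \<sigma> t) = exp (- Complex \<sigma> t * of_real (ln (real n)))"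
    using assms by (simp add: powr_def Ln_of_nat)
  also have "- Complex \<sigma> t * of_real (ln (real n)) = Complex (- \<sigma> * ln n) (- t * ln n)"
    by (simp add: complex_eq_iff)
  also have "exp \<dots> = of_real (real n powr (-\<sigma>)) * cis (- t * ln n)"
    using assms by (simp add: exp_eq_polar powr_def mult_ac)
  finally show ?thesis .
qed

lemma log_zeta_341:
  assumes "\<sigma> > 1"
  shows "3 * Re (log_zeta (of_real \<sigma>)) + 4 * Re (log_zeta (Complex \<sigma> t)) + Re (log_zeta (Complex \<sigma> (2 * t))) \<ge> 0"
proof -
  have R: "(\<lambda>n. Re (prime_log s n)) sums Re (log_zeta s)" if "Re s = \<sigma>" for s
    unfolding log_zeta_def using that assms by (intro sums_Re summable_sums summable_prime_log) auto
  have "(\<lambda>n. 3 * Re (prime_log (of_real \<sigma>) n) + 4 * Re (prime_log (Complex \<sigma> t) n) + Re (prime_log (Complex \<sigma> (2 * t)) n))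
    sums (3 * Re (log_zeta (of_real \<sigma>)) + 4 * Re (log_zeta (Complex \<sigma> t)) + Re (log_zeta (Complex \<sigma> (2 * t))))"
    by (intro sums_add sums_mult R) auto
  moreover have "3 * Re (prime_log (of_real \<sigma>) n) + 4 * Re (prime_log (Complex \<sigma> t) n) + Re (prime_log (Complex \<sigma> (2 * t)) n) \<ge> 0" for n
  proof (cases "prime n")
    case True
    hence n: "n \<ge> 2" by (rule prime_ge_2_nat)
    define r where "r = real n powr (-\<sigma>)"
    have r: "0 \<le> r" "r < 1"
      using norm_prime_powr_less_half[OF n, of "of_real \<sigma>"] assms by (auto simp: r_def norm_nat_powr)
    have p: "of_nat n powr (- Complex \<sigma> u) = of_real r * cis (- u * ln n)" for u
      using n by (simp add: r_def nat_powr_minus_Complex)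
    have "(of_nat n :: complex) powr (- of_real \<sigma>) = of_real r"
      using p[of 0] by (simp add: complex_of_real_def)
    moreover have "Ln (1 - of_real r) = of_real (ln (1 - r))"
      using r Ln_of_real[of "1 - r"] by simp
    ultimately show ?thesis
      \<comment> \<open>At the prime n the angle is - t ln n, the argument of n^(-s).\<close>
      using Ln_341[OF r, of "- t * ln n"] True p[of t] p[of "2 * t"]
      by (simp add: prime_log_def mult.assoc)
  qed (simp add: prime_log_def)
  ultimately show ?thesis by (metis (no_types, lifting) sums_le sums_zero)
qed

text \<open>For complex z the size of \<open>exp (z * log_zeta s)\<close> also depends on the
  imaginary part of the logarithm, so its norm has to be controlled and not only its real
  part.\<close>

lemma norm_log_zeta_le:
  assumes "Re s > 1"
  shows "norm (log_zeta s) \<le> Re (log_zeta (of_real (Re s)))"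
proof -
  have le: "norm (prime_log s n) \<le> Re (prime_log (of_real (Re s)) n)" for n
  proof (cases "prime n")
    case True
    hence n: "n \<ge> 2" by (rule prime_ge_2_nat)
    define r where "r = real n powr (- Re s)"
    have r: "norm (of_nat n powr (-s) :: complex) = r" by (simp add: r_def norm_nat_powr)
    have r1: "r < 1" using norm_prime_powr_less_half[OF n assms] r by simp
    have "(of_nat n :: complex) powr (- of_real (Re s)) = of_real r"
      using nat_powr_minus_Complex[of n "Re s" 0] n by (simp add: complex_of_real_def r_def)
    hence "Re (prime_log (of_real (Re s)) n) = - ln (1 - r)"
      using True r1 Ln_of_real[of "1 - r"] by (simp add: prime_log_def)
    thus ?thesis using norm_neg_Ln_le[of "of_nat n powr (-s)"] r r1 True
      by (simp add: prime_log_def)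
  qed (simp add: prime_log_def)
  have "norm (log_zeta s) \<le> (\<Sum>n. norm (prime_log s n))"
    unfolding log_zeta_def by (rule summable_norm) (rule summable_prime_log[OF assms])
  also have "\<dots> \<le> (\<Sum>n. Re (prime_log (of_real (Re s)) n))"
    using assms by (intro suminf_le le summable_prime_log summable_Re) auto
  also have "\<dots> = Re (log_zeta (of_real (Re s)))"
    unfolding log_zeta_def using assms by (intro sums_unique[symmetric] sums_Re summable_sums summable_prime_log) auto
  finally show ?thesis .
qed

section \<open>The zeta function near the line of abscissa 1\<close>

lemma norm_powr_diff_le:
  fixes s :: complex and a b :: real
  assumes "0 < a" "a \<le> b" "Re s \<ge> -1"
  shows "norm (of_real b powr (-s) - of_real a powr (-s) :: complex) \<le> norm s * a powr (- Re s - 1) * (b - a)"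
proof -
  let ?S = "closed_segment (complex_of_real a) (of_real b)"
  have S: "\<exists>x. w = of_real x \<and> a \<le> x" if "w \<in> ?S" for w
    using that assms by (auto simp: closed_segment_of_real closed_segment_eq_real_ivl)
  have "norm (of_real b powr (-s) - of_real a powr (-s) :: complex)
      \<le> (norm s * a powr (- Re s - 1)) * norm (of_real b - of_real a :: complex)"
  proof (rule field_differentiable_bound[of ?S])
    fix w assume "w \<in> ?S"
    then obtain x where x: "w = of_real x" "a \<le> x" using S by blast
    have "w \<notin> \<real>\<^sub>\<le>\<^sub>0" using x assms by (auto simp: complex_nonpos_Reals_iff)
    thus "((\<lambda>w. w powr (-s)) has_field_derivative (- s) * w powr (- s - 1)) (at w within ?S)"
      by (rule has_field_derivative_at_within[OF has_field_derivative_powr])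
    have "norm (w powr (- s - 1)) = x powr (- Re s - 1)"
      using x assms by (subst norm_powr_real_powr) auto
    also have "\<dots> \<le> a powr (- Re s - 1)" using x assms by (intro powr_mono2') auto
    finally show "norm (- s * w powr (- s - 1)) \<le> norm s * a powr (- Re s - 1)"
      by (simp add: norm_mult mult_left_mono)
  qed auto
  also have "norm (of_real b - of_real a :: complex) = b - a"
    using assms by (metis abs_of_nonneg diff_ge_0_iff_ge norm_of_real of_real_diff)
  finally show ?thesis .
qed

text \<open>With \<open>m = n + 1\<close>, the term is \<open>s - 1\<close> times the difference of \<open>m\<close> to the power \<open>-s\<close> and the
  integral of \<open>y\<close> to the power \<open>-s\<close> over \<open>[m, m + 1]\<close>.\<close>

definition zeta_term :: "nat \<Rightarrow> complex \<Rightarrow> complex" where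
  "zeta_term n s = (s - 1) * of_nat (Suc n) powr (-s) - of_nat (Suc n) powr (1 - s) + of_nat (Suc (Suc n)) powr (1 - s)"

text \<open>The term is the increment over [a, a + 1], with a = n + 1, of w^(1 - s) minus its
  tangent at a. The derivative of this difference vanishes at a, which gains a factor 1 / a.\<close>

lemma norm_zeta_term_le:
  assumes s: "Re s \<ge> 0"
  shows "norm (zeta_term n s) \<le> norm (s - 1) * norm s * real (Suc n) powr (- Re s - 1)"
proof -
  define a where "a = real (Suc n)"
  have a: "a > 0" by (simp add: a_def)
  let ?S = "closed_segment (complex_of_real a) (of_real (a + 1))"
  let ?f = "\<lambda>w. w powr (1 - s) - (1 - s) * of_real a powr (-s) * (w - of_real a)"
  have S: "\<exists>x. w = of_real x \<and> a \<le> x \<and> x \<le> a + 1" if "w \<in> ?S" for w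
    using that by (subst (asm) closed_segment_of_real) (auto simp: closed_segment_eq_real_ivl)
  have "norm (?f (of_real (a + 1)) - ?f (of_real a))
      \<le> (norm (s - 1) * (norm s * a powr (- Re s - 1))) * norm (of_real (a + 1) - of_real a :: complex)"
  proof (rule field_differentiable_bound[of ?S])
    fix w assume "w \<in> ?S"
    then obtain x where x: "w = of_real x" "a \<le> x" "x \<le> a + 1" using S by blast
    have nr: "w \<notin> \<real>\<^sub>\<le>\<^sub>0" using x a by (auto simp: complex_nonpos_Reals_iff)
    have p: "((\<lambda>w. w powr (1 - s)) has_field_derivative (1 - s) * w powr (1 - s - 1)) (at w)"
      by (rule has_field_derivative_powr[OF nr])
    have "(?f has_field_derivative (1 - s) * w powr (1 - s - 1) - (1 - s) * of_real a powr (-s) * (1 - 0)) (at w)"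
      by (intro DERIV_diff p DERIV_cmult DERIV_ident DERIV_const)
    also have "(1 - s) * w powr (1 - s - 1) - (1 - s) * of_real a powr (-s) * (1 - 0)
       = (1 - s) * (w powr (-s) - of_real a powr (-s))" by (simp add: algebra_simps)
    finally show "(?f has_field_derivative (1 - s) * (w powr (-s) - of_real a powr (-s))) (at w within ?S)"
      by (rule has_field_derivative_at_within)
    have "norm (w powr (-s) - of_real a powr (-s)) \<le> norm s * a powr (- Re s - 1) * (x - a)"
      unfolding x(1) using a x s by (intro norm_powr_diff_le) auto
    also have "\<dots> \<le> norm s * a powr (- Re s - 1) * 1"
      using x by (intro mult_left_mono) auto
    finally show "norm ((1 - s) * (w powr (-s) - of_real a powr (-s))) \<le> norm (s - 1) * (norm s * a powr (- Re s - 1))"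
      unfolding norm_mult by (simp add: norm_minus_commute mult_left_mono)
  qed auto
  also have "?f (of_real (a + 1)) - ?f (of_real a) = zeta_term n s"
    by (simp add: zeta_term_def a_def algebra_simps)
  finally show ?thesis by (simp add: a_def mult_ac)
qed

text \<open>This is (s - 1) zeta(s), continued to Re s > 0. The leading 1 is 1^(1 - s), the initial
  value of the telescoping sum in \<open>sum_zeta_term\<close>.\<close>

definition pole_free_zeta :: "complex \<Rightarrow> complex" where
  "pole_free_zeta s = 1 + (\<Sum>n. zeta_term n s)"

lemma summable_Suc_powr: "x > 0 \<Longrightarrow> summable (\<lambda>n. real (Suc n) powr (- x - 1))"
  using summable_Suc_iff[of "\<lambda>n. real n powr (- x - 1)"] by (simp add: summable_real_powr_iff)

lemma summable_zeta_term:
  assumes "Re s > 0"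
  shows "summable (\<lambda>n. zeta_term n s)"
proof (rule summable_comparison_test')
  show "summable (\<lambda>n. norm (s - 1) * norm s * real (Suc n) powr (- Re s - 1))"
    by (intro summable_mult summable_Suc_powr assms)
  show "norm (zeta_term n s) \<le> norm (s - 1) * norm s * real (Suc n) powr (- Re s - 1)" for n
    using assms by (intro norm_zeta_term_le) auto
qed

lemma pole_free_zeta_holomorphic: "pole_free_zeta holomorphic_on {s. Re s > 0}"
proof -
  have "(\<lambda>s. \<Sum>n. zeta_term n s) holomorphic_on {s. Re s > 0}"
  proof (rule infinite_sum_holomorphic)
    show "open {s. Re s > 0}" by (rule open_halfspace_Re_gt)
    show "zeta_term n holomorphic_on {s. Re s > 0}" for n
      unfolding zeta_term_def[abs_def] by (auto intro!: holomorphic_intros)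
    fix s :: complex assume "s \<in> {s. Re s > 0}"
    hence s: "Re s > 0" by simp
    define d where "d = Re s / 2"
    define K where "K = (norm s + d + 1) * (norm s + d)"
    have w: "Re w \<ge> d" "norm w \<le> norm s + d" if "w \<in> cball s d" for w
      using that abs_Re_le_cmod[of "s - w"] norm_triangle_ineq2[of w s]
      unfolding mem_cball dist_norm d_def by (simp_all add: field_simps norm_minus_commute)
    have d: "d > 0" using s by (simp add: d_def)
    have "norm (zeta_term n w) \<le> K * real (Suc n) powr (- d - 1)" if "w \<in> cball s d" for w n
    proof -
      have "norm (zeta_term n w) \<le> norm (w - 1) * norm w * real (Suc n) powr (- Re w - 1)"
        using w[OF that] d by (intro norm_zeta_term_le) auto
      also have "\<dots> \<le> K * real (Suc n) powr (- d - 1)"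
        unfolding K_def using w[OF that] norm_triangle_ineq4[of w 1] d
        by (intro mult_mono powr_mono) auto
      finally show ?thesis .
    qed
    moreover have "cball s d \<subseteq> {s. Re s > 0}" using w d by force
    moreover have "summable (\<lambda>n. K * real (Suc n) powr (- d - 1))"
      by (intro summable_mult summable_Suc_powr d)
    ultimately show "\<exists>d>0. \<exists>b. cball s d \<subseteq> {s. 0 < Re s} \<and> summable b \<and> (\<forall>w\<in>cball s d. \<forall>n. cmod (zeta_term n w) \<le> b n)"
      using d by blast
  qed
  thus ?thesis unfolding pole_free_zeta_def[abs_def] by (intro holomorphic_intros)
qed

lemma pole_free_zeta_1: "pole_free_zeta 1 = 1"
  by (simp add: pole_free_zeta_def zeta_term_def del: of_nat_Suc)

lemma sum_zeta_term:
  "1 + (\<Sum>n<N. zeta_term n s) = (s - 1) * (\<Sum>n<N. of_nat (Suc n) powr (-s)) + of_nat (Suc N) powr (1 - s)"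
  by (induction N) (simp_all add: zeta_term_def algebra_simps)

lemma pole_free_zeta_eq:
  assumes "Re s > 1"
  shows "pole_free_zeta s = (s - 1) * zeta s"
proof (rule LIMSEQ_unique)
  show "(\<lambda>N. 1 + (\<Sum>n<N. zeta_term n s)) \<longlonglongrightarrow> pole_free_zeta s"
    unfolding pole_free_zeta_def using assms
    by (intro tendsto_intros summable_LIMSEQ summable_zeta_term) auto
  have 1: "(\<lambda>N. (\<Sum>n<N. of_nat (Suc n) powr (-s))) \<longlonglongrightarrow> zeta s"
  proof -
    have "(\<lambda>n. omega_coeff 1 n * of_nat n powr (-s)) sums zeta s"
      unfolding omega_series_def using assms
      by (intro summable_sums summable_norm_cancel[OF summable_norm_omega_series]) auto
    hence "(\<lambda>n. omega_coeff 1 (Suc n) * of_nat (Suc n) powr (-s)) sums zeta s"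
      by (subst sums_Suc_iff) simp
    thus ?thesis by (simp add: sums_def omega_coeff_def)
  qed
  have 2: "(\<lambda>N. of_nat (Suc N) powr (1 - s) :: complex) \<longlonglongrightarrow> 0"
  proof (rule tendsto_norm_zero_cancel)
    have "(\<lambda>N. real N powr (1 - Re s)) \<longlonglongrightarrow> 0"
      by (rule tendsto_neg_powr) (use assms in \<open>auto intro: filterlim_real_sequentially\<close>)
    hence "(\<lambda>N. real (Suc N) powr (1 - Re s)) \<longlonglongrightarrow> 0" by (rule LIMSEQ_Suc)
    thus "(\<lambda>N. norm (of_nat (Suc N) powr (1 - s) :: complex)) \<longlonglongrightarrow> 0"
      by (simp only: norm_nat_powr) simp
  qed
  have "(\<lambda>N. (s - 1) * (\<Sum>n<N. of_nat (Suc n) powr (-s)) + of_nat (Suc N) powr (1 - s)) \<longlonglongrightarrow> (s - 1) * zeta s + 0"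
    by (intro tendsto_intros 1 2)
  thus "(\<lambda>N. 1 + (\<Sum>n<N. zeta_term n s)) \<longlonglongrightarrow> (s - 1) * zeta s"
    by (simp only: sum_zeta_term) simp
qed

section \<open>Growth of zeta and its logarithm in the vertical direction\<close>

definition log_height :: "real \<Rightarrow> real" where "log_height t = ln (\<bar>t\<bar> + 8)"

text \<open>The shift by 8 in \<open>log_height\<close> exceeds e^2. So its powers increase with the
  exponent, and the strip of width 1 / \<open>log_height t\<close> to the left of abscissa 1 stays
  in Re s \<ge> 1/2.\<close>

lemma log_height_ge: "log_height t \<ge> 2"
proof -
  have "exp 1 \<le> (272/100 :: real)" using e_less_272 by simp
  hence "exp (1::real) ^ 2 \<le> (272/100) ^ 2" by (intro power_mono) auto
  hence "exp (2::real) \<le> 8" by (simp add: power2_eq_square flip: exp_add)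
  hence "exp 2 \<le> \<bar>t\<bar> + 8" by simp
  thus ?thesis unfolding log_height_def by (subst ln_ge_iff) auto
qed

lemma exp_log_height: "exp (log_height t) = \<bar>t\<bar> + 8"
  by (simp add: log_height_def)

lemma powr_diff_ge:
  fixes x m :: real
  assumes "x > 0" "m > 1"
  shows "m powr (-x - 1) \<le> ((m - 1) powr (-x) - m powr (-x)) / x"
proof -
  have "\<exists>z>m-1. z < m \<and> m powr (-x) - (m - 1) powr (-x) = (m - (m - 1)) * (-x * z powr (-x - 1))"
    using assms by (intro MVT2) (auto intro!: derivative_eq_intros)
  then obtain z where z: "z > m - 1" "z < m" "m powr (-x) - (m - 1) powr (-x) = -x * z powr (-x - 1)" by auto
  have "m powr (-x - 1) \<le> z powr (-x - 1)" using z assms by (intro powr_mono2') auto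
  also have "\<dots> = ((m - 1) powr (-x) - m powr (-x)) / x" using z(3) assms by (simp add: field_simps)
  finally show ?thesis .
qed

text \<open>Comparison with the integral, in the telescoping form given by
  \<open>powr_diff_ge\<close>.\<close>

lemma sum_powr_tail_le:
  fixes x :: real
  assumes "x > 0" "N > 0"
  shows "(\<Sum>n. real (Suc (n + N)) powr (- x - 1)) \<le> real N powr (-x) / x"
proof (rule suminf_le_const)
  show "summable (\<lambda>n. real (Suc (n + N)) powr (- x - 1))"
    using summable_ignore_initial_segment[OF summable_Suc_powr[OF assms(1)], of N] by simp
  fix M
  have "(\<Sum>n<M. real (Suc (n + N)) powr (- x - 1)) \<le> (\<Sum>n<M. (real (n + N) powr (-x) - real (Suc n + N) powr (-x)) / x)"
    using powr_diff_ge[OF assms(1), of "real (Suc (n + N))" for n] assms(2)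
    by (intro sum_mono) (simp add: add_ac)
  also have "\<dots> = (real N powr (-x) - real (M + N) powr (-x)) / x"
    unfolding sum_divide_distrib[symmetric] by (subst sum_lessThan_telescope') simp
  also have "\<dots> \<le> real N powr (-x) / x" using assms by (intro divide_right_mono) auto
  finally show "(\<Sum>n<M. real (Suc (n + N)) powr (- x - 1)) \<le> real N powr (-x) / x" .
qed

lemma harm_le: "n > 0 \<Longrightarrow> (harm n :: real) \<le> 1 + ln (real n)"
proof -
  assume "n > 0"
  then obtain m where m: "n = Suc m" by (cases n) auto
  have "harm (Suc m) - ln (real (Suc m)) \<le> harm (Suc 0) - ln (real (Suc 0))"
    using decseqD[OF decseq_harm_diff_ln, of 0 m] by simp
  thus ?thesis by (simp add: m harm_expand)
qed

text \<open>The sum is cut at N of size |t|. Up to N the terms n^(-s) are at most 3 / n, since n^(1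
  - Re s) \<le> e in this region, and their sum is logarithmic; beyond N the tail estimate
  compensates the factor |s|. The factor |s - 1| is kept, to be divided out later. The boundary term
  at N does not carry it, whence 3 / r.\<close>

lemma norm_pole_free_zeta_le:
  fixes s :: complex and r :: real
  defines "t \<equiv> Im s"
  assumes r: "r > 0" "\<bar>t\<bar> \<ge> r" and s: "Re s \<ge> 1 - 1 / log_height t" "Re s \<le> 3"
  shows "norm (pole_free_zeta s) \<le> norm (s - 1) * ((30 + 3 / r) * log_height t)"
proof -
  define N where "N = nat \<lceil>\<bar>t\<bar>\<rceil> + 1"
  define L where "L = log_height t"
  have L2: "L \<ge> 2" unfolding L_def by (rule log_height_ge)
  have N: "N > 0" "\<bar>t\<bar> \<le> real N" "real N + 1 \<le> \<bar>t\<bar> + 8"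
    unfolding N_def by linarith+
  have sig: "Re s \<ge> 1/2"
  proof -
    have "1 / L \<le> 1 / 2" using L2 by (intro divide_left_mono) auto
    thus ?thesis using s by (simp add: L_def)
  qed
  \<comment> \<open>The width 1 / L of the strip is made for this: (|t| + 8)^(1 / L) = e.\<close>
  have e: "x powr (1 - Re s) \<le> exp 1" if "1 \<le> x" "x \<le> \<bar>t\<bar> + 8" for x :: real
  proof -
    have "x powr (1 - Re s) \<le> x powr (1 / L)" using s that by (intro powr_mono) (auto simp: L_def)
    also have "\<dots> \<le> (\<bar>t\<bar> + 8) powr (1 / L)" using that L2 by (intro powr_mono2) auto
    also have "\<dots> = exp (1 / L * L)" by (simp add: powr_def L_def log_height_def)
    also have "1 / L * L = 1" using L2 by simp
    finally show ?thesis .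
  qed
  have e3: "exp (1::real) \<le> 3" by (rule exp_le)
  have ns: "norm (s - 1) \<ge> r" using abs_Im_le_cmod[of "s - 1"] r by (simp add: t_def)
  have p1: "norm (\<Sum>n<N. of_nat (Suc n) powr (-s) :: complex) \<le> 3 * (2 * L)"
  proof -
    have "norm (\<Sum>n<N. of_nat (Suc n) powr (-s) :: complex) \<le> (\<Sum>n<N. 3 * inverse (real (Suc n)))"
    proof (rule sum_norm_le)
      fix n assume "n \<in> {..<N}"
      hence n: "real (Suc n) \<le> \<bar>t\<bar> + 8" using N by simp
      have "norm (of_nat (Suc n) powr (-s) :: complex) = real (Suc n) powr (1 - Re s + (- 1))"
        unfolding norm_nat_powr by simp
      also have "\<dots> = real (Suc n) powr (1 - Re s) * inverse (real (Suc n))"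
        unfolding powr_add by (subst powr_minus) simp
      also have "\<dots> \<le> 3 * inverse (real (Suc n))"
        using e[of "real (Suc n)"] n e3 by (intro mult_right_mono) auto
      finally show "norm (of_nat (Suc n) powr (-s) :: complex) \<le> 3 * inverse (real (Suc n))" .
    qed
    also have "\<dots> = 3 * harm N" by (simp only: harm_altdef sum_distrib_left)
    also have "harm N \<le> 1 + ln (real N)" by (rule harm_le[OF N(1)])
    also have "ln (real N) \<le> L" unfolding L_def log_height_def using N by (subst ln_le_cancel_iff) auto
    also have "1 + L \<le> 2 * L" using L2 by simp
    finally show ?thesis by simp
  qed
  have p2: "norm (of_nat (Suc N) powr (1 - s) :: complex) \<le> norm (s - 1) * (3 / r)"
  proof -
    have "norm (of_nat (Suc N) powr (1 - s) :: complex) = real (Suc N) powr (1 - Re s)"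
      unfolding norm_nat_powr by simp
    also have "\<dots> \<le> 3" using e[of "real (Suc N)"] N e3 by simp
    also have "3 = r * (3 / r)" using r by simp
    also have "\<dots> \<le> norm (s - 1) * (3 / r)" using ns r by (intro mult_right_mono) auto
    finally show ?thesis .
  qed
  have p3: "norm (\<Sum>n. zeta_term (n + N) s) \<le> norm (s - 1) * 24"
  proof -
    have b: "norm (zeta_term (n + N) s) \<le> norm (s - 1) * norm s * real (Suc (n + N)) powr (- Re s - 1)" for n
      using sig by (intro norm_zeta_term_le) auto
    have sm: "summable (\<lambda>n. norm (s - 1) * norm s * real (Suc (n + N)) powr (- Re s - 1))"
      using summable_ignore_initial_segment[OF summable_Suc_powr[of "Re s"], of N] sig
      by (intro summable_mult) simp
    have "norm (\<Sum>n. zeta_term (n + N) s) \<le> (\<Sum>n. norm (s - 1) * norm s * real (Suc (n + N)) powr (- Re s - 1))"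
      by (rule norm_suminf_le[OF b sm])
    also have "\<dots> = norm (s - 1) * norm s * (\<Sum>n. real (Suc (n + N)) powr (- Re s - 1))"
      using summable_ignore_initial_segment[OF summable_Suc_powr[of "Re s"], of N] sig
      by (intro suminf_mult) simp
    also have "\<dots> \<le> norm (s - 1) * norm s * (real N powr (- Re s) / Re s)"
      using sig N by (intro mult_left_mono sum_powr_tail_le) auto
    \<comment> \<open>24 = 4 * 3 * 2, from |s| \<le> 4 N, N^(1 - Re s) \<le> 3 and Re s \<ge>
      1/2.\<close>
    also have "norm s * (real N powr (- Re s) / Re s) \<le> 24"
    proof -
      have "norm s \<le> 4 * real N"
        using cmod_le[of s] s sig N unfolding t_def by linarith
      hence "norm s * real N powr (- Re s) \<le> 4 * real N * real N powr (- Re s)"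
        by (intro mult_right_mono) auto
      also have "\<dots> = 4 * real N powr (1 - Re s)"
        using N by (simp add: powr_diff powr_minus field_simps)
      also have "\<dots> \<le> 12" using e[of "real N"] N e3 by simp
      finally have "norm s * real N powr (- Re s) \<le> 12" .
      hence "norm s * real N powr (- Re s) / Re s \<le> 12 / (1/2)"
        using sig by (intro frac_le) auto
      thus ?thesis by simp
    qed
    hence "norm (s - 1) * norm s * (real N powr (- Re s) / Re s) \<le> norm (s - 1) * 24"
      unfolding mult.assoc by (intro mult_left_mono) auto
    finally show ?thesis .
  qed
  have "pole_free_zeta s = (1 + (\<Sum>n<N. zeta_term n s)) + (\<Sum>n. zeta_term (n + N) s)"
    unfolding pole_free_zeta_def
    using suminf_split_initial_segment[OF summable_zeta_term, of s N] sig by simp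
  also have "\<dots> = (s - 1) * (\<Sum>n<N. of_nat (Suc n) powr (-s)) + of_nat (Suc N) powr (1 - s) + (\<Sum>n. zeta_term (n + N) s)"
    by (simp only: sum_zeta_term)
  also have "norm \<dots> \<le> norm (s - 1) * (3 * (2 * L)) + norm (s - 1) * (3 / r) + norm (s - 1) * 24"
    by (intro norm_triangle_mono p2 p3) (simp only: norm_mult, intro mult_left_mono p1, simp)
  also have "\<dots> = norm (s - 1) * (6 * L + 3 / r + 24)" by (simp add: algebra_simps)
  also have "\<dots> \<le> norm (s - 1) * ((30 + 3 / r) * L)"
  proof (rule mult_left_mono)
    have "3 / r * 1 \<le> 3 / r * L" using r L2 by (intro mult_left_mono) auto
    thus "6 * L + 3 / r + 24 \<le> (30 + 3 / r) * L" using L2 by (simp add: algebra_simps)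
  qed simp
  finally show ?thesis by (simp add: L_def)
qed

lemma open_Re_gt_1: "open {s :: complex. Re s > 1}"
  by (rule open_halfspace_Re_gt)

lemma convex_Re_gt_1: "convex {s :: complex. Re s > 1}"
  by (rule convex_halfspace_Re_gt)

lemma zeta_holomorphic: "zeta holomorphic_on {s. Re s > 1}"
proof -
  have "(\<lambda>s. exp (log_zeta s)) holomorphic_on {s. Re s > 1}"
    by (intro holomorphic_intros log_zeta_holomorphic)
  thus ?thesis by (rule holomorphic_transform) (simp add: exp_log_zeta)
qed

lemma deriv_zeta_eq:
  assumes "Re s > 1"
  shows "deriv zeta s = zeta s * deriv log_zeta s"
proof -
  have "(log_zeta has_field_derivative deriv log_zeta s) (at s)"
    using assms by (intro holomorphic_derivI[OF log_zeta_holomorphic open_Re_gt_1]) auto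
  hence "((\<lambda>s. exp (log_zeta s)) has_field_derivative exp (log_zeta s) * deriv log_zeta s) (at s)"
    by (auto intro!: derivative_eq_intros)
  hence "(zeta has_field_derivative exp (log_zeta s) * deriv log_zeta s) (at s)"
    by (rule has_field_derivative_transform_within_open[OF _ open_Re_gt_1]) (use assms in \<open>auto simp: exp_log_zeta\<close>)
  thus ?thesis using assms by (simp add: DERIV_imp_deriv exp_log_zeta)
qed

lemma log_height_le_double:
  assumes "\<bar>u\<bar> \<le> 2 * \<bar>t\<bar> + 1"
  shows "log_height u \<le> 2 * log_height t"
proof -
  have "(\<bar>t\<bar> + 8)^2 = \<bar>t\<bar>^2 + 16 * \<bar>t\<bar> + 64" by (simp add: power2_eq_square algebra_simps)
  moreover have "\<bar>t\<bar>^2 \<ge> 0" by simp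
  ultimately have "\<bar>u\<bar> + 8 \<le> (\<bar>t\<bar> + 8)^2" using assms by linarith
  hence "log_height u \<le> ln ((\<bar>t\<bar> + 8)^2)"
    unfolding log_height_def by (intro ln_mono) auto
  also have "\<dots> = 2 * log_height t" by (simp add: log_height_def ln_realpow)
  finally show ?thesis .
qed

text \<open>Cauchy's inequality on a disc of radius r / (2 L). The disc may cross the line of
  abscissa 1, hence the continued function \<open>pole_free_zeta w / (w - 1)\<close>. Each
  derivative costs a factor 2 L / r.\<close>

lemma higher_deriv_zeta_bound:
  fixes r :: real
  assumes r: "0 < r" "r \<le> 1" and s: "1 < Re s" "Re s \<le> 2" "\<bar>Im s\<bar> \<ge> r"
  shows "norm ((deriv ^^ k) zeta s) \<le> (fact k * ((30 + 6 / r) * 2) * (2 / r) ^ k) * log_height (Im s) ^ Suc k"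
proof -
  define L where "L = log_height (Im s)"
  define \<rho> where "\<rho> = r / (2 * L)"
  have L: "L \<ge> 2" unfolding L_def by (rule log_height_ge)
  have \<rho>: "\<rho> > 0" "\<rho> \<le> r / 4" "\<rho> \<le> 1 / (2 * L)"
  proof -
    show "\<rho> > 0" using r L by (simp add: \<rho>_def)
    show "\<rho> \<le> r / 4" unfolding \<rho>_def using r L by (intro divide_left_mono) auto
    show "\<rho> \<le> 1 / (2 * L)" unfolding \<rho>_def using r L by (intro divide_right_mono) auto
  qed
  let ?f = "\<lambda>w. pole_free_zeta w / (w - 1)"
  have near: "Re w \<ge> 1 - 1 / (2 * L)" "Re w \<le> 3" "\<bar>Im w\<bar> \<ge> r / 2" "log_height (Im w) \<le> 2 * L" "Re w > 0" "w \<noteq> 1"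
    if "w \<in> cball s \<rho>" for w
  proof -
    have "\<bar>Re s - Re w\<bar> \<le> \<rho>" "\<bar>Im s - Im w\<bar> \<le> \<rho>"
      using that abs_Re_le_cmod[of "s - w"] abs_Im_le_cmod[of "s - w"] by (auto simp: dist_norm)
    note * = this
    show A: "Re w \<ge> 1 - 1 / (2 * L)" "Re w \<le> 3" using * \<rho> s r by linarith+
    show B: "\<bar>Im w\<bar> \<ge> r / 2" using *(2) \<rho>(2) s(3) r(1) by linarith
    show "log_height (Im w) \<le> 2 * L" unfolding L_def using * \<rho> r by (intro log_height_le_double) linarith
    have "1 / (2 * L) \<le> 1 / (2 * 2)" using L by (intro divide_left_mono) auto
    thus "Re w > 0" using A by simp
    show "w \<noteq> 1" using B r by auto
  qed
  have "norm ((deriv ^^ k) ?f s) \<le> fact k * ((30 + 6 / r) * (2 * L)) / \<rho> ^ k"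
  proof (rule Cauchy_inequality)
    have h: "?f holomorphic_on cball s \<rho>"
    proof (intro holomorphic_intros)
      show "pole_free_zeta holomorphic_on cball s \<rho>"
        by (rule holomorphic_on_subset[OF pole_free_zeta_holomorphic]) (use near in auto)
    qed (use near in auto)
    show "?f holomorphic_on ball s \<rho>" by (rule holomorphic_on_subset[OF h]) auto
    show "continuous_on (cball s \<rho>) ?f" by (rule holomorphic_on_imp_continuous_on[OF h])
    fix w assume "norm (s - w) = \<rho>"
    hence w: "w \<in> cball s \<rho>" by (simp add: dist_norm)
    note n = near[OF w]
    have "norm (pole_free_zeta w) \<le> norm (w - 1) * ((30 + 3 / (r / 2)) * log_height (Im w))"
    proof (rule norm_pole_free_zeta_le)
      \<comment> \<open>The logarithmic height varies on the disc but stays below 2 L, so a disc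
        reaching at most 1 / (2 L) to the left remains in the admissible strip.\<close>
      have "1 / (2 * L) \<le> 1 / log_height (Im w)"
        using n(4) log_height_ge[of "Im w"] by (intro divide_left_mono) auto
      thus "1 - 1 / log_height (Im w) \<le> Re w" using n(1) by simp
    qed (use n r in auto)
    also have "\<dots> \<le> norm (w - 1) * ((30 + 6 / r) * (2 * L))"
    proof -
      have e: "30 + 3 / (r / 2) = 30 + 6 / r" by simp
      have "30 + 6 / r \<ge> 0" using r by simp
      thus ?thesis unfolding e using n(4) by (intro mult_left_mono norm_ge_zero)
    qed
    finally show "norm (pole_free_zeta w / (w - 1)) \<le> (30 + 6 / r) * (2 * L)"
      using n(6) by (simp add: norm_divide divide_le_eq mult_ac)
  qed (rule \<rho>(1))
  also have "(deriv ^^ k) ?f s = (deriv ^^ k) zeta s"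
  proof (rule higher_deriv_transform_within_open)
    show "?f holomorphic_on {s. Re s > 1}"
      by (intro holomorphic_intros holomorphic_on_subset[OF pole_free_zeta_holomorphic]) auto
  qed (use s open_Re_gt_1 zeta_holomorphic in \<open>auto simp: pole_free_zeta_eq\<close>)
  also have "fact k * ((30 + 6 / r) * (2 * L)) / \<rho> ^ k = (fact k * ((30 + 6 / r) * 2) * (2 / r) ^ k) * L ^ Suc k"
    using r L by (simp add: \<rho>_def power_divide power_mult_distrib field_simps)
  finally show ?thesis by (simp add: L_def)
qed

lemma norm_zeta_eq: "Re s > 1 \<Longrightarrow> norm (zeta s) = exp (Re (log_zeta s))"
  by (simp add: exp_log_zeta[symmetric])

lemma zeta_near_pole_bound: "\<exists>K\<ge>1. \<forall>\<sigma>. 1 < \<sigma> \<and> \<sigma> \<le> 2 \<longrightarrow> norm (zeta (of_real \<sigma>)) \<le> K / (\<sigma> - 1)"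
proof -
  have "continuous_on (of_real ` {1..2}) pole_free_zeta"
    by (rule continuous_on_subset[OF holomorphic_on_imp_continuous_on[OF pole_free_zeta_holomorphic]]) auto
  moreover have "compact (of_real ` {1..2::real} :: complex set)"
    by (intro compact_continuous_image continuous_intros) auto
  ultimately have "bounded (pole_free_zeta ` of_real ` {1..2})"
    using compact_continuous_image compact_imp_bounded by blast
  then obtain K where K: "\<And>x. x \<in> {1..2::real} \<Longrightarrow> norm (pole_free_zeta (of_real x)) \<le> K"
    unfolding bounded_iff by blast
  have "norm (zeta (of_real \<sigma>)) \<le> max K 1 / (\<sigma> - 1)" if "1 < \<sigma>" "\<sigma> \<le> 2" for \<sigma>
  proof -
    have "(\<sigma> - 1) * norm (zeta (of_real \<sigma>)) = norm (pole_free_zeta (of_real \<sigma>))"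
    proof -
      have "norm (of_real \<sigma> - 1 :: complex) = \<sigma> - 1"
        using that by (metis abs_of_nonneg diff_ge_0_iff_ge less_eq_real_def norm_of_real of_real_1 of_real_diff)
      thus ?thesis using that by (simp add: pole_free_zeta_eq norm_mult)
    qed
    also have "\<dots> \<le> max K 1" using K[of \<sigma>] that by simp
    finally show ?thesis using that by (simp add: field_simps)
  qed
  thus ?thesis by (intro exI[of _ "max K 1"]) auto
qed

lemma zeta_341:
  assumes "\<sigma> > 1"
  shows "norm (zeta (of_real \<sigma>)) ^ 3 * norm (zeta (Complex \<sigma> t)) ^ 4 * norm (zeta (Complex \<sigma> (2 * t))) \<ge> 1"
proof -
  have "norm (zeta (of_real \<sigma>)) ^ 3 * norm (zeta (Complex \<sigma> t)) ^ 4 * norm (zeta (Complex \<sigma> (2 * t)))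
     = exp (3 * Re (log_zeta (of_real \<sigma>)) + 4 * Re (log_zeta (Complex \<sigma> t)) + Re (log_zeta (Complex \<sigma> (2 * t))))"
    using assms by (simp add: norm_zeta_eq exp_add flip: exp_of_nat_mult)
  also have "\<dots> \<ge> 1" using log_zeta_341[OF assms, of t] by simp
  finally show ?thesis .
qed

text \<open>At distance \<open>\<eta> = \<epsilon>\<^sup>4 / L\<^sup>9\<close> from the line of abscissa 1, where \<open>L\<close> is the logarithm of the height, the
  3-4-1 inequality gives a lower bound of order \<open>\<epsilon>\<^sup>3 / L\<^sup>7\<close>, whereas moving from there to the line
  changes the value by at most a multiple of \<open>L\<^sup>2 \<eta> = \<epsilon>\<^sup>4 / L\<^sup>7\<close>.\<close>

lemma zeta_bounds:
  fixes r :: real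
  assumes r: "0 < r" "r \<le> 1"
  obtains c K where "c > 0"
    "\<And>s. 1 < Re s \<Longrightarrow> Re s \<le> 2 \<Longrightarrow> \<bar>Im s\<bar> \<ge> r \<Longrightarrow> norm (zeta s) \<ge> c / log_height (Im s) ^ 7"
    "\<And>s. 1 < Re s \<Longrightarrow> Re s \<le> 2 \<Longrightarrow> \<bar>Im s\<bar> \<ge> r \<Longrightarrow> exp (norm (log_zeta s)) \<le> K * log_height (Im s) ^ 9"
proof -
  obtain K0 where K0: "K0 \<ge> 1" "\<And>\<sigma>. 1 < \<sigma> \<Longrightarrow> \<sigma> \<le> 2 \<Longrightarrow> norm (zeta (of_real \<sigma>)) \<le> K0 / (\<sigma> - 1)"
    using zeta_near_pole_bound by blast
  define K1 where "K1 = (30 + 6 / r) * 2"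
  define K2 where "K2 = K1 * (2 / r)"
  have K1: "K1 \<ge> 1" using r by (simp add: K1_def)
  have K2: "K2 > 0" using K1 r by (simp add: K2_def)
  have z1: "norm (zeta s) \<le> K1 * log_height (Im s)" if "1 < Re s" "Re s \<le> 2" "\<bar>Im s\<bar> \<ge> r" for s
    using higher_deriv_zeta_bound[OF r that, of 0] by (simp add: K1_def)
  have z2: "norm (deriv zeta s) \<le> K2 * log_height (Im s) ^ 2" if "1 < Re s" "Re s \<le> 2" "\<bar>Im s\<bar> \<ge> r" for s
    using higher_deriv_zeta_bound[OF r that, of 1] by (simp add: K1_def K2_def power2_eq_square)
  \<comment> \<open>The constant left by the 3-4-1 inequality; the 2 accounts for
    \<open>log_height (2 * t)\<close> being at most twice \<open>log_height t\<close>.\<close>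
  define B where "B = 1 / (2 * K0 ^ 3 * K1)"
  have B: "0 < B" "B \<le> 1"
  proof -
    show "0 < B" using K0 K1 by (simp add: B_def)
    have "1 * 1 * 1 \<le> 2 * K0 ^ 3 * K1" using K0 K1 by (intro mult_mono one_le_power) auto
    thus "B \<le> 1" unfolding B_def by (subst divide_le_eq_1) linarith
  qed
  have B4: "B ^ 4 \<le> B" using B by (simp add: power_le_one_iff power_decreasing[of 1 4 B, simplified])
  \<comment> \<open>With this choice the change of zeta on the way to the line is at most half of
    the lower bound at distance \<eta>.\<close>
  define \<epsilon> where "\<epsilon> = min 1 (B / (2 * K2))"
  have \<epsilon>: "0 < \<epsilon>" "\<epsilon> \<le> 1" "K2 * \<epsilon> \<le> B / 2"
  proof -
    have "K2 * \<epsilon> \<le> K2 * (B / (2 * K2))" unfolding \<epsilon>_def using K2 by (intro mult_left_mono) auto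
    thus "K2 * \<epsilon> \<le> B / 2" using K2 by simp
  qed (use B K2 in \<open>auto simp: \<epsilon>_def\<close>)
  define \<eta> where "\<eta> = (\<lambda>t. \<epsilon> ^ 4 / log_height t ^ 9)"
  have \<eta>: "0 < \<eta> t" "\<eta> t \<le> 1" for t
  proof -
    have L: "1 \<le> log_height t" using log_height_ge[of t] by simp
    show "0 < \<eta> t" using \<epsilon> L by (simp add: \<eta>_def)
    have "\<epsilon> ^ 4 \<le> 1" using \<epsilon> by (simp add: power_le_one)
    also have "1 \<le> log_height t ^ 9" using L by (rule one_le_power)
    finally show "\<eta> t \<le> 1" using L by (simp add: \<eta>_def)
  qed
  have far: "norm (zeta (Complex \<sigma> t)) \<ge> B * \<epsilon> ^ 3 / log_height t ^ 7"
    if "1 + \<eta> t \<le> \<sigma>" "\<sigma> \<le> 2" "\<bar>t\<bar> \<ge> r" for \<sigma> t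
  proof -
    define X where "X = norm (zeta (Complex \<sigma> t))"
    define L where "L = log_height t"
    have L: "L > 0" using log_height_ge[of t] by (simp add: L_def)
    have \<sigma>: "\<sigma> > 1" using that \<eta>[of t] by simp
    have "1 \<le> norm (zeta (of_real \<sigma>)) ^ 3 * X ^ 4 * norm (zeta (Complex \<sigma> (2 * t)))"
      unfolding X_def by (rule zeta_341[OF \<sigma>])
    also have "\<dots> \<le> (K0 / \<eta> t) ^ 3 * X ^ 4 * (K1 * (2 * L))"
    proof (intro mult_mono power_mono)
      have "norm (zeta (of_real \<sigma>)) \<le> K0 / (\<sigma> - 1)" using K0(2) \<sigma> that by simp
      also have "\<dots> \<le> K0 / \<eta> t" using that \<sigma> \<eta>[of t] K0 by (intro divide_left_mono) auto
      finally show "norm (zeta (of_real \<sigma>)) \<le> K0 / \<eta> t" .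
      have "norm (zeta (Complex \<sigma> (2 * t))) \<le> K1 * log_height (2 * t)"
        using z1[of "Complex \<sigma> (2 * t)"] \<sigma> that r by simp
      also have "\<dots> \<le> K1 * (2 * L)" unfolding L_def using log_height_le_double[of "2 * t" t] K1 by (intro mult_left_mono) auto
      finally show "norm (zeta (Complex \<sigma> (2 * t))) \<le> K1 * (2 * L)" .
    qed (use K0 K1 L \<eta>[of t] in \<open>auto simp: X_def\<close>)
    \<comment> \<open>The cube of K0 / \<eta> contributes L^27 and the value at height 2 t one more
      L; the fourth root of L^28 is L^7.\<close>
    also have "\<dots> = X ^ 4 * (L ^ 28 / (B * \<epsilon> ^ 12))"
    proof -
      have 1: "(K0 / \<eta> t) ^ 3 = K0 ^ 3 * L ^ 27 / \<epsilon> ^ 12"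
        by (simp add: \<eta>_def L_def power_divide power_mult_distrib flip: power_mult)
      have 2: "L ^ 28 = L ^ 27 * L" using power_add[of L 27 1] by simp
      show ?thesis unfolding 1 2 B_def using \<epsilon> K0 K1 L by (simp add: field_simps)
    qed
    finally have "B * \<epsilon> ^ 12 / L ^ 28 \<le> X ^ 4" using B \<epsilon> L by (simp add: field_simps)
    moreover have "B ^ 4 * \<epsilon> ^ 12 / L ^ 28 \<le> B * \<epsilon> ^ 12 / L ^ 28"
      using B4 \<epsilon> L by (intro divide_right_mono mult_right_mono) auto
    moreover have "(B * \<epsilon> ^ 3 / L ^ 7) ^ 4 = B ^ 4 * \<epsilon> ^ 12 / L ^ 28"
      by (simp add: power_divide power_mult_distrib flip: power_mult)
    ultimately have "(B * \<epsilon> ^ 3 / L ^ 7) ^ Suc 3 \<le> X ^ Suc 3" by simp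
    hence "B * \<epsilon> ^ 3 / L ^ 7 \<le> X"
      by (rule power_le_imp_le_base) (simp add: X_def)
    thus ?thesis by (simp add: X_def L_def)
  qed
  define c where "c = B * \<epsilon> ^ 3 / 2"
  have c: "c > 0" using B \<epsilon> by (simp add: c_def)
  \<comment> \<open>Mean value inequality on a horizontal segment, used both for zeta and for its
    logarithm.\<close>
  have move: "norm (f (Complex \<sigma> t) - f (Complex (1 + \<eta> t) t)) \<le> K * \<eta> t"
    if f: "f holomorphic_on {s. Re s > 1}" and st: "1 < \<sigma>" "\<sigma> \<le> 1 + \<eta> t" "\<bar>t\<bar> \<ge> r"
    and d: "\<And>s. 1 < Re s \<Longrightarrow> Re s \<le> 2 \<Longrightarrow> Im s = t \<Longrightarrow> norm (deriv f s) \<le> K" and K: "K \<ge> 0" for f \<sigma> t K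
  proof -
    let ?S = "closed_segment (Complex \<sigma> t) (Complex (1 + \<eta> t) t)"
    have S: "Im w = t \<and> 1 < Re w \<and> Re w \<le> 2" if "w \<in> ?S" for w
      using that st \<eta>[of t]
      by (auto simp: closed_segment_same_Im closed_segment_eq_real_ivl)
    have "norm (f (Complex \<sigma> t) - f (Complex (1 + \<eta> t) t)) \<le> K * norm (Complex \<sigma> t - Complex (1 + \<eta> t) t)"
    proof (rule field_differentiable_bound[of ?S])
      fix w assume w: "w \<in> ?S"
      show "(f has_field_derivative deriv f w) (at w within ?S)"
        using S[OF w] by (intro has_field_derivative_at_within[OF holomorphic_derivI[OF f open_Re_gt_1]]) auto
      show "norm (deriv f w) \<le> K" using S[OF w] d by blast
    qed auto
    also have "norm (Complex \<sigma> t - Complex (1 + \<eta> t) t) \<le> \<eta> t"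
      using st by (simp add: cmod_def)
    finally show ?thesis using K by (simp add: mult_left_mono)
  qed
  have low: "norm (zeta (Complex \<sigma> t)) \<ge> c / log_height t ^ 7" if st: "1 < \<sigma>" "\<sigma> \<le> 2" "\<bar>t\<bar> \<ge> r" for \<sigma> t
  proof (cases "1 + \<eta> t \<le> \<sigma>")
    case True
    have "c / log_height t ^ 7 \<le> B * \<epsilon> ^ 3 / log_height t ^ 7"
      using B \<epsilon> log_height_ge[of t] unfolding c_def by (intro divide_right_mono) auto
    also have "\<dots> \<le> norm (zeta (Complex \<sigma> t))" by (rule far[OF True st(2,3)])
    finally show ?thesis .
  next
    case False
    define L where "L = log_height t"
    have L: "L > 0" using log_height_ge[of t] by (simp add: L_def)
    have "norm (zeta (Complex \<sigma> t) - zeta (Complex (1 + \<eta> t) t)) \<le> (K2 * L ^ 2) * \<eta> t"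
      by (rule move[OF zeta_holomorphic]) (use st False z2 K2 L in \<open>auto simp: L_def\<close>)
    also have "\<dots> = (K2 * \<epsilon>) * \<epsilon> ^ 3 / L ^ 7"
    proof -
      have 1: "L ^ 9 = L ^ 2 * L ^ 7" using power_add[of L 2 7] by simp
      have 2: "\<epsilon> ^ 4 = \<epsilon> * \<epsilon> ^ 3" using power_add[of \<epsilon> 1 3] by simp
      have "K2 * L^2 * (\<epsilon> * \<epsilon> ^ 3 / (L ^ 2 * L ^ 7)) = K2 * \<epsilon> * \<epsilon> ^ 3 / L ^ 7"
        using L by (simp add: field_simps)
      thus ?thesis unfolding \<eta>_def L_def[symmetric] 1 2 .
    qed
    also have "\<dots> \<le> (B / 2) * \<epsilon> ^ 3 / L ^ 7"
      using \<epsilon> L by (intro divide_right_mono mult_right_mono) auto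
    finally have "norm (zeta (Complex \<sigma> t) - zeta (Complex (1 + \<eta> t) t)) \<le> c / L ^ 7"
      by (simp add: c_def)
    moreover have "norm (zeta (Complex (1 + \<eta> t) t)) \<ge> B * \<epsilon> ^ 3 / L ^ 7"
      unfolding L_def using \<eta>[of t] st by (intro far) auto
    moreover have "B * \<epsilon> ^ 3 / L ^ 7 = 2 * (c / L ^ 7)" by (simp add: c_def)
    moreover have "norm (zeta (Complex (1 + \<eta> t) t)) \<le> norm (zeta (Complex \<sigma> t))
       + norm (zeta (Complex \<sigma> t) - zeta (Complex (1 + \<eta> t) t))"
      by (metis norm_minus_commute norm_triangle_sub)
    ultimately show ?thesis unfolding L_def by linarith
  qed
  \<comment> \<open>L^9 = L^2 L^7, from zeta' and from 1 / zeta. Since \<eta> L^9 = \<epsilon>^4,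
    the logarithm changes by a bounded amount between the line and distance \<eta>.\<close>
  have M: "norm (deriv log_zeta s) \<le> K2 / c * log_height (Im s) ^ 9" if "1 < Re s" "Re s \<le> 2" "\<bar>Im s\<bar> \<ge> r" for s
  proof -
    have L: "log_height (Im s) > 0" using log_height_ge[of "Im s"] by simp
    have l: "c / log_height (Im s) ^ 7 \<le> norm (zeta s)"
      using low[of "Re s" "Im s"] that by simp
    have "norm (zeta s) * norm (deriv log_zeta s) \<le> K2 * log_height (Im s) ^ 2"
      using z2[OF that] deriv_zeta_eq[of s] that by (simp add: norm_mult)
    moreover have "c / log_height (Im s) ^ 7 * norm (deriv log_zeta s) \<le> norm (zeta s) * norm (deriv log_zeta s)"
      by (intro mult_right_mono l) simp
    ultimately have "c / log_height (Im s) ^ 7 * norm (deriv log_zeta s) \<le> K2 * log_height (Im s) ^ 2"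
      by (rule order_trans[rotated])
    hence "norm (deriv log_zeta s) \<le> K2 * log_height (Im s) ^ 2 * log_height (Im s) ^ 7 / c"
      using c L by (simp add: field_simps)
    thus ?thesis by (simp add: mult.assoc flip: power_add)
  qed
  define K where "K = K0 / \<epsilon> ^ 4 * exp (K2 / c * \<epsilon> ^ 4)"
  \<comment> \<open>At distance at least \<eta> the comparison with the real axis suffices, because
    K0 / \<eta> is itself a power of L.\<close>
  have up0: "exp (norm (log_zeta (Complex \<sigma> t))) \<le> K0 / \<epsilon> ^ 4 * log_height t ^ 9"
    if st: "1 + \<eta> t \<le> \<sigma>" "\<sigma> \<le> 2" for \<sigma> t
  proof -
    have \<sigma>: "\<sigma> > 1" using st \<eta>[of t] by simp
    have "exp (norm (log_zeta (Complex \<sigma> t))) \<le> exp (Re (log_zeta (of_real \<sigma>)))"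
      using norm_log_zeta_le[of "Complex \<sigma> t"] \<sigma> by simp
    also have "\<dots> = norm (zeta (of_real \<sigma>))" using \<sigma> by (simp add: norm_zeta_eq)
    also have "\<dots> \<le> K0 / (\<sigma> - 1)" using K0(2) \<sigma> st by simp
    also have "\<dots> \<le> K0 / \<eta> t" using st \<sigma> \<eta>[of t] K0 by (intro divide_left_mono) auto
    finally show ?thesis by (simp add: \<eta>_def)
  qed
  have up: "exp (norm (log_zeta (Complex \<sigma> t))) \<le> K * log_height t ^ 9" if st: "1 < \<sigma>" "\<sigma> \<le> 2" "\<bar>t\<bar> \<ge> r" for \<sigma> t
  proof -
    have L: "log_height t > 0" using log_height_ge[of t] by simp
    define E where "E = exp (K2 / c * \<epsilon> ^ 4)"
    have E: "E \<ge> 1" using K2 c \<epsilon> by (simp add: E_def)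
    have K': "K * log_height t ^ 9 = (K0 / \<epsilon> ^ 4 * log_height t ^ 9) * E" by (simp add: K_def E_def)
    have pos: "K0 / \<epsilon> ^ 4 * log_height t ^ 9 \<ge> 0" using K0 \<epsilon> L by auto
    show ?thesis
    proof (cases "1 + \<eta> t \<le> \<sigma>")
      case True
      have "K0 / \<epsilon> ^ 4 * log_height t ^ 9 * 1 \<le> (K0 / \<epsilon> ^ 4 * log_height t ^ 9) * E"
        using pos E by (intro mult_left_mono) auto
      thus ?thesis using up0[OF True st(2)] unfolding K' by simp
    next
      case False
      have "norm (log_zeta (Complex \<sigma> t) - log_zeta (Complex (1 + \<eta> t) t)) \<le> (K2 / c * log_height t ^ 9) * \<eta> t"
        by (rule move[OF log_zeta_holomorphic]) (use st False M K2 c L in auto)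
      also have "\<dots> = K2 / c * \<epsilon> ^ 4" using L by (simp add: \<eta>_def)
      finally have "norm (log_zeta (Complex \<sigma> t)) \<le> norm (log_zeta (Complex (1 + \<eta> t) t)) + K2 / c * \<epsilon> ^ 4"
        using norm_triangle_sub[of "log_zeta (Complex \<sigma> t)" "log_zeta (Complex (1 + \<eta> t) t)"] by linarith
      hence "exp (norm (log_zeta (Complex \<sigma> t))) \<le> exp (norm (log_zeta (Complex (1 + \<eta> t) t))) * E"
        unfolding E_def by (simp flip: exp_add)
      also have "\<dots> \<le> (K0 / \<epsilon> ^ 4 * log_height t ^ 9) * E"
        using up0[of t "1 + \<eta> t"] \<eta>[of t] E by (intro mult_right_mono) auto
      finally show ?thesis unfolding K' .
    qed
  qed
  show ?thesis
  proof (rule that[OF c])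
    fix s assume "1 < Re s" "Re s \<le> 2" "\<bar>Im s\<bar> \<ge> r"
    thus "c / log_height (Im s) ^ 7 \<le> cmod (zeta s)"
      "exp (norm (log_zeta s)) \<le> K * log_height (Im s) ^ 9"
      using low[of "Re s" "Im s"] up[of "Re s" "Im s"] by simp_all
  qed
qed

section \<open>Derivatives of the Dirichlet series\<close>

text \<open>One pair C, m serves for the whole family, which later is indexed by z on the unit
  circle; r keeps away from the pole at s = 1.\<close>

definition polylog :: "real \<Rightarrow> 'i set \<Rightarrow> ('i \<Rightarrow> complex \<Rightarrow> complex) \<Rightarrow> bool" where
  "polylog r I f \<longleftrightarrow> (\<exists>C m. C \<ge> 0 \<and> (\<forall>i\<in>I. \<forall>s. 1 < Re s \<and> Re s \<le> 2 \<and> r \<le> \<bar>Im s\<bar> \<longrightarrow> norm (f i s) \<le> C * log_height (Im s) ^ m))"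

lemma polylogI:
  assumes "\<And>i s. i \<in> I \<Longrightarrow> 1 < Re s \<Longrightarrow> Re s \<le> 2 \<Longrightarrow> r \<le> \<bar>Im s\<bar> \<Longrightarrow> norm (f i s) \<le> C * log_height (Im s) ^ m"
  shows "polylog r I f"
proof -
  have "norm (f i s) \<le> max C 0 * log_height (Im s) ^ m" if "i \<in> I" "1 < Re s" "Re s \<le> 2" "r \<le> \<bar>Im s\<bar>" for i s
  proof (rule order_trans[OF assms[OF that]])
    show "C * log_height (Im s) ^ m \<le> max C 0 * log_height (Im s) ^ m"
      using log_height_ge[of "Im s"] by (intro mult_right_mono) auto
  qed
  thus ?thesis unfolding polylog_def by (intro exI[of _ "max C 0"] exI[of _ m]) auto
qed

lemma polylog_cong:
  assumes "polylog r I f" "\<And>i s. i \<in> I \<Longrightarrow> 1 < Re s \<Longrightarrow> Re s \<le> 2 \<Longrightarrow> r \<le> \<bar>Im s\<bar> \<Longrightarrow> f i s = g i s"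
  shows "polylog r I g"
  using assms unfolding polylog_def by metis

lemma polylog_const:
  assumes "\<And>i. i \<in> I \<Longrightarrow> norm (c i) \<le> C"
  shows "polylog r I (\<lambda>i s. c i)"
  by (rule polylogI[where C = C and m = 0]) (use assms in simp)

lemma polylog_mult:
  assumes "polylog r I f" "polylog r I g"
  shows "polylog r I (\<lambda>i s. f i s * g i s)"
proof -
  obtain C m where C: "C \<ge> 0" "\<And>i s. i \<in> I \<Longrightarrow> 1 < Re s \<Longrightarrow> Re s \<le> 2 \<Longrightarrow> r \<le> \<bar>Im s\<bar> \<Longrightarrow> norm (f i s) \<le> C * log_height (Im s) ^ m"
    using assms(1) unfolding polylog_def by blast
  obtain D n where D: "D \<ge> 0" "\<And>i s. i \<in> I \<Longrightarrow> 1 < Re s \<Longrightarrow> Re s \<le> 2 \<Longrightarrow> r \<le> \<bar>Im s\<bar> \<Longrightarrow> norm (g i s) \<le> D * log_height (Im s) ^ n"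
    using assms(2) unfolding polylog_def by blast
  show ?thesis
  proof (rule polylogI[where C = "C * D" and m = "m + n"])
    fix i s assume a: "i \<in> I" "1 < Re s" "Re s \<le> 2" "r \<le> \<bar>Im s\<bar>"
    have "norm (f i s * g i s) \<le> (C * log_height (Im s) ^ m) * (D * log_height (Im s) ^ n)"
      unfolding norm_mult using C(1) log_height_ge[of "Im s"] by (intro mult_mono C(2) D(2) a) auto
    thus "norm (f i s * g i s) \<le> C * D * log_height (Im s) ^ (m + n)" by (simp add: power_add mult_ac)
  qed
qed

lemma polylog_add:
  assumes "polylog r I f" "polylog r I g"
  shows "polylog r I (\<lambda>i s. f i s + g i s)"
proof -
  obtain C m where C: "C \<ge> 0" "\<And>i s. i \<in> I \<Longrightarrow> 1 < Re s \<Longrightarrow> Re s \<le> 2 \<Longrightarrow> r \<le> \<bar>Im s\<bar> \<Longrightarrow> norm (f i s) \<le> C * log_height (Im s) ^ m"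
    using assms(1) unfolding polylog_def by blast
  obtain D n where D: "D \<ge> 0" "\<And>i s. i \<in> I \<Longrightarrow> 1 < Re s \<Longrightarrow> Re s \<le> 2 \<Longrightarrow> r \<le> \<bar>Im s\<bar> \<Longrightarrow> norm (g i s) \<le> D * log_height (Im s) ^ n"
    using assms(2) unfolding polylog_def by blast
  show ?thesis
  proof (rule polylogI[where C = "C + D" and m = "m + n"])
    fix i s assume a: "i \<in> I" "1 < Re s" "Re s \<le> 2" "r \<le> \<bar>Im s\<bar>"
    have L: "1 \<le> log_height (Im s)" using log_height_ge[of "Im s"] by simp
    have "norm (f i s + g i s) \<le> C * log_height (Im s) ^ m + D * log_height (Im s) ^ n"
      by (intro norm_triangle_mono C(2) D(2) a)
    also have "\<dots> \<le> C * log_height (Im s) ^ (m + n) + D * log_height (Im s) ^ (m + n)"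
      using C(1) D(1) L by (intro add_mono mult_left_mono power_increasing) auto
    finally show "norm (f i s + g i s) \<le> (C + D) * log_height (Im s) ^ (m + n)" by (simp add: algebra_simps)
  qed
qed

lemma polylog_sum:
  assumes "finite A" "\<And>a. a \<in> A \<Longrightarrow> polylog r I (f a)"
  shows "polylog r I (\<lambda>i s. \<Sum>a\<in>A. f a i s)"
  using assms
proof (induction A rule: finite_induct)
  case empty
  show ?case using polylog_const[of I "\<lambda>_. 0" 0] by simp
next
  case (insert a A)
  thus ?case using polylog_add[of r I "f a" "\<lambda>i s. \<Sum>a\<in>A. f a i s"] by simp
qed

lemma polylog_higher_deriv_mult:
  assumes f: "\<And>i. i \<in> I \<Longrightarrow> f i holomorphic_on {s. Re s > 1}" "\<And>j. j \<le> k \<Longrightarrow> polylog r I (\<lambda>i. (deriv ^^ j) (f i))"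
    and g: "\<And>i. i \<in> I \<Longrightarrow> g i holomorphic_on {s. Re s > 1}" "\<And>j. j \<le> k \<Longrightarrow> polylog r I (\<lambda>i. (deriv ^^ j) (g i))"
  shows "polylog r I (\<lambda>i. (deriv ^^ k) (\<lambda>s. f i s * g i s))"
proof -
  have "polylog r I (\<lambda>i s. \<Sum>j=0..k. of_nat (k choose j) * (deriv ^^ j) (f i) s * (deriv ^^ (k - j)) (g i) s)"
    by (intro polylog_sum polylog_mult polylog_const[where C = "real (k choose _)"] f g) auto
  thus ?thesis
    by (rule polylog_cong) (use higher_deriv_mult[OF f(1) g(1) open_Re_gt_1] in simp)
qed

text \<open>By f' = f g and Leibniz' rule, a derivative of f is expressed through lower ones, so
  only f itself needs a bound. It is meant for f = exp(z log zeta), where g is z times the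
  logarithmic derivative of zeta.\<close>

lemma polylog_higher_deriv_ode:
  assumes f: "\<And>i. i \<in> I \<Longrightarrow> f i holomorphic_on {s. Re s > 1}" "polylog r I f"
    and g: "\<And>i. i \<in> I \<Longrightarrow> g i holomorphic_on {s. Re s > 1}" "\<And>j. polylog r I (\<lambda>i. (deriv ^^ j) (g i))"
    and ode: "\<And>i s. i \<in> I \<Longrightarrow> Re s > 1 \<Longrightarrow> deriv (f i) s = f i s * g i s"
  shows "polylog r I (\<lambda>i. (deriv ^^ k) (f i))"
proof (induction k rule: less_induct)
  case (less k)
  show ?case
  proof (cases k)
    case 0
    thus ?thesis using f(2) by simp
  next
    case (Suc n)
    have "polylog r I (\<lambda>i. (deriv ^^ n) (\<lambda>s. f i s * g i s))"
      by (rule polylog_higher_deriv_mult) (use f g less Suc in auto)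
    thus ?thesis
    proof (rule polylog_cong)
      fix i s assume i: "i \<in> I" and s: "1 < Re s"
      have "(deriv ^^ k) (f i) s = (deriv ^^ n) (deriv (f i)) s"
        by (simp only: Suc funpow_Suc_right o_apply)
      also have "\<dots> = (deriv ^^ n) (\<lambda>s. f i s * g i s) s"
      proof (rule higher_deriv_transform_within_open[OF _ _ open_Re_gt_1])
        show "deriv (f i) holomorphic_on {s. 1 < Re s}" by (intro holomorphic_deriv f i open_Re_gt_1)
        show "(\<lambda>s. f i s * g i s) holomorphic_on {s. 1 < Re s}" by (intro holomorphic_intros f g i)
      qed (use i s ode in auto)
      finally show "(deriv ^^ n) (\<lambda>s. f i s * g i s) s = (deriv ^^ k) (f i) s" by simp
    qed
  qed
qed

lemma polylog_zeta:
  fixes r :: real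
  assumes r: "0 < r" "r \<le> 1"
  shows "polylog r I (\<lambda>i. (deriv ^^ k) zeta)"
  by (rule polylogI) (rule higher_deriv_zeta_bound[OF r])

lemma polylog_inverse_zeta:
  fixes r :: real
  assumes r: "0 < r" "r \<le> 1"
  shows "polylog r I (\<lambda>i s. 1 / zeta s)"
proof -
  obtain c K where c: "c > 0"
    "\<And>s. 1 < Re s \<Longrightarrow> Re s \<le> 2 \<Longrightarrow> \<bar>Im s\<bar> \<ge> r \<Longrightarrow> norm (zeta s) \<ge> c / log_height (Im s) ^ 7"
    using zeta_bounds[OF r] by metis
  show ?thesis
  proof (rule polylogI[where C = "1 / c" and m = 7])
    fix s assume s: "1 < Re s" "Re s \<le> 2" "r \<le> \<bar>Im s\<bar>"
    have L: "log_height (Im s) > 0" using log_height_ge[of "Im s"] by simp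
    have "norm (1 / zeta s) \<le> 1 / (c / log_height (Im s) ^ 7)"
      unfolding norm_divide norm_one using c s L by (intro divide_left_mono) (auto simp: exp_log_zeta[symmetric])
    thus "norm (1 / zeta s) \<le> 1 / c * log_height (Im s) ^ 7" using c L by simp
  qed
qed

text \<open>Leibniz' rule for zeta' = M zeta is solved for the highest derivative of M. The division
  by zeta is where the lower bound on zeta enters.\<close>

lemma polylog_log_deriv_zeta:
  fixes r :: real
  assumes r: "0 < r" "r \<le> 1"
  shows "polylog r I (\<lambda>i. (deriv ^^ k) (deriv log_zeta))"
proof (induction k rule: less_induct)
  case (less k)
  let ?M = "deriv log_zeta" and ?z = "zeta"
  have M: "?M holomorphic_on {s. Re s > 1}" by (intro holomorphic_deriv log_zeta_holomorphic open_Re_gt_1)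
  have "polylog r I (\<lambda>i s. ((deriv ^^ Suc k) ?z s + (\<Sum>j<k. (- of_nat (k choose j)) * (deriv ^^ j) ?M s * (deriv ^^ (k - j)) ?z s)) * (1 / ?z s))"
    by (intro polylog_mult polylog_add polylog_zeta polylog_inverse_zeta polylog_sum r less polylog_const[where C = "real (k choose _)"]) auto
  thus ?case
  proof (rule polylog_cong)
    fix s assume s: "1 < Re s"
    have nz: "?z s \<noteq> 0" using s by (simp add: exp_log_zeta[symmetric])
    have "(deriv ^^ Suc k) ?z s = (deriv ^^ k) (deriv ?z) s"
      by (simp only: funpow_Suc_right o_apply)
    also have "\<dots> = (deriv ^^ k) (\<lambda>s. ?M s * ?z s) s"
    proof (rule higher_deriv_transform_within_open[OF _ _ open_Re_gt_1])
      show "deriv ?z holomorphic_on {s. 1 < Re s}" by (intro holomorphic_deriv zeta_holomorphic open_Re_gt_1)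
      show "(\<lambda>s. ?M s * ?z s) holomorphic_on {s. 1 < Re s}" by (intro holomorphic_intros zeta_holomorphic M)
    qed (use s in \<open>auto simp: deriv_zeta_eq\<close>)
    also have "\<dots> = (\<Sum>j=0..k. of_nat (k choose j) * (deriv ^^ j) ?M s * (deriv ^^ (k - j)) ?z s)"
      using s by (intro higher_deriv_mult[OF M zeta_holomorphic open_Re_gt_1]) auto
    also have "\<dots> = (\<Sum>j<k. of_nat (k choose j) * (deriv ^^ j) ?M s * (deriv ^^ (k - j)) ?z s) + (deriv ^^ k) ?M s * ?z s"
      by (simp add: atLeast0AtMost flip: lessThan_Suc_atMost)
    finally have e: "(deriv ^^ Suc k) ?z s = (\<Sum>j<k. of_nat (k choose j) * (deriv ^^ j) ?M s * (deriv ^^ (k - j)) ?z s) + (deriv ^^ k) ?M s * ?z s" .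
    have "(\<Sum>j<k. (- of_nat (k choose j)) * (deriv ^^ j) ?M s * (deriv ^^ (k - j)) ?z s) = - (\<Sum>j<k. of_nat (k choose j) * (deriv ^^ j) ?M s * (deriv ^^ (k - j)) ?z s)"
      by (simp add: sum_negf)
    thus "((deriv ^^ Suc k) ?z s + (\<Sum>j<k. (- of_nat (k choose j)) * (deriv ^^ j) ?M s * (deriv ^^ (k - j)) ?z s)) * (1 / ?z s) = (deriv ^^ k) ?M s"
      unfolding e using nz by simp
  qed
qed

text \<open>The division by s is the one that partial summation produces in
  \<open>laplace_omega_mean\<close>.\<close>

lemma corr_prod_over_s:
  assumes z: "norm z = 1"
  shows "(\<lambda>s. corr_prod z s / s) holomorphic_on {s. Re s > 3/4}"
    and "\<And>s. Re s > 3/4 \<Longrightarrow> norm (corr_prod z s / s) \<le> 2 * corr_bound"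
proof -
  show "(\<lambda>s. corr_prod z s / s) holomorphic_on {s. Re s > 3/4}"
    by (intro holomorphic_intros corr_prod_holomorphic z) auto
  fix s :: complex assume s: "Re s > 3/4"
  have "norm s \<ge> 1/2" using complex_Re_le_cmod[of s] s by linarith
  hence "norm (corr_prod z s) / norm s \<le> corr_bound / (1/2)"
    using norm_corr_prod_le[OF z s] by (intro frac_le) (auto simp: corr_bound_def)
  thus "norm (corr_prod z s / s) \<le> 2 * corr_bound" by (simp add: norm_divide)
qed

lemma polylog_corr_prod: "polylog r {z. norm z = 1} (\<lambda>z. (deriv ^^ k) (\<lambda>s. corr_prod z s / s))"
proof (rule polylogI[where C = "fact k * (2 * corr_bound) / (1/4) ^ k" and m = 0])
  fix z s :: complex assume z: "z \<in> {z. norm z = 1}" and s: "1 < Re s"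
  have sub: "cball s (1/4) \<subseteq> {s. Re s > 3/4}"
  proof safe
    fix w assume "w \<in> cball s (1/4)"
    thus "Re w > 3/4" using abs_Re_le_cmod[of "s - w"] s by (auto simp: dist_norm)
  qed
  have h: "(\<lambda>s. corr_prod z s / s) holomorphic_on cball s (1/4)"
    using corr_prod_over_s(1)[of z] z sub holomorphic_on_subset by blast
  have "norm ((deriv ^^ k) (\<lambda>s. corr_prod z s / s) s) \<le> fact k * (2 * corr_bound) / (1/4) ^ k"
  proof (rule Cauchy_inequality)
    show "(\<lambda>s. corr_prod z s / s) holomorphic_on ball s (1/4)" by (rule holomorphic_on_subset[OF h]) auto
    show "continuous_on (cball s (1/4)) (\<lambda>s. corr_prod z s / s)" by (rule holomorphic_on_imp_continuous_on[OF h])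
    fix w assume "norm (s - w) = 1/4"
    hence "w \<in> cball s (1/4)" by (simp add: dist_norm)
    thus "norm (corr_prod z w / w) \<le> 2 * corr_bound" using sub z by (intro corr_prod_over_s) auto
  qed auto
  thus "norm ((deriv ^^ k) (\<lambda>s. corr_prod z s / s) s) \<le> fact k * (2 * corr_bound) / (1/4) ^ k * log_height (Im s) ^ 0" by simp
qed

lemma polylog_omega_series:
  fixes r :: real
  assumes r: "0 < r" "r \<le> 1"
  shows "polylog r {z. norm z = 1} (\<lambda>z. (deriv ^^ k) (\<lambda>s. omega_series z s / s))"
proof -
  let ?I = "{z :: complex. norm z = 1}"
  let ?Y = "\<lambda>z s. exp (z * log_zeta s)"
  have Yh: "?Y z holomorphic_on {s. Re s > 1}" for z
    by (intro holomorphic_intros log_zeta_holomorphic)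
  have Gh: "(\<lambda>s. corr_prod z s / s) holomorphic_on {s. Re s > 1}" if "z \<in> ?I" for z
    by (rule holomorphic_on_subset[OF corr_prod_over_s(1)]) (use that in auto)
  obtain K where K:
    "\<And>s. 1 < Re s \<Longrightarrow> Re s \<le> 2 \<Longrightarrow> \<bar>Im s\<bar> \<ge> r \<Longrightarrow> exp (norm (log_zeta s)) \<le> K * log_height (Im s) ^ 9"
    using zeta_bounds[OF r] by metis
  have Y0: "polylog r ?I ?Y"
  proof (rule polylogI[where C = K and m = 9])
    fix z s :: complex assume z: "z \<in> ?I" and s: "1 < Re s" "Re s \<le> 2" "r \<le> \<bar>Im s\<bar>"
    have "norm (?Y z s) \<le> exp (norm (z * log_zeta s))" by (rule norm_exp)
    also have "\<dots> = exp (norm (log_zeta s))" using z by (simp add: norm_mult)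
    also have "\<dots> \<le> K * log_height (Im s) ^ 9" by (rule K[OF s])
    finally show "norm (?Y z s) \<le> K * log_height (Im s) ^ 9" .
  qed
  have M: "deriv log_zeta holomorphic_on {s. Re s > 1}" by (intro holomorphic_deriv log_zeta_holomorphic open_Re_gt_1)
  have Y: "polylog r ?I (\<lambda>z. (deriv ^^ j) (?Y z))" for j
  proof (rule polylog_higher_deriv_ode[where g = "\<lambda>z s. z * deriv log_zeta s"])
    show "polylog r ?I (\<lambda>z. (deriv ^^ j) (\<lambda>s. z * deriv log_zeta s))" for j
    proof -
      have "polylog r ?I (\<lambda>z s. z * (deriv ^^ j) (deriv log_zeta) s)"
        by (intro polylog_mult polylog_const[where C = 1] polylog_log_deriv_zeta r) auto
      thus ?thesis by (rule polylog_cong) (use M in \<open>simp add: higher_deriv_cmult[OF _ _ open_Re_gt_1]\<close>)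
    qed
    fix z s :: complex assume s: "Re s > 1"
    have "(log_zeta has_field_derivative deriv log_zeta s) (at s)"
      using s by (intro holomorphic_derivI[OF log_zeta_holomorphic open_Re_gt_1]) auto
    hence "(?Y z has_field_derivative ?Y z s * (z * deriv log_zeta s)) (at s)"
      by (auto intro!: derivative_eq_intros)
    thus "deriv (?Y z) s = ?Y z s * (z * deriv log_zeta s)" by (rule DERIV_imp_deriv)
  qed (use Yh Y0 M in \<open>auto intro!: holomorphic_intros\<close>)
  have "polylog r ?I (\<lambda>z. (deriv ^^ k) (\<lambda>s. ?Y z s * (corr_prod z s / s)))"
    by (rule polylog_higher_deriv_mult) (use Yh Gh Y polylog_corr_prod in auto)
  thus ?thesis
  proof (rule polylog_cong)
    fix z s :: complex assume z: "z \<in> ?I" and s: "1 < Re s"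
    show "(deriv ^^ k) (\<lambda>s. ?Y z s * (corr_prod z s / s)) s = (deriv ^^ k) (\<lambda>s. omega_series z s / s) s"
    proof (rule higher_deriv_transform_within_open[OF _ _ open_Re_gt_1])
      show 1: "(\<lambda>s. ?Y z s * (corr_prod z s / s)) holomorphic_on {s. 1 < Re s}"
        by (rule holomorphic_on_mult[OF Yh Gh[OF z]])
      show "(\<lambda>s. omega_series z s / s) holomorphic_on {s. 1 < Re s}"
        by (rule holomorphic_transform[OF 1]) (use z omega_series_factorization in auto)
    qed (use z s omega_series_factorization in auto)
  qed
qed

lemma power_le_fact_exp: "x \<ge> 0 \<Longrightarrow> x ^ m \<le> fact m * exp (x :: real)"
proof -
  assume x: "x \<ge> 0"
  have "(\<Sum>n\<in>{m}. x ^ n / fact n) \<le> (\<Sum>n. x ^ n / fact n)"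
    using x summable_exp[of x] by (intro sum_le_suminf) (auto simp: divide_inverse mult_ac)
  also have "\<dots> = exp x" by (simp add: exp_def divide_inverse mult_ac)
  finally show ?thesis by (simp add: field_simps)
qed

text \<open>The power of the logarithm grows with k, but each such power is at most a multiple of
  |Im s| + 8. The loss caused by narrow Gaussians is therefore the same for all k.\<close>

theorem omega_series_deriv_bound_high:
  fixes r :: real
  assumes r: "0 < r" "r \<le> 1"
  obtains C where "C \<ge> 0" "\<And>z s. norm z = 1 \<Longrightarrow> 1 < Re s \<Longrightarrow> Re s \<le> 2 \<Longrightarrow> r \<le> \<bar>Im s\<bar> \<Longrightarrow>
    norm ((deriv ^^ k) (\<lambda>s. omega_series z s / s) s) \<le> C * (\<bar>Im s\<bar> + 8)"
proof -
  obtain C m where C: "C \<ge> 0" "\<And>z s. norm z = 1 \<Longrightarrow> 1 < Re s \<Longrightarrow> Re s \<le> 2 \<Longrightarrow> r \<le> \<bar>Im s\<bar> \<Longrightarrow>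
    norm ((deriv ^^ k) (\<lambda>s. omega_series z s / s) s) \<le> C * log_height (Im s) ^ m"
    using polylog_omega_series[OF r, of k] unfolding polylog_def by blast
  show ?thesis
  proof (rule that[of "C * fact m"])
    fix z s :: complex assume "norm z = 1" "1 < Re s" "Re s \<le> 2" "r \<le> \<bar>Im s\<bar>"
    hence "norm ((deriv ^^ k) (\<lambda>s. omega_series z s / s) s) \<le> C * log_height (Im s) ^ m" by (rule C(2))
    also have "log_height (Im s) ^ m \<le> fact m * exp (log_height (Im s))"
      using log_height_ge[of "Im s"] by (intro power_le_fact_exp) auto
    also have "exp (log_height (Im s)) = \<bar>Im s\<bar> + 8" by (rule exp_log_height)
    finally show "norm ((deriv ^^ k) (\<lambda>s. omega_series z s / s) s) \<le> C * fact m * (\<bar>Im s\<bar> + 8)"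
      using C(1) by (simp add: mult.assoc mult_left_mono)
  qed (use C in auto)
qed

section \<open>The singularity at s = 1\<close>

lemma norm_pochhammer_le:
  assumes "norm (z :: complex) \<le> 1"
  shows "norm (pochhammer z k) \<le> fact k"
proof -
  have "norm (pochhammer z k) = (\<Prod>i<k. norm (z + of_nat i))"
    by (simp add: pochhammer_prod prod_norm atLeast0LessThan)
  also have "\<dots> \<le> (\<Prod>i<k. 1 + real i)"
    using assms by (intro prod_mono conjI norm_triangle_mono) auto
  also have "\<dots> = pochhammer 1 k" by (simp add: pochhammer_prod atLeast0LessThan)
  finally show ?thesis by (simp add: pochhammer_fact)
qed

lemma higher_deriv_powr_shift:
  assumes "Re s > 1"
  shows "(deriv ^^ k) (\<lambda>s. (s - 1) powr (-z)) s = (-1) ^ k * pochhammer z k * (s - 1) powr (- z - of_nat k)"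
  using assms
proof (induction k arbitrary: s)
  case (Suc k)
  have "(deriv ^^ Suc k) (\<lambda>s. (s - 1) powr (-z)) s = deriv ((deriv ^^ k) (\<lambda>s. (s - 1) powr (-z))) s" by simp
  also have "\<dots> = (-1) ^ Suc k * pochhammer z (Suc k) * (s - 1) powr (- z - of_nat (Suc k))"
  proof (rule DERIV_imp_deriv)
    have nr: "s - 1 \<notin> \<real>\<^sub>\<le>\<^sub>0" using Suc.prems by (auto simp: complex_nonpos_Reals_iff)
    have "((\<lambda>s. (s - 1) powr (- z - of_nat k)) has_field_derivative (- z - of_nat k) * (s - 1) powr (- z - of_nat k - 1) * (1 - 0)) (at s)"
      by (rule DERIV_chain2[where g = "\<lambda>s. s - 1", OF has_field_derivative_powr[OF nr]])
         (intro DERIV_diff DERIV_ident DERIV_const)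
    hence "((\<lambda>s. (-1) ^ k * pochhammer z k * (s - 1) powr (- z - of_nat k)) has_field_derivative
        (-1) ^ k * pochhammer z k * ((- z - of_nat k) * (s - 1) powr (- z - of_nat k - 1) * (1 - 0))) (at s)"
      by (rule DERIV_cmult)
    also have "(-1) ^ k * pochhammer z k * ((- z - of_nat k) * (s - 1) powr (- z - of_nat k - 1) * (1 - 0))
       = (-1) ^ Suc k * pochhammer z (Suc k) * (s - 1) powr (- z - of_nat (Suc k))"
    proof -
      have e: "- z - of_nat k - 1 = - z - of_nat (Suc k)" by simp
      show ?thesis unfolding e pochhammer_Suc by (simp add: algebra_simps)
    qed
    finally show "((deriv ^^ k) (\<lambda>s. (s - 1) powr (-z)) has_field_derivative
        (-1) ^ Suc k * pochhammer z (Suc k) * (s - 1) powr (- z - of_nat (Suc k))) (at s)"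
      by (rule has_field_derivative_transform_within_open[OF _ open_Re_gt_1]) (use Suc in auto)
  qed
  finally show ?case .
qed simp

text \<open>The argument of w enters through exp(Im z * Arg w), which is at most exp pi.\<close>

lemma norm_powr_le:
  assumes "norm z = 1"
  shows "norm (w powr (- z - of_nat k)) \<le> exp pi * norm w powr (- Re z - real k)"
proof -
  have "\<bar>Im z * Arg w\<bar> \<le> 1 * pi"
    unfolding abs_mult using abs_Im_le_cmod[of z] assms Arg_bounded[of w]
    by (intro mult_mono) auto
  hence "exp (Im z * Arg w) \<le> exp pi" by simp
  moreover have "norm (w powr (- z - of_nat k)) = norm w powr (- Re z - real k) * exp (Im z * Arg w)"
    by (simp add: norm_powr_complex)
  ultimately show ?thesis
    using mult_right_mono[of "exp (Im z * Arg w)" "exp pi" "norm w powr (- Re z - real k)"]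
    by (simp add: mult.commute)
qed

text \<open>By \<open>norm_log_zeta_le\<close> the norm is at most the real part, which leaves no
  room for an imaginary part.\<close>

lemma log_zeta_real: "\<sigma> > 1 \<Longrightarrow> Im (log_zeta (of_real \<sigma>)) = 0"
  using norm_log_zeta_le[of "of_real \<sigma>"] cmod_eq_Re[of "log_zeta (of_real \<sigma>)"]
  by (smt (verit) Re_complex_of_real complex_Re_le_cmod cmod_power2 power2_eq_iff power2_less_eq_zero_iff zero_eq_power2)

text \<open>Near 1 the function is (s - 1)^(-z) h(s) with h holomorphic and h(1) =
  \<open>corr_prod z 1\<close>. In Leibniz' formula the term with all derivatives on the power
  dominates; the others, and the replacement of h(s) by h(1), are smaller by a factor |s - 1|. The
  sign (-1)^k cancels the one from differentiating the power.\<close>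

theorem omega_series_near_one:
  obtains r :: real where "0 < r" "r \<le> 1/4"
    "\<And>k. \<exists>C\<ge>0. \<forall>z s. norm z = 1 \<longrightarrow> 1 < Re s \<longrightarrow> norm (s - 1) \<le> 2 * r \<longrightarrow>
       norm ((-1) ^ k * (deriv ^^ k) (\<lambda>s. omega_series z s / s) s - corr_prod z 1 * pochhammer z k * (s - 1) powr (- z - of_nat k))
         \<le> C * norm (s - 1) powr (- Re z - real k + 1)"
proof -
  have "isCont pole_free_zeta 1"
    using holomorphic_on_imp_continuous_on[OF pole_free_zeta_holomorphic]
    by (rule continuous_on_interior) (simp add: interior_open open_halfspace_Re_gt)
  hence "\<forall>\<^sub>F w in nhds 1. dist (pole_free_zeta w) (pole_free_zeta 1) < 1/2"
    unfolding isCont_def tendsto_at_iff_tendsto_nhds by (rule tendstoD) simp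
  then obtain d where d: "d > 0" "\<And>w. dist w 1 < d \<Longrightarrow> norm (pole_free_zeta w - 1) < 1/2"
    unfolding eventually_nhds_metric by (auto simp: pole_free_zeta_1 dist_norm)
  \<comment> \<open>On this disc (s - 1) zeta(s) stays within 1/2 of 1, so its principal logarithm
    is holomorphic, and Re s > 3/4, as \<open>corr_prod\<close> requires.\<close>
  define R where "R = min d (1/8)"
  have R: "R > 0" "R \<le> 1/8" "\<And>w. w \<in> ball 1 R \<Longrightarrow> norm (pole_free_zeta w - 1) < 1/2"
    using d by (auto simp: R_def dist_commute)
  have BR: "Re w > 3/4" if "w \<in> ball 1 R" for w
    using that abs_Re_le_cmod[of "1 - w"] R(2) by (auto simp: dist_norm)
  define lz where "lz = (\<lambda>w. Ln (pole_free_zeta w))"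
  have nz: "pole_free_zeta w \<notin> \<real>\<^sub>\<le>\<^sub>0" "pole_free_zeta w \<noteq> 0" if "w \<in> ball 1 R" for w
  proof -
    have "Re (pole_free_zeta w) > 0"
      using R(3)[OF that] abs_Re_le_cmod[of "pole_free_zeta w - 1"] by simp
    thus "pole_free_zeta w \<notin> \<real>\<^sub>\<le>\<^sub>0" "pole_free_zeta w \<noteq> 0" by (auto simp: complex_nonpos_Reals_iff)
  qed
  have lz_holo: "lz holomorphic_on ball 1 R"
    unfolding lz_def
    by (intro holomorphic_intros holomorphic_on_subset[OF pole_free_zeta_holomorphic])
       (use nz BR in force)+
  have lz_le: "norm (lz w) \<le> 1" if "w \<in> ball 1 R" for w
    using norm_Ln_le[of "pole_free_zeta w - 1"] R(3)[OF that] by (simp add: lz_def)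
  define S where "S = ball 1 R \<inter> {s. Re s > 1}"
  have S: "open S" "convex S"
    unfolding S_def by (auto intro: open_Int convex_Int open_Re_gt_1 convex_Re_gt_1)
  \<comment> \<open>The difference D of the two logarithms satisfies exp D = 1, so it is a constant
    2 pi i n on the convex set S. At a real point \<open>log_zeta\<close> and
    \<open>Ln (s - 1)\<close> are real and |lz| \<le> 1 < 2 pi, which forces n = 0.\<close>
  have log_eq: "log_zeta s = lz s - Ln (s - 1)" if "s \<in> S" for s
  proof -
    define D where "D = (\<lambda>s. log_zeta s + Ln (s - 1) - lz s)"
    have D_holo: "D holomorphic_on S"
      unfolding D_def
    proof (intro holomorphic_intros)
      show "log_zeta holomorphic_on S" by (rule holomorphic_on_subset[OF log_zeta_holomorphic]) (auto simp: S_def)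
      show "lz holomorphic_on S" by (rule holomorphic_on_subset[OF lz_holo]) (auto simp: S_def)
    qed (auto simp: S_def complex_nonpos_Reals_iff)
    have D1: "exp (D w) = 1" if "w \<in> S" for w
    proof -
      have w: "w \<in> ball 1 R" "Re w > 1" using that by (auto simp: S_def)
      have "exp (D w) = zeta w * (w - 1) / pole_free_zeta w"
      proof -
        have "w - 1 \<noteq> 0" using w(2) by auto
        hence "exp (Ln (w - 1)) = w - 1" by (rule exp_Ln)
        thus ?thesis using w nz(2)[OF w(1)] unfolding D_def lz_def exp_add exp_diff
          by (simp add: exp_log_zeta)
      qed
      also have "\<dots> = 1" using w nz[OF w(1)] by (simp add: pole_free_zeta_eq mult.commute)
      finally show ?thesis .
    qed
    have "\<exists>c. \<forall>w\<in>S. D w = c"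
    proof (rule has_field_derivative_zero_constant[OF S(2)])
      fix w assume w: "w \<in> S"
      have dD: "(D has_field_derivative deriv D w) (at w)"
        by (rule holomorphic_derivI[OF D_holo S(1) w])
      hence "((\<lambda>w. exp (D w)) has_field_derivative exp (D w) * deriv D w) (at w)"
        by (auto intro!: derivative_eq_intros)
      moreover have "((\<lambda>w. exp (D w)) has_field_derivative 0) (at w)"
        by (rule has_field_derivative_transform_within_open[OF DERIV_const S(1) w]) (simp add: D1)
      ultimately have "exp (D w) * deriv D w = 0" by (rule DERIV_unique)
      thus "(D has_field_derivative 0) (at w within S)"
        using dD by (simp add: has_field_derivative_at_within)
    qed
    then obtain c where c: "\<And>w. w \<in> S \<Longrightarrow> D w = c" by blast
    define s0 where "s0 = complex_of_real (1 + R / 2)"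
    have s0: "s0 \<in> S" using R by (auto simp: S_def s0_def dist_norm norm_divide)
    have "Im (log_zeta s0) = 0" unfolding s0_def using R by (intro log_zeta_real) auto
    moreover have "Im (Ln (s0 - 1)) = 0"
    proof -
      have "s0 - 1 = of_real (R / 2)" by (simp add: s0_def)
      moreover have "Ln (of_real (R / 2)) = of_real (ln (R / 2))" using R by (intro Ln_of_real) auto
      ultimately show ?thesis by (simp only: Im_complex_of_real)
    qed
    ultimately have "Im c = - Im (lz s0)" using c[OF s0] by (auto simp: D_def)
    hence Imc: "\<bar>Im c\<bar> \<le> 1"
      using abs_Im_le_cmod[of "lz s0"] lz_le[of s0] s0 by (simp add: S_def)
    have "exp c = 1" using D1[OF s0] c[OF s0] by simp
    then obtain n :: int where n: "Re c = 0" "Im c = of_int (2 * n) * pi"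
      unfolding exp_eq_1 by auto
    have "n = 0"
    proof (rule ccontr)
      assume "n \<noteq> 0"
      hence "\<bar>real_of_int (2 * n)\<bar> \<ge> 1" by linarith
      hence "\<bar>real_of_int (2 * n)\<bar> * pi \<ge> 1 * pi" by (intro mult_right_mono) auto
      moreover have "\<bar>Im c\<bar> = \<bar>real_of_int (2 * n)\<bar> * pi" unfolding n(2) abs_mult by simp
      ultimately show False using Imc pi_gt3 by linarith
    qed
    hence "c = 0" using n by (simp add: complex_eq_iff)
    thus ?thesis using c[OF that] by (simp add: D_def algebra_simps)
  qed
  define h where "h = (\<lambda>z s. exp (z * lz s) * (corr_prod z s / s))"
  define K where "K = exp 1 * (2 * corr_bound)"
  have Kpos: "K > 0" by (simp add: K_def corr_bound_def)
  have h_holo: "h z holomorphic_on ball 1 R" if "norm z = 1" for z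
    unfolding h_def using BR
    by (intro holomorphic_on_mult holomorphic_on_exp' lz_holo holomorphic_on_const holomorphic_on_subset[OF corr_prod_over_s(1)[OF that]]) auto
  have h_le: "norm (h z s) \<le> K" if "norm z = 1" "s \<in> ball 1 R" for z s
  proof -
    have "norm (exp (z * lz s)) \<le> exp (norm (z * lz s))" by (rule norm_exp)
    also have "\<dots> \<le> exp 1" using lz_le[OF that(2)] that by (simp add: norm_mult)
    finally show ?thesis unfolding h_def K_def norm_mult
      using corr_prod_over_s(2)[OF that(1) BR[OF that(2)]] by (intro mult_mono) auto
  qed
  have h1: "h z 1 = corr_prod z 1" for z by (simp add: h_def lz_def pole_free_zeta_1)
  have fac: "omega_series z s / s = (s - 1) powr (-z) * h z s" if z: "norm z = 1" and s: "s \<in> S" for z s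
  proof -
    have "Re s > 1" "s \<noteq> 1" using s by (auto simp: S_def)
    thus ?thesis using omega_series_factorization[OF z, of s] log_eq[OF s]
      by (simp add: h_def powr_def algebra_simps exp_diff exp_minus divide_inverse)
  qed
  have hd: "norm ((deriv ^^ j) (h z) s) \<le> fact j * K / (R / 4) ^ j" if z: "norm z = 1" and s: "norm (s - 1) \<le> R / 2" for z s j
  proof (rule Cauchy_inequality)
    have sub: "cball s (R / 4) \<subseteq> ball 1 R"
    proof
      fix w assume "w \<in> cball s (R / 4)"
      hence "dist w s \<le> R / 4" by (simp add: dist_commute)
      moreover have "dist s 1 \<le> R / 2" using s by (simp add: dist_norm)
      ultimately have "dist w 1 < R" using dist_triangle[of w 1 s] R(1) by linarith
      thus "w \<in> ball 1 R" by (simp add: dist_commute)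
    qed
    have hh: "h z holomorphic_on cball s (R / 4)" by (rule holomorphic_on_subset[OF h_holo[OF z] sub])
    show "h z holomorphic_on ball s (R / 4)" by (rule holomorphic_on_subset[OF hh]) auto
    show "continuous_on (cball s (R / 4)) (h z)" by (rule holomorphic_on_imp_continuous_on[OF hh])
    fix w assume "norm (s - w) = R / 4"
    hence "w \<in> cball s (R / 4)" by (simp add: dist_norm)
    thus "norm (h z w) \<le> K" using sub z by (intro h_le) auto
  qed (use R in auto)
  show ?thesis
  \<comment> \<open>For |s - 1| \<le> R / 2 the Cauchy disc of radius R / 4 about s lies in the disc
    where h is bounded.\<close>
  proof (rule that[of "R / 4"])
    fix k
    \<comment> \<open>B collects the lower terms of Leibniz' formula; the other summand of C comes
      from h(s) - h(1).\<close>
    define B where "B = (\<Sum>i<k. real (k choose i) * (fact i * exp pi * (fact (k - i) * K / (R / 4) ^ (k - i))))"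
    define C where "C = fact k * exp pi * (K / (R / 4)) + B"
    have B: "B \<ge> 0" unfolding B_def using Kpos R by (intro sum_nonneg) auto
    have C: "C \<ge> 0" using Kpos R B by (simp add: C_def)
    have "norm ((-1) ^ k * (deriv ^^ k) (\<lambda>s. omega_series z s / s) s - corr_prod z 1 * pochhammer z k * (s - 1) powr (- z - of_nat k))
         \<le> C * norm (s - 1) powr (- Re z - real k + 1)"
      if z: "norm z = 1" and s: "1 < Re s" and near: "norm (s - 1) \<le> 2 * (R / 4)" for z s
    proof -
      define P where "P = (\<lambda>s. (s - 1) powr (-z))"
      define x where "x = norm (s - 1)"
      have x: "0 < x" "x \<le> R / 2" "x \<le> 1" using s near R by (auto simp: x_def)
      have sS: "s \<in> S" using s near R by (auto simp: S_def dist_norm norm_minus_commute)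
      have P_holo: "P holomorphic_on S" unfolding P_def
        by (intro holomorphic_intros) (auto simp: S_def complex_nonpos_Reals_iff)
      have hS: "h z holomorphic_on S" by (rule holomorphic_on_subset[OF h_holo[OF z]]) (auto simp: S_def)
      have Ph: "(\<lambda>s. P s * h z s) holomorphic_on S" by (intro holomorphic_intros P_holo hS)
      have Pd: "(deriv ^^ i) P s = (-1) ^ i * pochhammer z i * (s - 1) powr (- z - of_nat i)" for i
        unfolding P_def by (rule higher_deriv_powr_shift[OF s])
      have Pn: "norm ((deriv ^^ i) P s) \<le> fact i * exp pi * x powr (- Re z - real i)" for i
      proof -
        have "norm ((deriv ^^ i) P s) = norm (pochhammer z i) * norm ((s - 1) powr (- z - of_nat i))"
          by (simp add: Pd norm_mult norm_power)
        also have "\<dots> \<le> fact i * (exp pi * x powr (- Re z - real i))"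
          unfolding x_def using z by (intro mult_mono norm_pochhammer_le norm_powr_le) auto
        finally show ?thesis by (simp add: mult_ac)
      qed
      have "(deriv ^^ k) (\<lambda>s. omega_series z s / s) s = (deriv ^^ k) (\<lambda>s. P s * h z s) s"
      proof (rule higher_deriv_transform_within_open[OF _ Ph S(1) sS])
        show "(\<lambda>s. omega_series z s / s) holomorphic_on S"
          by (rule holomorphic_transform[OF Ph]) (simp add: fac[OF z] P_def)
      qed (simp add: fac[OF z] P_def)
      also have "\<dots> = (\<Sum>i=0..k. of_nat (k choose i) * (deriv ^^ i) P s * (deriv ^^ (k - i)) (h z) s)"
        by (rule higher_deriv_mult[OF P_holo hS S(1) sS])
      also have "\<dots> = (\<Sum>i<k. of_nat (k choose i) * (deriv ^^ i) P s * (deriv ^^ (k - i)) (h z) s) + (deriv ^^ k) P s * h z s"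
        by (simp add: atLeast0AtMost flip: lessThan_Suc_atMost)
      finally have eq: "(deriv ^^ k) (\<lambda>s. omega_series z s / s) s =
        (\<Sum>i<k. of_nat (k choose i) * (deriv ^^ i) P s * (deriv ^^ (k - i)) (h z) s) + (deriv ^^ k) P s * h z s"
        (is "_ = ?E + _") .
      have E: "norm ?E \<le> B * x powr (- Re z - real k + 1)"
        unfolding B_def sum_distrib_right
      proof (rule sum_norm_le)
        fix i assume i: "i \<in> {..<k}"
        have px: "x powr (- Re z - real i) \<le> x powr (- Re z - real k + 1)"
          using x i by (intro powr_mono') auto
        have "norm (of_nat (k choose i) * (deriv ^^ i) P s * (deriv ^^ (k - i)) (h z) s)
           \<le> real (k choose i) * (fact i * exp pi * x powr (- Re z - real k + 1)) * (fact (k - i) * K / (R / 4) ^ (k - i))"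
          unfolding norm_mult norm_of_nat using z near R Kpos px
          by (intro mult_mono hd order_trans[OF Pn] mult_left_mono) auto
        thus "norm (of_nat (k choose i) * (deriv ^^ i) P s * (deriv ^^ (k - i)) (h z) s)
           \<le> real (k choose i) * (fact i * exp pi * (fact (k - i) * K / (R / 4) ^ (k - i))) * x powr (- Re z - real k + 1)"
          by (simp only: mult_ac)
      qed
      have hdiff: "norm (h z s - h z 1) \<le> K / (R / 4) * x"
      proof -
        have "norm (h z s - h z 1) \<le> K / (R / 4) * norm (s - 1)"
        proof (rule field_differentiable_bound[of "cball 1 (R / 2)"])
          fix w :: complex assume w: "w \<in> cball 1 (R / 2)"
          hence "w \<in> ball 1 R" using R by auto
          thus "(h z has_field_derivative deriv (h z) w) (at w within cball 1 (R / 2))"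
            by (intro has_field_derivative_at_within[OF holomorphic_derivI[OF h_holo[OF z] open_ball]])
          show "norm (deriv (h z) w) \<le> K / (R / 4)"
            using hd[OF z, of w 1] w by (simp add: dist_norm norm_minus_commute)
        qed (use near R in \<open>auto simp: dist_norm norm_minus_commute\<close>)
        thus ?thesis by (simp add: x_def)
      qed
      have "(-1) ^ k * (deriv ^^ k) (\<lambda>s. omega_series z s / s) s - corr_prod z 1 * pochhammer z k * (s - 1) powr (- z - of_nat k)
        = (-1) ^ k * ((deriv ^^ k) P s * (h z s - h z 1)) + (-1) ^ k * ?E"
      proof -
        have "(-1) ^ k * (-1) ^ k = (1 :: complex)" by (simp flip: power_mult_distrib)
        hence "(-1) ^ k * (deriv ^^ k) P s = pochhammer z k * (s - 1) powr (- z - of_nat k)"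
          unfolding Pd by (metis mult.assoc mult_1)
        hence "(-1) ^ k * ((deriv ^^ k) P s * (h z s - h z 1)) = (-1) ^ k * ((deriv ^^ k) P s * h z s) - corr_prod z 1 * pochhammer z k * (s - 1) powr (- z - of_nat k)"
          unfolding h1 by (simp add: algebra_simps)
        thus ?thesis unfolding eq by (simp only: distrib_left) (simp only: algebra_simps)
      qed
      also have "norm \<dots> \<le> (fact k * exp pi * x powr (- Re z - real k)) * (K / (R / 4) * x) + B * x powr (- Re z - real k + 1)"
      proof (rule norm_triangle_mono)
        show "norm ((-1) ^ k * ((deriv ^^ k) P s * (h z s - h z 1))) \<le> (fact k * exp pi * x powr (- Re z - real k)) * (K / (R / 4) * x)"
        proof -
          have "norm ((-1) ^ k * ((deriv ^^ k) P s * (h z s - h z 1))) = norm ((deriv ^^ k) P s) * norm (h z s - h z 1)"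
            by (simp add: norm_mult norm_power)
          also have "\<dots> \<le> (fact k * exp pi * x powr (- Re z - real k)) * (K / (R / 4) * x)"
            by (intro mult_mono Pn hdiff) auto
          finally show ?thesis .
        qed
        show "norm ((-1) ^ k * ?E) \<le> B * x powr (- Re z - real k + 1)"
          using E by (simp add: norm_mult norm_power)
      qed
      also have "\<dots> = C * x powr (- Re z - real k + 1)"
      proof -
        have "x powr (- Re z - real k + 1) = x powr (- Re z - real k) * x"
          using x by (subst powr_add) simp
        thus ?thesis by (simp add: C_def algebra_simps)
      qed
      finally show ?thesis by (simp add: x_def)
    qed
    thus "\<exists>C\<ge>0. \<forall>z s. norm z = 1 \<longrightarrow> 1 < Re s \<longrightarrow> norm (s - 1) \<le> 2 * (R / 4) \<longrightarrow>
       norm ((-1) ^ k * (deriv ^^ k) (\<lambda>s. omega_series z s / s) s - corr_prod z 1 * pochhammer z k * (s - 1) powr (- z - of_nat k))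
         \<le> C * norm (s - 1) powr (- Re z - real k + 1)"
      using C by blast
  qed (use R in auto)
qed

section \<open>Laplace transforms\<close>

text \<open>Vanishing on the negative axis lets all integrals run over the whole line, and growth
  below every exponential gives a transform on all of Re \<xi> > 0.\<close>

definition subexp :: "(real \<Rightarrow> complex) \<Rightarrow> bool" where
  "subexp f \<longleftrightarrow> f \<in> borel_measurable borel \<and> (\<forall>v<0. f v = 0) \<and> (\<forall>\<epsilon>>0. \<exists>C\<ge>0. \<forall>v\<ge>0. norm (f v) \<le> C * exp (\<epsilon> * v))"

definition laplace :: "(real \<Rightarrow> complex) \<Rightarrow> complex \<Rightarrow> complex" where
  "laplace f \<xi> = (LBINT v. f v * exp (- \<xi> * of_real v))"

lemma subexp_measurable [measurable_dest]: "subexp f \<Longrightarrow> f \<in> borel_measurable borel"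
  by (simp add: subexp_def)

lemma subexp_bound:
  assumes "subexp f" "\<epsilon> > 0"
  obtains C where "C \<ge> 0" "\<And>v. norm (f v) \<le> C * exp (\<epsilon> * v) * indicator {0..} v"
proof -
  obtain C where C: "C \<ge> 0" "\<And>v. v \<ge> 0 \<Longrightarrow> norm (f v) \<le> C * exp (\<epsilon> * v)"
    using assms unfolding subexp_def by blast
  have "norm (f v) \<le> C * exp (\<epsilon> * v) * indicator {0..} v" for v
    using C(2)[of v] assms(1) by (cases "v < 0") (auto simp: subexp_def)
  thus ?thesis using that C(1) by blast
qed

lemma subexp_diff:
  assumes "subexp f" "subexp g"
  shows "subexp (\<lambda>v. f v - g v)"
  unfolding subexp_def
proof (intro conjI allI impI)
  show "(\<lambda>v. f v - g v) \<in> borel_measurable borel"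
    using assms by (auto dest!: subexp_measurable)
  show "f v - g v = 0" if "v < 0" for v using assms that by (simp add: subexp_def)
  fix \<epsilon> :: real assume e: "\<epsilon> > 0"
  obtain C where C: "C \<ge> 0" "\<And>v. norm (f v) \<le> C * exp (\<epsilon> * v) * indicator {0..} v"
    using subexp_bound[OF assms(1) e] by blast
  obtain D where D: "D \<ge> 0" "\<And>v. norm (g v) \<le> D * exp (\<epsilon> * v) * indicator {0..} v"
    using subexp_bound[OF assms(2) e] by blast
  have "norm (f v - g v) \<le> (C + D) * exp (\<epsilon> * v)" if "v \<ge> 0" for v
    using norm_triangle_ineq4[of "f v" "g v"] C(2)[of v] D(2)[of v] that
    by (simp add: algebra_simps)
  thus "\<exists>C\<ge>0. \<forall>v\<ge>0. norm (f v - g v) \<le> C * exp (\<epsilon> * v)"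
    using C(1) D(1) by (intro exI[of _ "C + D"]) auto
qed

lemma subexp_mult_linear:
  assumes "subexp f"
  shows "subexp (\<lambda>v. c * of_real v * f v)"
  unfolding subexp_def
proof (intro conjI allI impI)
  show "(\<lambda>v. c * of_real v * f v) \<in> borel_measurable borel"
    using assms by (auto dest!: subexp_measurable)
  show "c * of_real v * f v = 0" if "v < 0" for v using assms that by (simp add: subexp_def)
  fix \<epsilon> :: real assume e: "\<epsilon> > 0"
  obtain C where C: "C \<ge> 0" "\<And>v. norm (f v) \<le> C * exp (\<epsilon> / 2 * v) * indicator {0..} v"
    using subexp_bound[OF assms, of "\<epsilon> / 2"] e by auto
  have "norm (c * of_real v * f v) \<le> norm c * (2 / \<epsilon>) * C * exp (\<epsilon> * v)" if v: "v \<ge> 0" for v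
  proof -
    have "\<epsilon> / 2 * v \<le> exp (\<epsilon> / 2 * v)" using exp_ge_add_one_self[of "\<epsilon> / 2 * v"] by linarith
    hence v': "v \<le> 2 / \<epsilon> * exp (\<epsilon> / 2 * v)" using e by (simp add: field_simps)
    have "norm (c * of_real v * f v) = norm c * v * norm (f v)" using v by (simp add: norm_mult)
    also have "\<dots> \<le> norm c * (2 / \<epsilon> * exp (\<epsilon> / 2 * v)) * (C * exp (\<epsilon> / 2 * v))"
      using C(2)[of v] v v' e by (intro mult_mono) auto
    also have "\<dots> = norm c * (2 / \<epsilon>) * C * (exp (\<epsilon> / 2 * v) * exp (\<epsilon> / 2 * v))" by (simp add: mult_ac)
    also have "exp (\<epsilon> / 2 * v) * exp (\<epsilon> / 2 * v) = exp (\<epsilon> * v)" by (simp flip: exp_add)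
    finally show ?thesis .
  qed
  thus "\<exists>C\<ge>0. \<forall>v\<ge>0. norm (c * of_real v * f v) \<le> C * exp (\<epsilon> * v)"
    using C(1) e by (intro exI[of _ "norm c * (2 / \<epsilon>) * C"]) auto
qed

lemma subexp_mult_const: "subexp f \<Longrightarrow> subexp (\<lambda>v. c * f v)"
  unfolding subexp_def
proof safe
  assume f: "f \<in> borel_measurable borel"
  thus "(\<lambda>v. c * f v) \<in> borel_measurable borel" by auto
next
  fix \<epsilon> :: real assume "\<epsilon> > 0" "\<forall>\<epsilon>>0. \<exists>C\<ge>0. \<forall>v\<ge>0. cmod (f v) \<le> C * exp (\<epsilon> * v)"
  then obtain C where C: "C \<ge> 0" "\<And>v. v \<ge> 0 \<Longrightarrow> norm (f v) \<le> C * exp (\<epsilon> * v)" by blast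
  show "\<exists>C\<ge>0. \<forall>v\<ge>0. cmod (c * f v) \<le> C * exp (\<epsilon> * v)"
    using C by (intro exI[of _ "norm c * C"]) (auto simp: norm_mult mult.assoc mult_left_mono)
qed auto

lemma subexp_mult_power:
  assumes "subexp f"
  shows "subexp (\<lambda>v. (c * of_real v) ^ k * f v)"
proof (induction k)
  case (Suc k)
  thus ?case using subexp_mult_linear[OF Suc, of c] by (simp add: mult_ac)
qed (use assms in simp)

lemma integrable_exp_halfline:
  fixes u :: real
  assumes "u > 0"
  shows "integrable lborel (\<lambda>v. exp (- u * v) * indicator {0..} v :: real)"
proof -
  have "integrable lborel (\<lambda>x. x ^ 0 * exp (-x) * indicator {0..} x :: real)"
    using has_bochner_integral_I0i_power_exp_m'[of 0] by (rule integrable.intros)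
  hence "integrable lborel (\<lambda>x. (0 + u * x) ^ 0 * exp (-(0 + u * x)) * indicator {0..} (0 + u * x) :: real)"
    by (rule lborel_integrable_real_affine) (use assms in simp)
  moreover have "indicator {0..} (0 + u * x) = (indicator {0..} x :: real)" for x
    using assms by (auto simp: indicator_def zero_le_mult_iff)
  ultimately show ?thesis by simp
qed

lemma subexp_integrable:
  assumes f: "subexp f" and \<xi>: "Re \<xi> > 0"
  shows "integrable lborel (\<lambda>v. f v * exp (- \<xi> * of_real v))"
proof -
  obtain C where C: "C \<ge> 0" "\<And>v. norm (f v) \<le> C * exp (Re \<xi> / 2 * v) * indicator {0..} v"
    using subexp_bound[OF f, of "Re \<xi> / 2"] \<xi> by auto
  show ?thesis
  proof (rule Bochner_Integration.integrable_bound)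
    show "integrable lborel (\<lambda>v. C * (exp (- (Re \<xi> / 2) * v) * indicator {0..} v))"
      using \<xi> by (intro integrable_mult_right integrable_exp_halfline) auto
    show "(\<lambda>v. f v * exp (- \<xi> * of_real v)) \<in> borel_measurable lborel"
      using subexp_measurable[OF f] by measurable
    show "AE v in lborel. norm (f v * exp (- \<xi> * of_real v)) \<le> norm (C * (exp (- (Re \<xi> / 2) * v) * indicator {0..} v))"
    proof (rule AE_I2)
      fix v :: real
      have "norm (f v * exp (- \<xi> * of_real v)) = norm (f v) * exp (- Re \<xi> * v)"
        by (simp add: norm_mult norm_exp_eq_Re)
      also have "\<dots> \<le> (C * exp (Re \<xi> / 2 * v) * indicator {0..} v) * exp (- Re \<xi> * v)"
        by (intro mult_right_mono C) auto
      also have "\<dots> = C * ((exp (Re \<xi> / 2 * v) * exp (- Re \<xi> * v)) * indicator {0..} v)" by (simp add: mult_ac)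
      also have "exp (Re \<xi> / 2 * v) * exp (- Re \<xi> * v) = exp (- (Re \<xi> / 2) * v)"
        by (simp flip: exp_add)
      finally show "norm (f v * exp (- \<xi> * of_real v)) \<le> norm (C * (exp (- (Re \<xi> / 2) * v) * indicator {0..} v))"
        by simp
    qed
  qed
qed

lemma laplace_diff:
  assumes "subexp f" "subexp g" "Re \<xi> > 0"
  shows "laplace (\<lambda>v. f v - g v) \<xi> = laplace f \<xi> - laplace g \<xi>"
  unfolding laplace_def left_diff_distrib
  by (rule Bochner_Integration.integral_diff) (use subexp_integrable assms in auto)

lemma laplace_cmult: "laplace (\<lambda>v. c * f v) \<xi> = c * laplace f \<xi>"
  by (simp add: laplace_def mult.assoc)

lemma norm_exp_minus_linear_le:
  fixes w :: complex
  shows "norm (exp w - 1 - w) \<le> exp (norm w) * norm w ^ 2"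
  using Taylor_exp_field[of w 1] by (simp add: algebra_simps power2_eq_square)

text \<open>The remainder of the linear approximation under the integral is at most |h|^2 times v^2
  |f(v)| with a decaying exponential, because |exp w - 1 - w| \<le> exp |w| |w|^2.\<close>

lemma laplace_deriv:
  assumes f: "subexp f" and \<xi>: "Re \<xi> > 0"
  shows "(laplace f has_field_derivative laplace (\<lambda>v. - of_real v * f v) \<xi>) (at \<xi>)"
proof -
  \<comment> \<open>For |h| \<le> \<sigma> the factor exp(|h| v) is absorbed by exp(- Re \<xi> v),
    and decay at rate \<sigma> is still left.\<close>
  define \<sigma> where "\<sigma> = Re \<xi> / 4"
  have \<sigma>: "\<sigma> > 0" using \<xi> by (simp add: \<sigma>_def)
  define g where "g = (\<lambda>v. of_real v * (of_real v * f v))"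
  have g: "subexp g"
    using subexp_mult_linear[OF subexp_mult_linear[OF f, of 1], of 1] by (simp add: g_def)
  have f1: "subexp (\<lambda>v. - of_real v * f v)"
    using subexp_mult_linear[OF f, of "-1"] by simp
  define K where "K = (LBINT v. norm (g v * exp (- of_real \<sigma> * of_real v)))"
  have Kint: "integrable lborel (\<lambda>v. norm (g v * exp (- of_real \<sigma> * of_real v)))"
    using \<sigma> by (intro integrable_norm subexp_integrable[OF g]) auto
  have K: "K \<ge> 0" by (simp add: K_def)
  have main: "norm (laplace f (\<xi> + h) - laplace f \<xi> - h * laplace (\<lambda>v. - of_real v * f v) \<xi>) \<le> norm h ^ 2 * K"
    if h: "norm h \<le> \<sigma>" for h
  proof -
    have re: "Re (\<xi> + h) > 0" using h abs_Re_le_cmod[of h] \<sigma> by (simp add: \<sigma>_def)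
    let ?F = "\<lambda>v. f v * exp (- (\<xi> + h) * of_real v) - f v * exp (- \<xi> * of_real v) - h * (- of_real v * f v * exp (- \<xi> * of_real v))"
    have i1: "integrable lborel (\<lambda>v. f v * exp (- (\<xi> + h) * of_real v))" by (rule subexp_integrable[OF f re])
    have i2: "integrable lborel (\<lambda>v. f v * exp (- \<xi> * of_real v))" by (rule subexp_integrable[OF f \<xi>])
    have i3: "integrable lborel (\<lambda>v. h * (- of_real v * f v * exp (- \<xi> * of_real v)))"
      by (intro integrable_mult_right subexp_integrable[OF f1 \<xi>])
    have split: "laplace f (\<xi> + h) - laplace f \<xi> - h * laplace (\<lambda>v. - of_real v * f v) \<xi> = (LBINT v. ?F v)"
      unfolding laplace_def
      by (subst Bochner_Integration.integral_diff[OF Bochner_Integration.integrable_diff[OF i1 i2] i3],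
          subst Bochner_Integration.integral_diff[OF i1 i2]) simp
    have "norm (LBINT v. ?F v) \<le> (LBINT v. norm h ^ 2 * norm (g v * exp (- of_real \<sigma> * of_real v)))"
    proof (rule Bochner_Integration.integral_norm_bound_integral)
      show "integrable lborel ?F" by (intro Bochner_Integration.integrable_diff i1 i2 i3)
      show "integrable lborel (\<lambda>v. norm h ^ 2 * norm (g v * exp (- of_real \<sigma> * of_real v)))"
        by (intro integrable_mult_right Kint)
      fix v :: real
      show "norm (?F v) \<le> norm h ^ 2 * norm (g v * exp (- of_real \<sigma> * of_real v))"
      proof (cases "v < 0")
        case True
        thus ?thesis using f by (simp add: subexp_def)
      next
        case False
        define w where "w = - h * of_real v"
        have w: "norm w = norm h * v" using False by (simp add: w_def norm_mult)
        have "?F v = f v * (exp (- \<xi> * of_real v) * (exp w - 1 - w))"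
          by (simp add: w_def algebra_simps exp_add exp_diff exp_minus divide_inverse)
        also have "norm \<dots> = norm (f v) * (exp (- Re \<xi> * v) * norm (exp w - 1 - w))"
          by (simp add: norm_mult norm_exp_eq_Re)
        also have "\<dots> \<le> norm (f v) * (exp (- Re \<xi> * v) * (exp (norm w) * norm w ^ 2))"
          by (intro mult_left_mono norm_exp_minus_linear_le) auto
        also have "\<dots> \<le> norm (f v) * (exp (- Re \<xi> * v) * (exp (\<sigma> * v) * norm w ^ 2))"
        proof -
          have "norm h * v \<le> \<sigma> * v" using h False by (intro mult_right_mono) auto
          thus ?thesis unfolding w by (intro mult_left_mono mult_right_mono) auto
        qed
        also have "\<dots> = norm h ^ 2 * (v ^ 2 * norm (f v)) * (exp (- Re \<xi> * v) * exp (\<sigma> * v))"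
          unfolding w by (simp add: power_mult_distrib mult_ac)
        also have "\<dots> \<le> norm h ^ 2 * (v ^ 2 * norm (f v)) * exp (- \<sigma> * v)"
        proof (rule mult_left_mono)
          have "Re \<xi> * v \<ge> 0" using False \<xi> by (intro mult_nonneg_nonneg) auto
          thus "exp (- Re \<xi> * v) * exp (\<sigma> * v) \<le> exp (- \<sigma> * v)"
            unfolding exp_add[symmetric] exp_le_cancel_iff by (simp add: \<sigma>_def mult.commute)
        qed simp
        also have "\<dots> = norm h ^ 2 * norm (g v * exp (- of_real \<sigma> * of_real v))"
          using False by (simp add: g_def norm_mult norm_exp_eq_Re power2_eq_square)
        finally show ?thesis .
      qed
    qed
    also have "\<dots> = norm h ^ 2 * K" unfolding K_def by (rule integral_mult_right_zero)
    finally show ?thesis unfolding split .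
  qed
  have "((\<lambda>h. (laplace f (\<xi> + h) - laplace f \<xi>) / h - laplace (\<lambda>v. - of_real v * f v) \<xi>) \<longlongrightarrow> 0) (at 0)"
  proof (rule Lim_null_comparison)
    have "\<forall>\<^sub>F h in at 0. dist h 0 < \<sigma> \<and> h \<noteq> 0"
      using \<sigma> unfolding eventually_at by (intro exI[of _ \<sigma>]) auto
    thus "\<forall>\<^sub>F h in at 0. norm ((laplace f (\<xi> + h) - laplace f \<xi>) / h - laplace (\<lambda>v. - of_real v * f v) \<xi>) \<le> norm h * K"
    proof eventually_elim
      case (elim h)
      hence h: "norm h \<le> \<sigma>" "norm h > 0" by auto
      have "(laplace f (\<xi> + h) - laplace f \<xi>) / h - laplace (\<lambda>v. - of_real v * f v) \<xi>
         = (laplace f (\<xi> + h) - laplace f \<xi> - h * laplace (\<lambda>v. - of_real v * f v) \<xi>) / h"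
        using h by (simp add: diff_divide_distrib)
      also have "norm \<dots> \<le> (norm h ^ 2 * K) / norm h"
        unfolding norm_divide using main[OF h(1)] h by (intro divide_right_mono) auto
      also have "\<dots> = norm h * K" using h by (simp add: power2_eq_square)
      finally show ?case .
    qed
    have "((\<lambda>h::complex. norm h * K) \<longlongrightarrow> norm (0::complex) * K) (at 0)"
      by (intro tendsto_intros)
    thus "((\<lambda>h::complex. norm h * K) \<longlongrightarrow> 0) (at 0)" by simp
  qed
  thus ?thesis unfolding DERIV_def by (rule LIM_zero_cancel)
qed

lemma open_Re_gt_0: "open {s :: complex. Re s > 0}"
  by (rule open_halfspace_Re_gt)

lemma laplace_holomorphic: "subexp f \<Longrightarrow> laplace f holomorphic_on {s. Re s > 0}"
  using laplace_deriv open_Re_gt_0 by (auto simp: holomorphic_on_open)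

lemma laplace_higher_deriv:
  assumes f: "subexp f" and \<xi>: "Re \<xi> > 0"
  shows "(deriv ^^ k) (laplace f) \<xi> = laplace (\<lambda>v. (- of_real v) ^ k * f v) \<xi>"
  using \<xi>
proof (induction k arbitrary: \<xi>)
  case (Suc k)
  have s: "subexp (\<lambda>v. (- of_real v) ^ k * f v)"
    using subexp_mult_power[OF f, of "-1" k] by simp
  have "(deriv ^^ Suc k) (laplace f) \<xi> = deriv ((deriv ^^ k) (laplace f)) \<xi>" by simp
  also have "\<dots> = laplace (\<lambda>v. - of_real v * ((- of_real v) ^ k * f v)) \<xi>"
    by (rule DERIV_imp_deriv, rule has_field_derivative_transform_within_open[OF laplace_deriv[OF s] open_Re_gt_0])
       (use Suc in auto)
  finally show ?case by (simp add: mult_ac)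
qed simp

text \<open>The exponent is w - 1 so that the transform is Gamma(w) times \<xi>^(-w).\<close>

definition power_fun :: "complex \<Rightarrow> real \<Rightarrow> complex" where
  "power_fun w v = (if v > 0 then of_real v powr (w - 1) else 0)"

lemma subexp_power_fun:
  assumes "Re w \<ge> 1"
  shows "subexp (power_fun w)"
  unfolding subexp_def
proof (intro conjI allI impI)
  have "(\<lambda>v. if v > 0 then exp ((w - 1) * of_real (ln v)) else 0) \<in> borel_measurable borel"
    by measurable
  also have "(\<lambda>v. if v > 0 then exp ((w - 1) * of_real (ln v)) else 0) = power_fun w"
    by (auto simp: power_fun_def powr_def Ln_of_real fun_eq_iff)
  finally show "power_fun w \<in> borel_measurable borel" .
  show "power_fun w v = 0" if "v < 0" for v using that by (simp add: power_fun_def)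
  fix \<epsilon> :: real assume e: "\<epsilon> > 0"
  define a where "a = Re w - 1"
  \<comment> \<open>From ln v \<le> \<delta> v - 1 - ln \<delta>, the growth rate is a \<delta>
    \<le> \<epsilon>; the summand 1 covers a = 0.\<close>
  define \<delta> where "\<delta> = \<epsilon> / (a + 1)"
  have a: "a \<ge> 0" using assms by (simp add: a_def)
  have d: "\<delta> > 0" using e a by (simp add: \<delta>_def)
  have "norm (power_fun w v) \<le> exp (a * (- 1 - ln \<delta>)) * exp (\<epsilon> * v)" if v: "v \<ge> 0" for v
  proof (cases "v = 0")
    case False
    hence v: "v > 0" using that by simp
    have "ln v = ln (\<delta> * v) - ln \<delta>" using v d by (simp add: ln_mult)
    also have "\<dots> \<le> \<delta> * v - 1 - ln \<delta>" using v d by (intro diff_right_mono ln_le_minus_one) auto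
    finally have "a * ln v \<le> a * (\<delta> * v - 1 - ln \<delta>)" using a by (rule mult_left_mono)
    also have "\<dots> = a * (- 1 - ln \<delta>) + (a * \<delta>) * v" by (simp add: algebra_simps)
    also have "\<dots> \<le> a * (- 1 - ln \<delta>) + \<epsilon> * v"
      using a e v by (intro add_left_mono mult_right_mono) (auto simp: \<delta>_def field_simps)
    finally have "exp (a * ln v) \<le> exp (a * (- 1 - ln \<delta>)) * exp (\<epsilon> * v)" by (simp flip: exp_add)
    moreover have "norm (power_fun w v) = exp (a * ln v)"
      using v by (simp add: power_fun_def norm_powr_real_powr powr_def a_def)
    ultimately show ?thesis by simp
  qed (simp add: power_fun_def)
  thus "\<exists>C\<ge>0. \<forall>v\<ge>0. norm (power_fun w v) \<le> C * exp (\<epsilon> * v)"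
    by (intro exI[of _ "exp (a * (- 1 - ln \<delta>))"]) auto
qed

lemma laplace_power_fun_1:
  assumes "Re w \<ge> 1"
  shows "laplace (power_fun w) 1 = Gamma w"
proof -
  have "integrable lborel (\<lambda>v. power_fun w v * exp (- 1 * of_real v))"
    by (rule subexp_integrable[OF subexp_power_fun[OF assms]]) simp
  hence "((\<lambda>v. power_fun w v * exp (- 1 * of_real v)) has_integral laplace (power_fun w) 1) UNIV"
    unfolding laplace_def by (rule has_integral_integral_lborel)
  moreover have "((\<lambda>t. of_real t powr (w - 1) / of_real (exp t)) has_integral Gamma w) {0<..}"
    by (rule Gamma_integral_complex') (use assms in simp)
  hence "((\<lambda>t. if t \<in> {0<..} then of_real t powr (w - 1) / of_real (exp t) else 0) has_integral Gamma w) UNIV"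
    by (subst has_integral_restrict_UNIV)
  moreover have "(\<lambda>t. if t \<in> {0<..} then of_real t powr (w - 1) / of_real (exp t) else 0) =
     (\<lambda>v. power_fun w v * exp (- 1 * of_real v))"
    by (auto simp: power_fun_def exp_minus exp_of_real divide_inverse fun_eq_iff)
  ultimately show ?thesis by (metis has_integral_unique)
qed

lemma laplace_power_fun_real:
  assumes w: "Re w \<ge> 1" and x: "x > 0"
  shows "laplace (power_fun w) (of_real x) = Gamma w * of_real x powr (-w)"
proof -
  have "laplace (power_fun w) 1 = (LBINT v. power_fun w v * exp (- 1 * of_real v))"
    by (simp add: laplace_def)
  also have "\<dots> = \<bar>x\<bar> *\<^sub>R (LBINT v. power_fun w (0 + x * v) * exp (- 1 * of_real (0 + x * v)))"
    by (rule lborel_integral_real_affine) (use x in simp)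
  also have "(\<lambda>v. power_fun w (0 + x * v) * exp (- 1 * of_real (0 + x * v)))
     = (\<lambda>v. of_real x powr (w - 1) * (power_fun w v * exp (- of_real x * of_real v)))"
  proof
    fix v
    have "of_real (x * v) powr (w - 1) = of_real x powr (w - 1) * of_real v powr (w - 1)" if "v > 0"
      using x that by (simp add: powr_times_real)
    thus "power_fun w (0 + x * v) * exp (- 1 * of_real (0 + x * v)) = of_real x powr (w - 1) * (power_fun w v * exp (- of_real x * of_real v))"
      using x by (simp add: power_fun_def zero_less_mult_iff)
  qed
  also have "\<bar>x\<bar> *\<^sub>R (LBINT v. of_real x powr (w - 1) * (power_fun w v * exp (- of_real x * of_real v)))
     = (of_real x * of_real x powr (w - 1)) * laplace (power_fun w) (of_real x)"
    using x by (simp add: laplace_def scaleR_conv_of_real)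
  also have "of_real x * of_real x powr (w - 1) = of_real x powr w"
    using x by (simp add: powr_diff)
  finally have "Gamma w = of_real x powr w * laplace (power_fun w) (of_real x)"
    using laplace_power_fun_1[OF w] by simp
  thus ?thesis using x by (simp add: powr_minus field_simps)
qed

text \<open>Euler's integral is the case \<xi> = 1, scaling of v gives real \<xi> > 0, and both
  sides are holomorphic in the right half-plane.\<close>

lemma laplace_power_fun:
  assumes w: "Re w \<ge> 1" and \<xi>: "Re \<xi> > 0"
  shows "laplace (power_fun w) \<xi> = Gamma w * \<xi> powr (-w)"
proof -
  let ?S = "{s :: complex. Re s > 0}"
  let ?f = "\<lambda>\<xi>. laplace (power_fun w) \<xi> - Gamma w * \<xi> powr (-w)"
  have "?f \<xi> = 0"
  proof (rule analytic_continuation[where f = ?f and S = ?S and U = "of_real ` {0<..<2}" and \<xi> = 1])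
    show "?f holomorphic_on ?S"
      by (intro holomorphic_intros laplace_holomorphic subexp_power_fun w) (auto simp: complex_nonpos_Reals_iff)
    show "connected ?S" by (intro convex_connected convex_halfspace_Re_gt)
    show "1 islimpt complex_of_real ` {0<..<2}"
    proof -
      have "1 islimpt {0<..<2::real}" by (rule interior_limit_point) auto
      thus ?thesis unfolding islimpt_sequential
      proof safe
        fix g assume g: "\<forall>n. g n \<in> {0<..<2::real} - {1}" "g \<longlonglongrightarrow> 1"
        have "(\<lambda>n. complex_of_real (g n)) \<longlonglongrightarrow> of_real 1" by (intro tendsto_of_real g)
        thus "\<exists>f. (\<forall>n. f n \<in> complex_of_real ` {0<..<2} - {1}) \<and> f \<longlonglongrightarrow> 1"
          using g by (intro exI[of _ "\<lambda>n. complex_of_real (g n)"]) auto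
      qed
    qed
    fix s assume "s \<in> complex_of_real ` {0<..<2}"
    thus "?f s = 0" using laplace_power_fun_real[OF w] by auto
  qed (use \<xi> open_Re_gt_0 in auto)
  thus ?thesis by simp
qed

section \<open>The mean of the coefficients and its transform\<close>

definition omega_sum :: "complex \<Rightarrow> nat \<Rightarrow> complex" where
  "omega_sum z N = (\<Sum>n\<in>{1..N}. omega_coeff z n)"

text \<open>In the variable v = ln x, summation up to x turns the Dirichlet series at s into a
  Laplace transform at s - 1.\<close>

definition omega_mean :: "complex \<Rightarrow> real \<Rightarrow> complex" where
  "omega_mean z v = (if v < 0 then 0 else omega_sum z (nat \<lfloor>exp v\<rfloor>) * of_real (exp (- v)))"

lemma norm_omega_sum_diff_le:
  assumes "norm z \<le> 1" "M \<le> N"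
  shows "norm (omega_sum z N - omega_sum z M) \<le> real (N - M)"
proof -
  have "{1..N} = {1..M} \<union> {Suc M..N}" using assms(2) by auto
  hence "omega_sum z N = omega_sum z M + (\<Sum>n\<in>{Suc M..N}. omega_coeff z n)"
    unfolding omega_sum_def by (simp add: sum.union_disjoint)
  hence "norm (omega_sum z N - omega_sum z M) = norm (\<Sum>n\<in>{Suc M..N}. omega_coeff z n)" by simp
  also have "\<dots> \<le> (\<Sum>n\<in>{Suc M..N}. 1)"
    by (intro sum_norm_le norm_omega_coeff_le assms)
  finally show ?thesis by simp
qed

lemma norm_omega_sum_le: "norm z \<le> 1 \<Longrightarrow> norm (omega_sum z N) \<le> real N"
  using norm_omega_sum_diff_le[of z 0 N] by (simp add: omega_sum_def)

lemma norm_omega_mean_le: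
  assumes "norm z \<le> 1"
  shows "norm (omega_mean z v) \<le> 1"
proof (cases "v < 0")
  case False
  have "norm (omega_sum z (nat \<lfloor>exp v\<rfloor>)) \<le> real (nat \<lfloor>exp v\<rfloor>)" by (rule norm_omega_sum_le[OF assms])
  also have "\<dots> \<le> exp v" by simp
  finally have "norm (omega_sum z (nat \<lfloor>exp v\<rfloor>)) * exp (- v) \<le> exp v * exp (- v)"
    by (intro mult_right_mono) auto
  thus ?thesis using False by (simp add: omega_mean_def norm_mult flip: exp_add)
qed (simp add: omega_mean_def)

lemma omega_mean_measurable [measurable]: "omega_mean z \<in> borel_measurable borel"
proof -
  have "(\<lambda>v::real. omega_sum z (nat \<lfloor>exp v\<rfloor>)) \<in> borel_measurable borel"
    by measurable
  thus ?thesis unfolding omega_mean_def[abs_def] by measurable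
qed

lemma subexp_omega_mean:
  assumes "norm z \<le> 1"
  shows "subexp (omega_mean z)"
  unfolding subexp_def
proof (intro conjI allI impI omega_mean_measurable)
  fix \<epsilon> :: real assume "\<epsilon> > 0"
  have "norm (omega_mean z v) \<le> 1 * exp (\<epsilon> * v)" if "v \<ge> 0" for v
  proof -
    have "0 \<le> \<epsilon> * v" using that \<open>\<epsilon> > 0\<close> by simp
    thus ?thesis using norm_omega_mean_le[OF assms, of v] one_le_exp_iff[of "\<epsilon> * v"] by linarith
  qed
  thus "\<exists>C\<ge>0. \<forall>v\<ge>0. norm (omega_mean z v) \<le> C * exp (\<epsilon> * v)"
    by (intro exI[of _ 1]) auto
qed (simp add: omega_mean_def)

text \<open>A translate of \<open>laplace_power_fun\<close> for w = 1, where
  \<open>power_fun\<close> is the Heaviside function. The endpoint, a null set, is included to match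
  the condition n \<le> exp v.\<close>

lemma integral_exp_tail:
  fixes c :: complex and a :: real
  assumes "Re c > 0"
  shows "has_bochner_integral lborel (\<lambda>v. (if v \<ge> a then exp (- c * of_real v) else 0)) (exp (- c * of_real a) / c)"
proof -
  have sub: "subexp (power_fun 1)" by (rule subexp_power_fun) simp
  have p: "power_fun 1 v = (if v > 0 then 1 else 0)" for v
    by (simp add: power_fun_def)
  have "has_bochner_integral lborel (\<lambda>v. power_fun 1 v * exp (- c * of_real v)) (1 / c)"
    using subexp_integrable[OF sub assms] laplace_power_fun[of 1 c] assms
    by (auto simp: has_bochner_integral_iff laplace_def powr_minus divide_inverse)
  hence "has_bochner_integral lborel (\<lambda>v. power_fun 1 (- a + 1 * v) * exp (- c * of_real (- a + 1 * v))) ((1 / c) /\<^sub>R \<bar>1\<bar>)"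
    by (subst (asm) lborel_has_bochner_integral_real_affine_iff[of 1 _ _ "-a"]) auto
  hence "has_bochner_integral lborel (\<lambda>v. exp (- c * of_real a) * (power_fun 1 (v - a) * exp (- c * of_real (v - a)))) (exp (- c * of_real a) * (1 / c))"
    by (intro has_bochner_integral_mult_right) simp
  also have "(\<lambda>v. exp (- c * of_real a) * (power_fun 1 (v - a) * exp (- c * of_real (v - a)))) = (\<lambda>v. (if v > a then exp (- c * of_real v) else 0))"
    by (auto simp: p fun_eq_iff algebra_simps simp flip: exp_add)
  finally have 1: "has_bochner_integral lborel (\<lambda>v. (if v > a then exp (- c * of_real v) else 0)) (exp (- c * of_real a) / c)"
    by simp
  show ?thesis
  proof (rule has_bochner_integral_cong_AE[THEN iffD1, OF _ _ _ 1])
    show "AE v in lborel. (if v > a then exp (- c * of_real v) else 0) = (if v \<ge> a then exp (- c * of_real v) else 0)"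
      using AE_lborel_singleton[of a] by eventually_elim auto
  qed measurable
qed

text \<open>Partial summation as an exchange of sum and integral: n contributes from v = ln n
  onwards, and the integral of exp(-(1 + \<xi>) v) from there is n^(-1 - \<xi>) / (1 +
  \<xi>).\<close>

lemma laplace_omega_mean:
  assumes z: "norm z \<le> 1" and \<xi>: "Re \<xi> > 0"
  shows "laplace (omega_mean z) \<xi> = omega_series z (1 + \<xi>) / (1 + \<xi>)"
proof -
  define c where "c = 1 + \<xi>"
  have c: "Re c > 1" using \<xi> by (simp add: c_def)
  define e where "e = (\<lambda>(n::nat) v. if v \<ge> ln (real n) then exp (- c * of_real v) else 0)"
  define g where "g = (\<lambda>n v. omega_coeff z n * e n v)"
  have n_powr: "exp (- c * of_real (ln (real n))) = of_nat n powr (- c)" if "n > 0" for n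
    using that by (simp add: powr_def Ln_of_nat)
  have e: "has_bochner_integral lborel (e n) (of_nat n powr (- c) / c)" if "n > 0" for n
    using integral_exp_tail[of c "ln (real n)"] c n_powr[OF that] by (simp add: e_def)
  have g: "has_bochner_integral lborel (g n) (omega_coeff z n * of_nat n powr (- c) / c)" for n :: nat
  proof (cases "n = 0")
    case False
    hence "has_bochner_integral lborel (\<lambda>v. omega_coeff z n * e n v) (omega_coeff z n * (of_nat n powr (- c) / c))"
      by (intro has_bochner_integral_mult_right e) simp
    thus ?thesis by (simp add: g_def)
  qed (simp add: g_def omega_coeff_def has_bochner_integral_zero)
  have ng: "(LBINT v. norm (g n v)) \<le> real n powr (- Re c) / Re c" if "n > 0" for n
  proof -
    have e': "has_bochner_integral lborel (\<lambda>v. if v \<ge> ln (real n) then exp (- of_real (Re c) * of_real v) else 0) (exp (- of_real (Re c) * of_real (ln (real n))) / of_real (Re c) :: complex)"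
      by (rule integral_exp_tail) (use c in simp)
    have "has_bochner_integral lborel (\<lambda>v. complex_of_real (if v \<ge> ln (real n) then exp (- Re c * v) else 0)) (of_real (exp (- Re c * ln (real n)) / Re c))"
      using e' by (simp add: exp_of_real[symmetric] if_distrib[of complex_of_real] cong: if_cong)
    hence r: "has_bochner_integral lborel (\<lambda>v. if v \<ge> ln (real n) then exp (- Re c * v) else 0) (exp (- Re c * ln (real n)) / Re c)"
      using has_bochner_integral_Re by fastforce
    have "(LBINT v. norm (g n v)) \<le> (LBINT v. if v \<ge> ln (real n) then exp (- Re c * v) else 0)"
    proof (rule integral_mono)
      show "integrable lborel (\<lambda>v. norm (g n v))" using g[of n] by (intro integrable_norm) (auto simp: has_bochner_integral_iff)
      show "integrable lborel (\<lambda>v. if v \<ge> ln (real n) then exp (- Re c * v) else 0)" using r by (auto simp: has_bochner_integral_iff)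
      fix v
      have "norm (g n v) \<le> 1 * norm (e n v)"
        unfolding g_def norm_mult by (intro mult_right_mono norm_omega_coeff_le z) auto
      thus "norm (g n v) \<le> (if v \<ge> ln (real n) then exp (- Re c * v) else 0)"
        by (auto simp: e_def norm_exp_eq_Re split: if_splits)
    qed
    also have "\<dots> = exp (- Re c * ln (real n)) / Re c" using r by (rule has_bochner_integral_integral_eq)
    also have "exp (- Re c * ln (real n)) = real n powr (- Re c)" using that by (simp add: powr_def)
    finally show ?thesis .
  qed
  have sm: "summable (\<lambda>n. LBINT v. norm (g n v))"
  proof (rule summable_comparison_test')
    show "summable (\<lambda>n. real n powr (- Re c) / Re c)"
      using c by (intro summable_divide) (simp add: summable_real_powr_iff)
    fix n :: nat assume "n \<ge> 1"
    thus "norm (LBINT v. norm (g n v)) \<le> real n powr (- Re c) / Re c" using ng[of n] by simp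
  qed
  have pt: "(\<lambda>n. g n v) sums (omega_mean z v * exp (- \<xi> * of_real v))" for v
  proof -
    define N where "N = nat \<lfloor>exp v\<rfloor>"
    have in_iff: "ln (real n) \<le> v \<longleftrightarrow> n \<le> N" if "n > 0" for n
    proof -
      have "ln (real n) \<le> v \<longleftrightarrow> real n \<le> exp v" using that by (metis exp_le_cancel_iff exp_ln of_nat_0_less_iff)
      also have "\<dots> \<longleftrightarrow> n \<le> N" unfolding N_def by (simp add: le_nat_iff le_floor_iff)
      finally show ?thesis .
    qed
    have zero: "g n v = 0" if "n \<notin> {1..N}" for n
      using that in_iff[of n] by (cases "n = 0") (auto simp: g_def e_def omega_coeff_def)
    have "(\<lambda>n. g n v) sums (\<Sum>n\<in>{1..N}. g n v)"
      by (rule sums_finite) (use zero in auto)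
    also have "(\<Sum>n\<in>{1..N}. g n v) = (\<Sum>n\<in>{1..N}. omega_coeff z n * exp (- c * of_real v))"
      by (rule sum.cong) (auto simp: g_def e_def in_iff)
    also have "\<dots> = omega_sum z N * exp (- c * of_real v)"
      by (simp add: omega_sum_def sum_distrib_right)
    also have "\<dots> = omega_mean z v * exp (- \<xi> * of_real v)"
    proof (cases "v < 0")
      case True
      hence "N = 0" unfolding N_def by (simp add: floor_le_iff nat_eq_iff)
      thus ?thesis using True by (simp add: omega_mean_def omega_sum_def)
    next
      case False
      have "exp (- c * of_real v) = of_real (exp (- v)) * exp (- \<xi> * of_real v)"
        by (simp add: c_def algebra_simps exp_of_real[symmetric] flip: exp_add)
      thus ?thesis using False by (simp add: omega_mean_def N_def)
    qed
    finally show ?thesis .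
  qed
  have "(\<lambda>n. LBINT v. g n v) sums (LBINT v. (\<Sum>n. g n v))"
  proof (rule sums_integral)
    show "integrable lborel (g n)" for n using g[of n] by (auto simp: has_bochner_integral_iff)
    show "AE v in lborel. summable (\<lambda>n. norm (g n v))"
    proof (rule AE_I2)
      fix v :: real
      have "g n v = 0" if "n \<notin> {..nat \<lfloor>exp v\<rfloor>}" for n
      proof -
        have "exp v < real n" using that by simp linarith
        hence "v < ln (real n)" by (metis exp_less_cancel_iff exp_ln not_exp_less_zero order_less_trans exp_gt_zero)
        thus ?thesis by (simp add: g_def e_def)
      qed
      thus "summable (\<lambda>n. norm (g n v))"
        by (intro summable_finite[of "{..nat \<lfloor>exp v\<rfloor>}"]) auto
    qed
  qed (rule sm)
  moreover have "(\<lambda>v. (\<Sum>n. g n v)) = (\<lambda>v. omega_mean z v * exp (- \<xi> * of_real v))"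
    using pt by (auto simp: sums_iff)
  moreover have "(LBINT v. g n v) = omega_coeff z n * of_nat n powr (- c) / c" for n
    using g[of n] by (rule has_bochner_integral_integral_eq)
  ultimately have "(\<lambda>n. omega_coeff z n * of_nat n powr (- c) / c) sums laplace (omega_mean z) \<xi>"
    by (simp add: laplace_def)
  moreover have "(\<lambda>n. omega_coeff z n * of_nat n powr (- c) / c) sums (omega_series z c / c)"
    unfolding omega_series_def using c z
    by (intro sums_divide summable_sums summable_norm_cancel[OF summable_norm_omega_series]) auto
  ultimately show ?thesis unfolding c_def by (rule sums_unique2)
qed

section \<open>Gaussian smoothing\<close>

text \<open>The weight on the Fourier side that belongs to the normal density of standard deviation
  \<delta>: small \<delta> admits heights up to about 1 / \<delta>.\<close>

definition gauss :: "real \<Rightarrow> real \<Rightarrow> real" where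
  "gauss \<delta> t = exp (- (\<delta> * t)\<^sup>2 / 2)"

lemma gauss_measurable [measurable]: "gauss \<delta> \<in> borel_measurable borel"
  unfolding gauss_def[abs_def] by measurable

lemma gauss_pos: "gauss \<delta> t > 0" and gauss_le_1: "gauss \<delta> t \<le> 1"
  by (simp_all add: gauss_def)

lemma gauss_eq_density:
  assumes "\<delta> > 0"
  shows "gauss \<delta> t = sqrt (2 * pi) / \<delta> * normal_density 0 (1 / \<delta>) t"
proof -
  have "sqrt (2 * pi * (1 / \<delta>)\<^sup>2) = sqrt (2 * pi) / \<delta>"
    using assms by (simp add: real_sqrt_mult real_sqrt_divide power_divide)
  thus ?thesis using assms
    by (simp add: gauss_def normal_density_def power_divide power_mult_distrib field_simps)
qed

lemma gauss_moments:
  assumes "\<delta> > 0"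
  shows "has_bochner_integral lborel (gauss \<delta>) (sqrt (2 * pi) / \<delta>)"
    and "has_bochner_integral lborel (\<lambda>t. gauss \<delta> t * \<bar>t\<bar>) (2 / \<delta>\<^sup>2)"
proof -
  have "has_bochner_integral lborel (\<lambda>t. sqrt (2 * pi) / \<delta> * (normal_density 0 (1 / \<delta>) t * (t - 0) ^ (2 * 0))) (sqrt (2 * pi) / \<delta> * (fact (2 * 0) / ((2 / (1 / \<delta>)\<^sup>2) ^ 0 * fact 0)))"
    using assms by (intro has_bochner_integral_mult_right normal_moment_even) auto
  thus "has_bochner_integral lborel (gauss \<delta>) (sqrt (2 * pi) / \<delta>)"
    by (simp add: gauss_eq_density[OF assms, abs_def])
  have "has_bochner_integral lborel (\<lambda>t. sqrt (2 * pi) / \<delta> * (normal_density 0 (1 / \<delta>) t * \<bar>t - 0\<bar> ^ (2 * 0 + 1))) (sqrt (2 * pi) / \<delta> * (2 ^ 0 * (1 / \<delta>) ^ (2 * 0 + 1) * fact 0 * sqrt (2 / pi)))"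
    using assms by (intro has_bochner_integral_mult_right normal_moment_abs_odd) auto
  also have "sqrt (2 * pi) / \<delta> * (2 ^ 0 * (1 / \<delta>) ^ (2 * 0 + 1) * fact 0 * sqrt (2 / pi)) = 2 / \<delta>\<^sup>2"
  proof -
    have "sqrt (2 * pi) * sqrt (2 / pi) = sqrt (2\<^sup>2)"
      unfolding real_sqrt_mult[symmetric] by (simp add: power2_eq_square)
    hence "sqrt (2 * pi) * sqrt (2 / pi) = 2" by simp
    thus ?thesis by (simp add: power2_eq_square field_simps)
  qed
  finally show "has_bochner_integral lborel (\<lambda>t. gauss \<delta> t * \<bar>t\<bar>) (2 / \<delta>\<^sup>2)"
    by (simp add: gauss_eq_density[OF assms, abs_def] mult_ac)
qed

text \<open>A rescaling of the characteristic function of the standard normal distribution.\<close>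

lemma gauss_fourier:
  assumes d: "\<delta> > 0"
  shows "(LBINT t. of_real (gauss \<delta> t) * exp (- \<i> * of_real t * of_real u)) = complex_of_real (2 * pi * normal_density 0 \<delta> u)"
proof -
  define s where "s = - u / \<delta>"
  have "char std_normal_distribution s = (CLBINT x. std_normal_density x *\<^sub>R iexp (s * x))"
    unfolding char_def by (subst integral_density) auto
  hence 1: "(CLBINT x. std_normal_density x *\<^sub>R iexp (s * x)) = of_real (exp (- s\<^sup>2 / 2))"
    by (simp add: char_std_normal_distribution)
  have "(CLBINT x. std_normal_density x *\<^sub>R iexp (s * x)) = \<bar>\<delta>\<bar> *\<^sub>R (CLBINT t. std_normal_density (0 + \<delta> * t) *\<^sub>R iexp (s * (0 + \<delta> * t)))"
    by (rule lborel_integral_real_affine) (use d in simp)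
  also have "(\<lambda>t. std_normal_density (0 + \<delta> * t) *\<^sub>R iexp (s * (0 + \<delta> * t))) = (\<lambda>t. of_real (1 / sqrt (2 * pi)) * (of_real (gauss \<delta> t) * exp (- \<i> * of_real t * of_real u)))"
  proof
    fix t
    have "s * (\<delta> * t) = - (t * u)" using d by (simp add: s_def)
    thus "std_normal_density (0 + \<delta> * t) *\<^sub>R iexp (s * (0 + \<delta> * t)) = of_real (1 / sqrt (2 * pi)) * (of_real (gauss \<delta> t) * exp (- \<i> * of_real t * of_real u))"
      by (simp add: std_normal_density_def gauss_def scaleR_conv_of_real mult_ac)
  qed
  also have "\<bar>\<delta>\<bar> *\<^sub>R (CLBINT t. of_real (1 / sqrt (2 * pi)) * (of_real (gauss \<delta> t) * exp (- \<i> * of_real t * of_real u)))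
     = of_real (\<delta> / sqrt (2 * pi)) * (CLBINT t. of_real (gauss \<delta> t) * exp (- \<i> * of_real t * of_real u))"
    using d by (simp add: scaleR_conv_of_real)
  finally have 2: "of_real (\<delta> / sqrt (2 * pi)) * (CLBINT t. of_real (gauss \<delta> t) * exp (- \<i> * of_real t * of_real u)) = of_real (exp (- s\<^sup>2 / 2))"
    using 1 by simp
  have "(CLBINT t. of_real (gauss \<delta> t) * exp (- \<i> * of_real t * of_real u)) = of_real (sqrt (2 * pi) / \<delta>) * (of_real (\<delta> / sqrt (2 * pi)) * (CLBINT t. of_real (gauss \<delta> t) * exp (- \<i> * of_real t * of_real u)))"
    using d by (simp add: field_simps)
  also have "\<dots> = of_real (sqrt (2 * pi) / \<delta> * exp (- s\<^sup>2 / 2))" unfolding 2 by simp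
  also have "sqrt (2 * pi) / \<delta> * exp (- s\<^sup>2 / 2) = 2 * pi * normal_density 0 \<delta> u"
  proof -
    have q: "sqrt (2 * pi * \<delta>\<^sup>2) = sqrt (2 * pi) * \<delta>" using d by (simp add: real_sqrt_mult)
    have "2 * pi = sqrt (2 * pi) * sqrt (2 * pi)" by simp
    hence "2 * pi * (1 / (sqrt (2 * pi) * \<delta>)) = sqrt (2 * pi) / \<delta>"
      using d by (simp add: field_simps)
    moreover have "- s\<^sup>2 / 2 = - (u - 0)\<^sup>2 / (2 * \<delta>\<^sup>2)" by (simp add: s_def power_divide)
    ultimately show ?thesis unfolding normal_density_def q by (metis mult.assoc)
  qed
  finally show ?thesis .
qed

text \<open>Multiplying by \<^term>\<open>exp (- a * v)\<close> only shifts the centre of a Gaussian, so that smoothing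
  with a Gaussian is controlled by the Laplace transform on the line of abscissa \<^term>\<open>a\<close>.\<close>

lemma gauss_smoothing_eq:
  assumes D: "subexp D" and a: "a > 0" and d: "\<delta> > 0"
  shows "(LBINT v. D v * of_real (normal_density x \<delta> v))
    = of_real (exp (a * x + a\<^sup>2 * \<delta>\<^sup>2 / 2) / (2 * pi)) *
      (LBINT t. of_real (gauss \<delta> t) * exp (\<i> * of_real t * of_real (x + a * \<delta>\<^sup>2)) * laplace D (Complex a t))"
proof -
  \<comment> \<open>The new centre, obtained by completing the square after the factor exp(- a v)
    has been split off.\<close>
  define y where "y = x + a * \<delta>\<^sup>2"
  define K where "K = exp (a * x + a\<^sup>2 * \<delta>\<^sup>2 / 2)"
  define E where "E = (\<lambda>v. D v * exp (- of_real a * of_real v))"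
  define F where "F = (\<lambda>v t. E v * (of_real (gauss \<delta> t) * exp (- \<i> * of_real t * of_real (v - y))))"
  have Eint: "integrable lborel E" unfolding E_def by (rule subexp_integrable[OF D]) (use a in simp)
  have [measurable]: "D \<in> borel_measurable borel" by (rule subexp_measurable[OF D])
  have [measurable]: "E \<in> borel_measurable borel" unfolding E_def by measurable
  have gint: "integrable lborel (gauss \<delta>)" using gauss_moments(1)[OF d] by (rule integrable.intros)
  have nF: "norm (F v t) = norm (E v) * gauss \<delta> t" for v t
    using gauss_pos[of \<delta> t] by (simp add: F_def norm_mult)
  \<comment> \<open>The norm of F is a product of an integrable function of v and one of t.\<close>
  have Fint: "integrable (lborel \<Otimes>\<^sub>M lborel) (case_prod F)"
  proof (rule lborel_pair.Fubini_integrable)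
    show "case_prod F \<in> borel_measurable (lborel \<Otimes>\<^sub>M lborel)" unfolding F_def by measurable
    show "integrable lborel (\<lambda>v. LBINT t. norm (case_prod F (v, t)))"
      using Eint by (simp add: nF)
    show "AE v in lborel. integrable lborel (\<lambda>t. case_prod F (v, t))"
    proof (rule AE_I2)
      fix v
      have "integrable lborel (\<lambda>t. norm (E v) * gauss \<delta> t)" using gint by simp
      thus "integrable lborel (\<lambda>t. case_prod F (v, t))"
      proof (rule Bochner_Integration.integrable_bound)
        show "(\<lambda>t. case_prod F (v, t)) \<in> borel_measurable lborel"
          by (simp only: F_def prod.case) measurable
        have "norm (F v t) \<le> norm (norm (E v) * gauss \<delta> t)" for t
          unfolding nF by simp
        thus "AE t in lborel. norm (case_prod F (v, t)) \<le> norm (norm (E v) * gauss \<delta> t)" by simp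
      qed
    qed
  qed
  have shift: "normal_density x \<delta> v = K * exp (- a * v) * normal_density 0 \<delta> (v - y)" for v
  proof -
    have "K * exp (- a * v) * exp (- (v - y - 0)\<^sup>2 / (2 * \<delta>\<^sup>2)) = exp (a * x + a\<^sup>2 * \<delta>\<^sup>2 / 2 + (- a * v) + (- (v - y - 0)\<^sup>2 / (2 * \<delta>\<^sup>2)))"
      unfolding K_def by (simp only: exp_add)
    also have "a * x + a\<^sup>2 * \<delta>\<^sup>2 / 2 + (- a * v) + (- (v - y - 0)\<^sup>2 / (2 * \<delta>\<^sup>2)) = - (v - x)\<^sup>2 / (2 * \<delta>\<^sup>2)"
      using d by (simp add: y_def field_simps power2_eq_square)
    finally show ?thesis unfolding normal_density_def by simp
  qed
  have "(LBINT v. D v * of_real (normal_density x \<delta> v)) = (LBINT v. of_real (K / (2 * pi)) * (LBINT t. F v t))"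
  proof (rule Bochner_Integration.integral_cong[OF refl])
    fix v
    have "(LBINT t. F v t) = E v * (LBINT t. of_real (gauss \<delta> t) * exp (- \<i> * of_real t * of_real (v - y)))"
      unfolding F_def by (rule integral_mult_right_zero)
    also have "\<dots> = E v * of_real (2 * pi * normal_density 0 \<delta> (v - y))"
      by (simp only: gauss_fourier[OF d])
    finally have "of_real (K / (2 * pi)) * (LBINT t. F v t) = D v * (exp (- of_real a * of_real v) * of_real (K * normal_density 0 \<delta> (v - y)))"
      by (simp add: E_def mult_ac)
    also have "exp (- of_real a * of_real v) = complex_of_real (exp (- a * v))"
      by (simp add: exp_of_real[symmetric])
    finally show "D v * of_real (normal_density x \<delta> v) = of_real (K / (2 * pi)) * (LBINT t. F v t)"
      unfolding shift by (simp add: mult_ac)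
  qed
  also have "\<dots> = of_real (K / (2 * pi)) * (LBINT v. LBINT t. F v t)" by (rule integral_mult_right_zero)
  also have "(LBINT v. LBINT t. F v t) = (LBINT t. LBINT v. F v t)"
    by (rule lborel_pair.Fubini_integral[OF Fint, symmetric])
  also have "\<dots> = (LBINT t. of_real (gauss \<delta> t) * exp (\<i> * of_real t * of_real y) * laplace D (Complex a t))"
  proof (rule Bochner_Integration.integral_cong[OF refl])
    fix t
    have "F v t = of_real (gauss \<delta> t) * exp (\<i> * of_real t * of_real y) * (D v * exp (- Complex a t * of_real v))" for v
    proof -
      have "exp (- of_real a * of_real v) * exp (- \<i> * of_real t * of_real (v - y)) = exp (\<i> * of_real t * of_real y) * exp (- Complex a t * of_real v)"
        unfolding exp_add[symmetric] by (simp add: Complex_eq algebra_simps)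
      thus ?thesis unfolding F_def E_def by (simp add: mult_ac)
    qed
    thus "(LBINT v. F v t) = of_real (gauss \<delta> t) * exp (\<i> * of_real t * of_real y) * laplace D (Complex a t)"
      unfolding laplace_def by (simp only: integral_mult_right_zero)
  qed
  finally show ?thesis by (simp add: K_def y_def)
qed

lemma gauss_smoothing_bound:
  assumes D: "subexp D" and a: "a > 0" and d: "\<delta> > 0"
    and B: "\<And>t. norm (laplace D (Complex a t)) \<le> B t" "integrable lborel (\<lambda>t. gauss \<delta> t * B t)"
  shows "norm (LBINT v. D v * of_real (normal_density x \<delta> v))
    \<le> exp (a * x + a\<^sup>2 * \<delta>\<^sup>2 / 2) / (2 * pi) * (LBINT t. gauss \<delta> t * B t)"
proof -
  let ?F = "\<lambda>t. of_real (gauss \<delta> t) * exp (\<i> * of_real t * of_real (x + a * \<delta>\<^sup>2)) * laplace D (Complex a t)"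
  have nF: "norm (?F t) = gauss \<delta> t * norm (laplace D (Complex a t))" for t
    using gauss_pos[of \<delta> t] by (simp add: norm_mult)
  have le: "norm (?F t) \<le> gauss \<delta> t * B t" for t
    unfolding nF using gauss_pos[of \<delta> t] B(1)[of t] by (intro mult_left_mono) auto
  have "norm (LBINT t. ?F t) \<le> (LBINT t. gauss \<delta> t * B t)"
  proof (cases "integrable lborel ?F")
    case True
    thus ?thesis by (rule Bochner_Integration.integral_norm_bound_integral) (use B le in auto)
  next
    \<comment> \<open>Here the Bochner integral is 0 by convention, and nonnegativity of the bound
      is enough.\<close>
    case False
    have "gauss \<delta> t * B t \<ge> 0" for t using le[of t] norm_ge_zero order_trans by blast
    thus ?thesis using False by (simp add: not_integrable_integral_eq)
  qed
  hence "norm (of_real (exp (a * x + a\<^sup>2 * \<delta>\<^sup>2 / 2) / (2 * pi)) * (LBINT t. ?F t)) \<le> exp (a * x + a\<^sup>2 * \<delta>\<^sup>2 / 2) / (2 * pi) * (LBINT t. gauss \<delta> t * B t)"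
    unfolding norm_mult norm_of_real abs_of_nonneg[OF divide_nonneg_nonneg[OF exp_ge_zero mult_nonneg_nonneg[OF zero_le_numeral pi_ge_zero]]]
    by (intro mult_left_mono) auto
  thus ?thesis unfolding gauss_smoothing_eq[OF D a d] .
qed

lemma integral_inverse_square:
  assumes a: "a > 0"
  shows "has_bochner_integral lborel (\<lambda>t. 1 / (a\<^sup>2 + t\<^sup>2)) (pi / a)"
proof -
  have "has_bochner_integral lborel (\<lambda>x::real. inverse (1 + x\<^sup>2)) pi"
    using integrable_inverse_1_plus_square LBINT_inverse_1_plus_square
    by (simp add: has_bochner_integral_iff set_integrable_def interval_lebesgue_integral_def set_lebesgue_integral_def)
  hence "has_bochner_integral lborel (\<lambda>x. inverse (1 + (0 + (1 / a) * x)\<^sup>2)) (pi /\<^sub>R \<bar>1 / a\<bar>)"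
    by (subst (asm) lborel_has_bochner_integral_real_affine_iff[of "1 / a" _ _ 0]) (use a in auto)
  hence "has_bochner_integral lborel (\<lambda>x. (1 / a\<^sup>2) * inverse (1 + (0 + (1 / a) * x)\<^sup>2)) ((1 / a\<^sup>2) * (pi /\<^sub>R \<bar>1 / a\<bar>))"
    by (intro has_bochner_integral_mult_right)
  also have "(\<lambda>x. (1 / a\<^sup>2) * inverse (1 + (0 + (1 / a) * x)\<^sup>2)) = (\<lambda>t. 1 / (a\<^sup>2 + t\<^sup>2))"
    using a by (auto simp: fun_eq_iff power_divide field_simps add_nonneg_eq_0_iff)
  also have "(1 / a\<^sup>2) * (pi /\<^sub>R \<bar>1 / a\<bar>) = pi / a" using a by (simp add: power2_eq_square field_simps)
  finally show ?thesis .
qed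

text \<open>The linear growth in |t| costs 1 / \<delta>^2 through the Gaussian moments, while the
  peak at height 0 integrates to pi / a. The condition a x \<le> 1 keeps the exponential in front
  bounded.\<close>

lemma gauss_smoothing_bound_rational:
  assumes D: "subexp D" and a: "0 < a" and d: "0 < \<delta>" "\<delta> \<le> 1" and C: "C1 \<ge> 0" "C2 \<ge> 0"
    and ax: "a * x \<le> 1" "a \<le> 1"
    and B: "\<And>t. norm (laplace D (Complex a t)) \<le> C1 * (\<bar>t\<bar> + 8) + C2 / (a\<^sup>2 + t\<^sup>2)"
  shows "norm (LBINT v. D v * of_real (normal_density x \<delta> v)) \<le> 100 * C1 / \<delta>\<^sup>2 + 5 * C2 / a"
proof -
  have sq: "sqrt (2 * pi) \<le> 3"
    by (rule real_le_lsqrt) (use pi_less_4 in auto)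
  let ?B = "\<lambda>t. C1 * (\<bar>t\<bar> + 8) + C2 / (a\<^sup>2 + t\<^sup>2)"
  note m = gauss_moments[OF d(1)]
  have i3: "integrable lborel (\<lambda>t. gauss \<delta> t * (1 / (a\<^sup>2 + t\<^sup>2)))"
  proof (rule Bochner_Integration.integrable_bound)
    show "integrable lborel (\<lambda>t. 1 / (a\<^sup>2 + t\<^sup>2))" using integral_inverse_square[OF a] by (rule integrable.intros)
    show "AE t in lborel. norm (gauss \<delta> t * (1 / (a\<^sup>2 + t\<^sup>2))) \<le> norm (1 / (a\<^sup>2 + t\<^sup>2))"
    proof (rule AE_I2)
      fix t show "norm (gauss \<delta> t * (1 / (a\<^sup>2 + t\<^sup>2))) \<le> norm (1 / (a\<^sup>2 + t\<^sup>2))"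
        unfolding norm_mult using gauss_pos[of \<delta> t] gauss_le_1[of \<delta> t]
        by (intro mult_left_le_one_le) auto
    qed
  qed measurable
  have l3: "(LBINT t. gauss \<delta> t * (1 / (a\<^sup>2 + t\<^sup>2))) \<le> pi / a"
  proof -
    have "(LBINT t. gauss \<delta> t * (1 / (a\<^sup>2 + t\<^sup>2))) \<le> (LBINT t. 1 / (a\<^sup>2 + t\<^sup>2))"
    proof (rule integral_mono[OF i3])
      show "integrable lborel (\<lambda>t. 1 / (a\<^sup>2 + t\<^sup>2))" using integral_inverse_square[OF a] by (rule integrable.intros)
      show "gauss \<delta> t * (1 / (a\<^sup>2 + t\<^sup>2)) \<le> 1 / (a\<^sup>2 + t\<^sup>2)" for t
        using gauss_pos[of \<delta> t] gauss_le_1[of \<delta> t] by (intro mult_left_le_one_le) auto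
    qed
    also have "\<dots> = pi / a" using integral_inverse_square[OF a] by (rule has_bochner_integral_integral_eq)
    finally show ?thesis .
  qed
  have eq: "(\<lambda>t. gauss \<delta> t * ?B t) = (\<lambda>t. C1 * (gauss \<delta> t * \<bar>t\<bar>) + (8 * C1) * gauss \<delta> t + C2 * (gauss \<delta> t * (1 / (a\<^sup>2 + t\<^sup>2))))"
    by (simp add: fun_eq_iff algebra_simps)
  have h: "has_bochner_integral lborel (\<lambda>t. gauss \<delta> t * ?B t) (C1 * (2 / \<delta>\<^sup>2) + (8 * C1) * (sqrt (2 * pi) / \<delta>) + C2 * (LBINT t. gauss \<delta> t * (1 / (a\<^sup>2 + t\<^sup>2))))"
    unfolding eq by (intro has_bochner_integral_add has_bochner_integral_mult_right m has_bochner_integral_integrable i3)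
  have "norm (LBINT v. D v * of_real (normal_density x \<delta> v)) \<le> exp (a * x + a\<^sup>2 * \<delta>\<^sup>2 / 2) / (2 * pi) * (LBINT t. gauss \<delta> t * ?B t)"
    using h by (intro gauss_smoothing_bound[OF D a d(1) B]) (auto simp: has_bochner_integral_iff)
  also have "(LBINT t. gauss \<delta> t * ?B t) = C1 * (2 / \<delta>\<^sup>2) + (8 * C1) * (sqrt (2 * pi) / \<delta>) + C2 * (LBINT t. gauss \<delta> t * (1 / (a\<^sup>2 + t\<^sup>2)))"
    using h by (rule has_bochner_integral_integral_eq)
  \<comment> \<open>3/2 = 9/6 from exp 2 \<le> 9 and 2 pi \<ge> 6. After this, 39 = 3/2 (2 + 24) is
    rounded up to 100 and 3/2 * 3.2 to 5.\<close>
  also have "exp (a * x + a\<^sup>2 * \<delta>\<^sup>2 / 2) / (2 * pi) * \<dots> \<le> 3 / 2 * (C1 * (2 / \<delta>\<^sup>2) + (8 * C1) * (3 / \<delta>\<^sup>2) + C2 * (pi / a))"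
  proof (rule mult_mono)
    have "a\<^sup>2 * \<delta>\<^sup>2 \<le> 1 * 1" using a d ax by (intro mult_mono power_le_one) auto
    hence "exp (a * x + a\<^sup>2 * \<delta>\<^sup>2 / 2) \<le> exp 2" using ax by simp
    also have "exp (2::real) = exp 1 * exp 1" by (simp flip: exp_add)
    also have "\<dots> \<le> 3 * 3" by (intro mult_mono exp_le) auto
    finally have "exp (a * x + a\<^sup>2 * \<delta>\<^sup>2 / 2) / (2 * pi) \<le> 9 / (2 * 3)"
      using pi_gt3 by (intro frac_le) auto
    thus "exp (a * x + a\<^sup>2 * \<delta>\<^sup>2 / 2) / (2 * pi) \<le> 3 / 2" by simp
    have "sqrt (2 * pi) / \<delta> \<le> 3 / \<delta>\<^sup>2"
      using d sq by (intro frac_le) (auto simp: power2_eq_square mult_left_le_one_le)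
    thus "C1 * (2 / \<delta>\<^sup>2) + (8 * C1) * (sqrt (2 * pi) / \<delta>) + C2 * (LBINT t. gauss \<delta> t * (1 / (a\<^sup>2 + t\<^sup>2))) \<le> C1 * (2 / \<delta>\<^sup>2) + (8 * C1) * (3 / \<delta>\<^sup>2) + C2 * (pi / a)"
      using C l3 by (intro add_mono mult_left_mono order_refl) auto
    have "(LBINT t. gauss \<delta> t * (1 / (a\<^sup>2 + t\<^sup>2))) \<ge> 0"
      using gauss_pos by (intro integral_nonneg_AE AE_I2) (simp add: less_imp_le)
    thus "0 \<le> C1 * (2 / \<delta>\<^sup>2) + (8 * C1) * (sqrt (2 * pi) / \<delta>) + C2 * (LBINT t. gauss \<delta> t * (1 / (a\<^sup>2 + t\<^sup>2)))"
      using C d by (intro add_nonneg_nonneg mult_nonneg_nonneg) auto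
  qed auto
  also have "\<dots> \<le> 100 * C1 / \<delta>\<^sup>2 + 5 * C2 / a"
  proof -
    have "3 / 2 * (C2 * (pi / a)) \<le> 3 / 2 * (C2 * (3.2 / a))"
      using C a pi_approx by (intro mult_left_mono divide_right_mono) auto
    also have "\<dots> \<le> 5 * C2 / a" using C a by (simp add: field_simps)
    finally have 1: "3 / 2 * (C2 * (pi / a)) \<le> 5 * C2 / a" .
    have "3 / 2 * (C1 * (2 / \<delta>\<^sup>2) + (8 * C1) * (3 / \<delta>\<^sup>2)) = 39 * (C1 / \<delta>\<^sup>2)" by simp
    also have "\<dots> \<le> 100 * (C1 / \<delta>\<^sup>2)" using C by (intro mult_right_mono) auto
    finally have 2: "3 / 2 * (C1 * (2 / \<delta>\<^sup>2) + (8 * C1) * (3 / \<delta>\<^sup>2)) \<le> 100 * C1 / \<delta>\<^sup>2" by simp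
    show ?thesis using 1 2 by (simp only: distrib_left)
  qed
  finally show ?thesis by - simp
qed

section \<open>The discrepancy from the main term\<close>

lemma norm_powr_diff_le_mono:
  fixes e :: complex and a b :: real
  assumes "0 < a" "0 < b" "a \<le> M" "b \<le> M" "Re e \<ge> 1"
  shows "norm (of_real b powr e - of_real a powr e :: complex) \<le> norm e * M powr (Re e - 1) * \<bar>b - a\<bar>"
proof -
  let ?S = "closed_segment (complex_of_real a) (of_real b)"
  have S: "\<exists>x. w = of_real x \<and> 0 < x \<and> x \<le> M" if "w \<in> ?S" for w
    using that assms
    by (subst (asm) closed_segment_of_real) (force simp: closed_segment_eq_real_ivl split: if_splits)
  have "norm (of_real b powr e - of_real a powr e :: complex)
      \<le> (norm e * M powr (Re e - 1)) * norm (of_real b - of_real a :: complex)"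
  proof (rule field_differentiable_bound[of ?S])
    fix w assume "w \<in> ?S"
    then obtain x where x: "w = of_real x" "0 < x" "x \<le> M" using S by blast
    have "w \<notin> \<real>\<^sub>\<le>\<^sub>0" using x by (auto simp: complex_nonpos_Reals_iff)
    thus "((\<lambda>w. w powr e) has_field_derivative e * w powr (e - 1)) (at w within ?S)"
      by (rule has_field_derivative_at_within[OF has_field_derivative_powr])
    have "norm (w powr (e - 1)) = x powr (Re e - 1)"
      using x by (subst norm_powr_real_powr) auto
    also have "\<dots> \<le> M powr (Re e - 1)" using x assms by (intro powr_mono2) auto
    finally show "norm (e * w powr (e - 1)) \<le> norm e * M powr (Re e - 1)"
      by (simp add: norm_mult mult_left_mono)
  qed auto
  also have "norm (of_real b - of_real a :: complex) = \<bar>b - a\<bar>"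
    by (metis norm_of_real of_real_diff)
  finally show ?thesis .
qed

lemma abs_exp_minus_1_le:
  fixes u :: real
  assumes "\<bar>u\<bar> \<le> 1"
  shows "\<bar>exp u - 1\<bar> \<le> 3 * \<bar>u\<bar>"
proof -
  have "\<bar>exp u - 1\<bar> \<le> exp \<bar>u\<bar> * \<bar>u\<bar>"
    using Taylor_exp_field[of u 0] by simp
  also have "exp \<bar>u\<bar> \<le> exp 1" using assms by simp
  also have "exp (1::real) \<le> 3" by (rule exp_le)
  finally show ?thesis by (simp add: mult_right_mono)
qed

text \<open>Moving from x to v changes the sum by at most |exp v - exp x| + 1, and the normalisation
  accordingly. The 1 stems from the floors and becomes 3 exp(-x) after normalisation.\<close>

lemma omega_mean_diff_le:
  assumes z: "norm z \<le> 1" and v: "v \<ge> 0" "x \<ge> 0" "\<bar>v - x\<bar> \<le> 1"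
  shows "norm (omega_mean z v - omega_mean z x) \<le> 6 * \<bar>v - x\<bar> + 3 * exp (- x)"
proof -
  define A B where "A = omega_sum z (nat \<lfloor>exp v\<rfloor>)" and "B = omega_sum z (nat \<lfloor>exp x\<rfloor>)"
  have AB: "norm (A - B) \<le> \<bar>exp v - exp x\<bar> + 1"
  proof (cases "v \<le> x")
    case True
    hence le: "nat \<lfloor>exp v\<rfloor> \<le> nat \<lfloor>exp x\<rfloor>" by (intro nat_mono floor_mono) simp
    have "norm (A - B) = norm (B - A)" by (rule norm_minus_commute)
    also have "\<dots> \<le> real (nat \<lfloor>exp x\<rfloor> - nat \<lfloor>exp v\<rfloor>)" unfolding A_def B_def by (rule norm_omega_sum_diff_le[OF z le])
    also have "\<dots> = real (nat \<lfloor>exp x\<rfloor>) - real (nat \<lfloor>exp v\<rfloor>)" using le by (rule of_nat_diff)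
    also have "\<dots> \<le> \<bar>exp v - exp x\<bar> + 1"
      using floor_correct[of "exp x"] floor_correct[of "exp v"] exp_gt_zero[of x] exp_gt_zero[of v] by simp linarith
    finally show ?thesis .
  next
    case False
    hence le: "nat \<lfloor>exp x\<rfloor> \<le> nat \<lfloor>exp v\<rfloor>" by (intro nat_mono floor_mono) simp
    have "norm (A - B) \<le> real (nat \<lfloor>exp v\<rfloor> - nat \<lfloor>exp x\<rfloor>)" unfolding A_def B_def by (rule norm_omega_sum_diff_le[OF z le])
    also have "\<dots> = real (nat \<lfloor>exp v\<rfloor>) - real (nat \<lfloor>exp x\<rfloor>)" using le by (rule of_nat_diff)
    also have "\<dots> \<le> \<bar>exp v - exp x\<bar> + 1"
      using floor_correct[of "exp x"] floor_correct[of "exp v"] exp_gt_zero[of x] exp_gt_zero[of v] by simp linarith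
    finally show ?thesis .
  qed
  have B: "norm B \<le> exp x"
  proof -
    have "norm B \<le> real (nat \<lfloor>exp x\<rfloor>)" unfolding B_def by (rule norm_omega_sum_le[OF z])
    also have "\<dots> \<le> exp x" by simp
    finally show ?thesis .
  qed
  have "omega_mean z v - omega_mean z x = (A - B) * of_real (exp (- v)) + B * of_real (exp (- v) - exp (- x))"
    using v by (simp add: omega_mean_def A_def B_def algebra_simps)
  also have "norm \<dots> \<le> (\<bar>exp v - exp x\<bar> + 1) * exp (- v) + exp x * \<bar>exp (- v) - exp (- x)\<bar>"
  proof (rule norm_triangle_mono)
    show "norm ((A - B) * of_real (exp (- v))) \<le> (\<bar>exp v - exp x\<bar> + 1) * exp (- v)"
      unfolding norm_mult norm_of_real by (simp add: AB)
    show "norm (B * of_real (exp (- v) - exp (- x))) \<le> exp x * \<bar>exp (- v) - exp (- x)\<bar>"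
      unfolding norm_mult norm_of_real by (intro mult_right_mono B) auto
  qed
  also have "\<dots> = \<bar>exp v * exp (- v) - exp x * exp (- v)\<bar> + exp (- v) + \<bar>exp x * exp (- v) - exp x * exp (- x)\<bar>"
    unfolding left_diff_distrib[symmetric] right_diff_distrib[symmetric] abs_mult
    by (simp add: distrib_right)
  also have "\<dots> = 2 * \<bar>exp (x - v) - 1\<bar> + exp (- v)"
    by (simp flip: exp_add)
  also have "\<dots> \<le> 2 * (3 * \<bar>v - x\<bar>) + 3 * exp (- x)"
  proof (intro add_mono mult_left_mono)
    show "\<bar>exp (x - v) - 1\<bar> \<le> 3 * \<bar>v - x\<bar>" using abs_exp_minus_1_le[of "x - v"] v by (simp add: abs_minus_commute)
    have "exp (- v) \<le> exp (1 + (- x))" using v by simp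
    also have "\<dots> = exp 1 * exp (- x)" by (rule exp_add)
    also have "\<dots> \<le> 3 * exp (- x)" by (intro mult_right_mono exp_le) auto
    finally show "exp (- v) \<le> 3 * exp (- x)" .
  qed auto
  finally show ?thesis by simp
qed

text \<open>The subtracted function is v^k times the expected main term, which is proportional to
  v^(z - 1). The factor v^k also removes the singularity at v = 0.\<close>

definition discrepancy :: "nat \<Rightarrow> complex \<Rightarrow> real \<Rightarrow> complex" where
  "discrepancy k z v = of_real v ^ k * omega_mean z v - corr_prod z 1 * rGamma z * power_fun (z + of_nat k) v"

lemma subexp_discrepancy:
  assumes "norm z = 1" "k \<ge> 2"
  shows "subexp (discrepancy k z)"
proof -
  have "Re z \<ge> -1" using abs_Re_le_cmod[of z] assms by linarith
  hence "subexp (power_fun (z + of_nat k))" using assms by (intro subexp_power_fun) auto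
  thus ?thesis
    unfolding discrepancy_def[abs_def]
    using subexp_mult_power[OF subexp_omega_mean, of z 1 k] assms
    by (intro subexp_diff subexp_mult_const) auto
qed

text \<open>Multiplication by v^k becomes k derivatives, and Gamma(z + k) / Gamma(z) is the
  Pochhammer symbol. So the subtracted term is exactly the singular part found in
  \<open>omega_series_near_one\<close>.\<close>

lemma laplace_discrepancy:
  assumes z: "norm z = 1" and k: "k \<ge> 2" and \<xi>: "Re \<xi> > 0"
  shows "laplace (discrepancy k z) \<xi> = (-1) ^ k * (deriv ^^ k) (\<lambda>s. omega_series z s / s) (1 + \<xi>) -
    corr_prod z 1 * pochhammer z k * \<xi> powr (- z - of_nat k)"
proof -
  have re: "Re z \<ge> -1" using abs_Re_le_cmod[of z] z by linarith
  have sub1: "subexp (omega_mean z)" using z by (intro subexp_omega_mean) auto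
  have w: "Re (z + of_nat k) \<ge> 1" using re k by simp
  have sub2: "subexp (power_fun (z + of_nat k))" by (rule subexp_power_fun[OF w])
  have sub3: "subexp (\<lambda>v. of_real v ^ k * omega_mean z v)" using subexp_mult_power[OF sub1, of 1 k] by simp
  have Q_holo: "(\<lambda>s. omega_series z s / s) holomorphic_on {s. Re s > 1}"
  proof (rule holomorphic_transform)
    show "(\<lambda>s. exp (z * log_zeta s) * (corr_prod z s / s)) holomorphic_on {s. Re s > 1}"
      by (intro holomorphic_on_mult holomorphic_on_exp' holomorphic_on_const log_zeta_holomorphic
           holomorphic_on_subset[OF corr_prod_over_s(1)[OF z]]) auto
  qed (simp add: omega_series_factorization[OF z])
  have "of_real v ^ k * omega_mean z v = (-1) ^ k * ((- of_real v) ^ k * omega_mean z v)" for v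
    by (simp only: mult.assoc[symmetric] power_mult_distrib[symmetric]) simp
  hence s1: "laplace (\<lambda>v. of_real v ^ k * omega_mean z v) \<xi> = (-1) ^ k * laplace (\<lambda>v. (- of_real v) ^ k * omega_mean z v) \<xi>"
    unfolding laplace_cmult[symmetric] by (simp only:)
  have s2: "laplace (\<lambda>v. (- of_real v) ^ k * omega_mean z v) \<xi> = (deriv ^^ k) (laplace (omega_mean z)) \<xi>"
    by (rule laplace_higher_deriv[OF sub1 \<xi>, symmetric])
  have s3: "(deriv ^^ k) (laplace (omega_mean z)) \<xi> = (deriv ^^ k) (\<lambda>\<xi>. omega_series z (1 * \<xi> + 1) / (1 * \<xi> + 1)) \<xi>"
  proof (rule higher_deriv_transform_within_open[OF laplace_holomorphic[OF sub1] _ open_Re_gt_0])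
    have "((\<lambda>s. omega_series z s / s) \<circ> (\<lambda>\<xi>. 1 * \<xi> + 1)) holomorphic_on {s. Re s > 0}"
      by (rule holomorphic_on_compose_gen[OF _ Q_holo]) (auto intro!: holomorphic_intros)
    thus "(\<lambda>\<xi>. omega_series z (1 * \<xi> + 1) / (1 * \<xi> + 1)) holomorphic_on {s. Re s > 0}" by (simp add: o_def)
    fix w :: complex assume "w \<in> {s. Re s > 0}"
    thus "laplace (omega_mean z) w = omega_series z (1 * w + 1) / (1 * w + 1)"
      using laplace_omega_mean[of z w] z by (simp add: add.commute)
  qed (use \<xi> in simp)
  have s4: "(deriv ^^ k) (\<lambda>\<xi>. omega_series z (1 * \<xi> + 1) / (1 * \<xi> + 1)) \<xi> = 1 ^ k * (deriv ^^ k) (\<lambda>s. omega_series z s / s) (1 * \<xi> + 1)"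
    by (rule higher_deriv_compose_linear'[OF Q_holo open_Re_gt_0 open_Re_gt_1]) (use \<xi> in auto)
  have 1: "laplace (\<lambda>v. of_real v ^ k * omega_mean z v) \<xi> = (-1) ^ k * (deriv ^^ k) (\<lambda>s. omega_series z s / s) (1 + \<xi>)"
    unfolding s1 s2 s3 s4 by (simp add: add.commute)
  \<comment> \<open>Re (z + k) \<ge> 1 excludes the poles of Gamma.\<close>
  have nz: "rGamma (z + of_nat k) \<noteq> 0"
  proof
    assume "rGamma (z + of_nat k) = 0"
    then obtain n where n: "z + of_nat k = of_int n" "n \<le> 0"
      by (auto simp: rGamma_eq_zero_iff elim!: nonpos_Ints_cases)
    have "Re (z + of_nat k) = real_of_int n" unfolding n(1) by simp
    thus False using w n(2) by linarith
  qed
  have poch: "rGamma z * Gamma (z + of_nat k) = pochhammer z k"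
    using nz pochhammer_rGamma[of z k] by (simp add: Gamma_def)
  have e: "- (z + of_nat k) = - z - of_nat k" by simp
  have 2: "laplace (\<lambda>v. corr_prod z 1 * rGamma z * power_fun (z + of_nat k) v) \<xi> = corr_prod z 1 * pochhammer z k * \<xi> powr (- z - of_nat k)"
    unfolding laplace_cmult laplace_power_fun[OF w \<xi>] e poch[symmetric] by (simp only: mult.assoc)
  show ?thesis
    unfolding discrepancy_def[abs_def]
    by (subst laplace_diff[OF sub3 subexp_mult_const[OF sub2] \<xi>]) (simp only: 1 2)
qed

text \<open>At heights above r the two parts are bounded separately. Below r, the bound |\<xi>|^(-q
  - 2) with q = Re z + k - 3 is split: |\<xi>|^(-2) is kept for integrability in t, and the rest is
  bounded by a^(-q). This needs q \<ge> 0, hence k \<ge> 4.\<close>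

lemma laplace_discrepancy_bound:
  assumes k: "k \<ge> 4"
  obtains r C where "0 < r" "r \<le> 1/4" "C \<ge> 0"
    "\<And>z a t. norm z = 1 \<Longrightarrow> 0 < a \<Longrightarrow> a \<le> r \<Longrightarrow> norm (laplace (discrepancy k z) (Complex a t))
      \<le> C * (\<bar>t\<bar> + 8) + (C * a powr (- (Re z + real k - 3))) / (a\<^sup>2 + t\<^sup>2)"
proof -
  obtain r where r: "0 < r" "r \<le> 1/4" and near_k:
    "\<And>k. \<exists>C\<ge>0. \<forall>z s. norm z = 1 \<longrightarrow> 1 < Re s \<longrightarrow> norm (s - 1) \<le> 2 * r \<longrightarrow>
       norm ((-1) ^ k * (deriv ^^ k) (\<lambda>s. omega_series z s / s) s - corr_prod z 1 * pochhammer z k * (s - 1) powr (- z - of_nat k))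
         \<le> C * norm (s - 1) powr (- Re z - real k + 1)"
    by (rule omega_series_near_one) blast
  obtain C2 where C2: "C2 \<ge> 0" and near: "\<And>z s. norm z = 1 \<Longrightarrow> 1 < Re s \<Longrightarrow> norm (s - 1) \<le> 2 * r \<Longrightarrow>
       norm ((-1) ^ k * (deriv ^^ k) (\<lambda>s. omega_series z s / s) s - corr_prod z 1 * pochhammer z k * (s - 1) powr (- z - of_nat k))
         \<le> C2 * norm (s - 1) powr (- Re z - real k + 1)"
    using near_k[of k] by blast
  obtain C1 where C1: "C1 \<ge> 0" and high: "\<And>z s. norm z = 1 \<Longrightarrow> 1 < Re s \<Longrightarrow> Re s \<le> 2 \<Longrightarrow> r \<le> \<bar>Im s\<bar> \<Longrightarrow>
    norm ((deriv ^^ k) (\<lambda>s. omega_series z s / s) s) \<le> C1 * (\<bar>Im s\<bar> + 8)"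
    using omega_series_deriv_bound_high[of r k] r by auto
  define C3 where "C3 = corr_bound * fact k * (exp pi * r powr (- real k - 1))"
  have G0: "corr_bound > 0" by (simp add: corr_bound_def)
  have C3: "C3 \<ge> 0" using G0 by (simp add: C3_def)
  define C where "C = C1 + C2 + C3"
  have C: "C \<ge> 0" "C1 + C3 \<le> C" "C2 \<le> C" using C1 C2 C3 by (auto simp: C_def)
  show ?thesis
  proof (rule that[OF r C(1)])
    fix z :: complex and a t :: real assume z: "norm z = 1" and a: "0 < a" "a \<le> r"
    define \<xi> where "\<xi> = Complex a t"
    have re: "\<bar>Re z\<bar> \<le> 1" using abs_Re_le_cmod[of z] z by simp
    have \<xi>: "Re \<xi> > 0" "Re (1 + \<xi>) > 1" "Re (1 + \<xi>) \<le> 2" "Im (1 + \<xi>) = t" "1 + \<xi> - 1 = \<xi>"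
      using a r by (auto simp: \<xi>_def)
    have n\<xi>: "norm \<xi> ^ 2 = a\<^sup>2 + t\<^sup>2" by (simp add: \<xi>_def cmod_power2)
    have n\<xi>a: "a \<le> norm \<xi>" using complex_Re_le_cmod[of \<xi>] by (simp add: \<xi>_def)
    have eq: "laplace (discrepancy k z) \<xi> = (-1) ^ k * (deriv ^^ k) (\<lambda>s. omega_series z s / s) (1 + \<xi>) -
      corr_prod z 1 * pochhammer z k * \<xi> powr (- z - of_nat k)"
      using k by (intro laplace_discrepancy z \<xi>) auto
    have T1: "C * (\<bar>t\<bar> + 8) \<ge> 0" using C by simp
    have T2: "(C * a powr (- (Re z + real k - 3))) / (a\<^sup>2 + t\<^sup>2) \<ge> 0" using C by simp
    show "norm (laplace (discrepancy k z) (Complex a t)) \<le> C * (\<bar>t\<bar> + 8) + (C * a powr (- (Re z + real k - 3))) / (a\<^sup>2 + t\<^sup>2)"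
    proof (cases "\<bar>t\<bar> \<ge> r")
      case True
      have "norm (laplace (discrepancy k z) \<xi>) \<le> C1 * (\<bar>t\<bar> + 8) + C3"
        unfolding eq
      proof (rule order_trans[OF norm_triangle_ineq4 add_mono])
        show "norm ((-1) ^ k * (deriv ^^ k) (\<lambda>s. omega_series z s / s) (1 + \<xi>)) \<le> C1 * (\<bar>t\<bar> + 8)"
          using high[of z "1 + \<xi>"] z \<xi> True by (simp add: norm_mult norm_power)
        have rx: "r \<le> norm \<xi>" using abs_Im_le_cmod[of \<xi>] True by (simp add: \<xi>_def)
        have "norm \<xi> powr (- Re z - real k) \<le> r powr (- Re z - real k)"
          using rx r re k by (intro powr_mono2') auto
        also have "\<dots> \<le> r powr (- real k - 1)" using r re by (intro powr_mono') auto
        finally have "norm (\<xi> powr (- z - of_nat k)) \<le> exp pi * r powr (- real k - 1)"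
          using norm_powr_le[OF z, of \<xi> k] by (meson exp_ge_zero mult_left_mono order_trans)
        thus "norm (corr_prod z 1 * pochhammer z k * \<xi> powr (- z - of_nat k)) \<le> C3"
          unfolding C3_def norm_mult using z G0
          by (intro mult_mono norm_corr_prod_le norm_pochhammer_le) auto
      qed
      also have "\<dots> \<le> (C1 + C3) * (\<bar>t\<bar> + 8)"
      proof -
        have "C3 * 1 \<le> C3 * (\<bar>t\<bar> + 8)" using C3 by (intro mult_left_mono) auto
        thus ?thesis by (simp add: algebra_simps)
      qed
      also have "\<dots> \<le> C * (\<bar>t\<bar> + 8)" using C by (intro mult_right_mono) auto
      finally show ?thesis using T2 unfolding \<xi>_def by linarith
    next
      case False
      define q where "q = Re z + real k - 3"
      have q: "q \<ge> 0" using re k by (simp add: q_def)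
      have pos: "norm \<xi> > 0" using a n\<xi>a by linarith
      \<comment> \<open>Both coordinates are at most r, which is why the expansion at s = 1 is
        available up to distance 2 r.\<close>
      have "norm \<xi> \<le> \<bar>Re \<xi>\<bar> + \<bar>Im \<xi>\<bar>" by (rule cmod_le)
      hence "norm \<xi> \<le> 2 * r" using False a by (simp add: \<xi>_def)
      hence "norm (laplace (discrepancy k z) \<xi>) \<le> C2 * norm \<xi> powr (- Re z - real k + 1)"
        unfolding eq using near[OF z \<xi>(2)] by (simp add: \<xi>(5))
      also have "- Re z - real k + 1 = - q + (- 2)" by (simp add: q_def)
      also have "norm \<xi> powr (- q + (- 2)) = norm \<xi> powr (- q) / norm \<xi> ^ 2"
        unfolding powr_add using pos by (simp add: powr_minus powr_numeral divide_inverse)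
      also have "C2 * (norm \<xi> powr (- q) / norm \<xi> ^ 2) \<le> C2 * (a powr (- q) / norm \<xi> ^ 2)"
      proof (intro mult_left_mono divide_right_mono C2)
        show "norm \<xi> powr (- q) \<le> a powr (- q)"
          using a n\<xi>a q by (intro powr_mono2') auto
      qed auto
      also have "\<dots> = C2 * a powr (- q) / (a\<^sup>2 + t\<^sup>2)" by (simp add: n\<xi>)
      also have "\<dots> \<le> C * a powr (- q) / (a\<^sup>2 + t\<^sup>2)"
        using C by (intro divide_right_mono mult_right_mono) auto
      finally show ?thesis using T1 unfolding \<xi>_def q_def by linarith
    qed
  qed
qed

text \<open>As an entire function, \<open>rGamma\<close> is bounded on the unit circle, including
  the neighbourhood of the pole z = -1 of Gamma.\<close>

lemma main_coeff_bounded: "\<exists>K\<ge>0. \<forall>z. norm z = 1 \<longrightarrow> norm (corr_prod z 1 * rGamma z) \<le> K"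
proof -
  have "compact (rGamma ` sphere (0::complex) 1)"
    by (intro compact_continuous_image compact_sphere holomorphic_on_imp_continuous_on holomorphic_rGamma)
  then obtain B where B: "\<And>z. norm z = 1 \<Longrightarrow> norm (rGamma (z :: complex)) \<le> B"
    by (force dest!: compact_imp_bounded simp: bounded_iff)
  have B0: "B \<ge> 0" using B[of 1] norm_ge_zero[of "rGamma (1 :: complex)"] by simp
  have "norm (corr_prod z 1 * rGamma z) \<le> corr_bound * B" if "norm z = 1" for z
    unfolding norm_mult using that B0 by (intro mult_mono norm_corr_prod_le B) (auto simp: corr_bound_def)
  thus ?thesis using B0 by (intro exI[of _ "corr_bound * B"]) (auto simp: corr_bound_def)
qed

lemma norm_discrepancy_le:
  assumes z: "norm z = 1" and k: "k \<ge> 3" and K: "norm (corr_prod z 1 * rGamma z) \<le> K"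
  shows "norm (discrepancy k z v) \<le> (1 + K) * (1 + \<bar>v\<bar>) ^ k"
proof (cases "v > 0")
  case True
  have K0: "K \<ge> 0" using K norm_ge_zero order_trans by blast
  have re: "\<bar>Re z\<bar> \<le> 1" using abs_Re_le_cmod[of z] z by simp
  have "norm (of_real v ^ k * omega_mean z v) \<le> (1 + v) ^ k * 1"
    unfolding norm_mult norm_power using True z by (intro mult_mono power_mono norm_omega_mean_le) auto
  moreover have "norm (power_fun (z + of_nat k) v) \<le> (1 + v) ^ k"
  proof -
    have "norm (power_fun (z + of_nat k) v) = v powr (Re z + real k - 1)"
      using True by (simp add: power_fun_def norm_powr_real_powr)
    also have "\<dots> \<le> (1 + v) powr (Re z + real k - 1)" using True re k by (intro powr_mono2) auto
    also have "\<dots> \<le> (1 + v) powr real k" using True re by (intro powr_mono) auto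
    finally show ?thesis using True by (simp add: powr_realpow)
  qed
  hence "norm (corr_prod z 1 * rGamma z * power_fun (z + of_nat k) v) \<le> K * (1 + v) ^ k"
    unfolding norm_mult[of "corr_prod z 1 * rGamma z"] using K K0 by (intro mult_mono) auto
  ultimately show ?thesis
    using norm_triangle_ineq4[of "of_real v ^ k * omega_mean z v" "corr_prod z 1 * rGamma z * power_fun (z + of_nat k) v"] True
    by (simp add: discrepancy_def algebra_simps)
next
  case False
  have K0: "K \<ge> 0" using K norm_ge_zero order_trans by blast
  have "discrepancy k z v = 0"
    using False k by (cases "v = 0") (simp_all add: discrepancy_def omega_mean_def power_fun_def)
  thus ?thesis using K0 by simp
qed

lemma discrepancy_near:
  assumes z: "norm z = 1" and k: "k \<ge> 3" and K: "norm (corr_prod z 1 * rGamma z) \<le> K"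
    and x: "x \<ge> 2" and u: "\<bar>v - x\<bar> \<le> 1"
  shows "norm (discrepancy k z v - discrepancy k z x)
    \<le> (real k + 2) * (2 * x) ^ k * \<bar>v - x\<bar> * (1 + K) + x ^ k * (6 * \<bar>v - x\<bar> + 3 * exp (- x))"
proof -
  have K0: "K \<ge> 0" using K norm_ge_zero order_trans by blast
  have re: "\<bar>Re z\<bar> \<le> 1" using abs_Re_le_cmod[of z] z by simp
  have v: "v > 0" "v \<le> 2 * x" using x u by linarith+
  \<comment> \<open>Covers both powers that occur, with e = k and e = z + k - 1; the latter has real
    part at least 1 because k \<ge> 3.\<close>
  have p: "norm (of_real v powr e - of_real x powr e :: complex) \<le> (real k + 2) * (2 * x) ^ k * \<bar>v - x\<bar>"
    if e: "Re e \<ge> 1" "Re e - 1 \<le> real k" "norm e \<le> real k + 2" for e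
  proof -
    have "norm (of_real v powr e - of_real x powr e :: complex) \<le> norm e * (2 * x) powr (Re e - 1) * \<bar>v - x\<bar>"
      using v x e by (intro norm_powr_diff_le_mono) auto
    also have "\<dots> \<le> (real k + 2) * (2 * x) powr real k * \<bar>v - x\<bar>"
      using x e by (intro mult_right_mono mult_mono powr_mono) auto
    finally show ?thesis using x by (simp add: powr_realpow)
  qed
  have 1: "norm (of_real v ^ k - of_real x ^ k :: complex) \<le> (real k + 2) * (2 * x) ^ k * \<bar>v - x\<bar>"
    using p[of "of_nat k"] v x k by simp
  have 2: "norm (power_fun (z + of_nat k) v - power_fun (z + of_nat k) x) \<le> (real k + 2) * (2 * x) ^ k * \<bar>v - x\<bar>"
  proof -
    have "norm (z + of_nat k - 1) \<le> norm z + real k + 1"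
      using norm_triangle_ineq4[of "z + of_nat k" 1] norm_triangle_ineq[of z "of_nat k"] by simp
    thus ?thesis using p[of "z + of_nat k - 1"] v x re k z by (simp add: power_fun_def)
  qed
  have "discrepancy k z v - discrepancy k z x = (of_real v ^ k - of_real x ^ k) * omega_mean z v
    + of_real x ^ k * (omega_mean z v - omega_mean z x)
    - corr_prod z 1 * rGamma z * (power_fun (z + of_nat k) v - power_fun (z + of_nat k) x)"
    by (simp add: discrepancy_def algebra_simps)
  also have "norm \<dots> \<le> (real k + 2) * (2 * x) ^ k * \<bar>v - x\<bar> * 1 + x ^ k * (6 * \<bar>v - x\<bar> + 3 * exp (- x)) + K * ((real k + 2) * (2 * x) ^ k * \<bar>v - x\<bar>)"
  proof (rule order_trans[OF norm_triangle_ineq4 add_mono], rule norm_triangle_mono)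
    show "norm ((of_real v ^ k - of_real x ^ k) * omega_mean z v) \<le> (real k + 2) * (2 * x) ^ k * \<bar>v - x\<bar> * 1"
      unfolding norm_mult using 1 z x by (intro mult_mono norm_omega_mean_le) auto
    have "norm (omega_mean z v - omega_mean z x) \<le> 6 * \<bar>v - x\<bar> + 3 * exp (- x)"
      using z v x u by (intro omega_mean_diff_le) auto
    thus "norm (of_real x ^ k * (omega_mean z v - omega_mean z x)) \<le> x ^ k * (6 * \<bar>v - x\<bar> + 3 * exp (- x))"
      unfolding norm_mult norm_power using x by (simp add: mult_left_mono)
    show "norm (corr_prod z 1 * rGamma z * (power_fun (z + of_nat k) v - power_fun (z + of_nat k) x)) \<le> K * ((real k + 2) * (2 * x) ^ k * \<bar>v - x\<bar>)"
      unfolding norm_mult[of "corr_prod z 1 * rGamma z"] using 2 K K0 by (intro mult_mono) auto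
  qed
  finally show ?thesis by (simp add: algebra_simps)
qed

text \<open>For |v - x| > 1 only the polynomial growth of the discrepancy is used, and it is hidden
  in a high power of |v - x|. The exponent 2 k + 1 is odd, so that the absolute moment of the normal
  density has a closed form.\<close>

lemma discrepancy_modulus:
  assumes k: "k \<ge> 3"
  obtains C where "C \<ge> 0" "\<And>z x v. norm z = 1 \<Longrightarrow> x \<ge> 2 \<Longrightarrow>
    norm (discrepancy k z v - discrepancy k z x) \<le> C * x ^ k * (\<bar>v - x\<bar> + \<bar>v - x\<bar> ^ (2 * k + 1) + exp (- x))"
proof -
  obtain K where K: "K \<ge> 0" "\<And>z. norm z = 1 \<Longrightarrow> norm (corr_prod z 1 * rGamma z) \<le> K"
    using main_coeff_bounded by blast
  define A where "A = (real k + 2) * 2 ^ k * (1 + K)"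
  define B where "B = 2 * (1 + K) * 3 ^ k"
  define C where "C = A + 6 + B"
  have AB: "A \<ge> 0" "B \<ge> 0" using K by (auto simp: A_def B_def)
  show ?thesis
  proof (rule that[of C])
    show "C \<ge> 0" using AB by (simp add: C_def)
    fix z :: complex and x v :: real assume z: "norm z = 1" and x: "x \<ge> 2"
    define u where "u = \<bar>v - x\<bar>"
    have u: "u \<ge> 0" by (simp add: u_def)
    show "norm (discrepancy k z v - discrepancy k z x) \<le> C * x ^ k * (\<bar>v - x\<bar> + \<bar>v - x\<bar> ^ (2 * k + 1) + exp (- x))"
    proof (cases "u \<le> 1")
      case True
      have "norm (discrepancy k z v - discrepancy k z x) \<le> (real k + 2) * (2 * x) ^ k * u * (1 + K) + x ^ k * (6 * u + 3 * exp (- x))"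
        unfolding u_def using True by (intro discrepancy_near z k K x) (simp add: u_def)
      also have "\<dots> = x ^ k * (A * u + 6 * u + 3 * exp (- x))"
        by (simp add: A_def power_mult_distrib algebra_simps)
      also have "\<dots> \<le> x ^ k * (C * (u + u ^ (2 * k + 1) + exp (- x)))"
      proof (rule mult_left_mono)
        have "C * (u + u ^ (2 * k + 1) + exp (- x)) = C * u + C * u ^ (2 * k + 1) + C * exp (- x)" by (simp add: algebra_simps)
        moreover have "C * u \<ge> A * u + 6 * u" using AB u by (simp add: C_def algebra_simps)
        moreover have "C * u ^ (2 * k + 1) \<ge> 0" using AB u by (simp add: C_def)
        moreover have "C * exp (- x) \<ge> 3 * exp (- x)" using AB by (intro mult_right_mono) (auto simp: C_def)
        ultimately show "A * u + 6 * u + 3 * exp (- x) \<le> C * (u + u ^ (2 * k + 1) + exp (- x))" by linarith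
      qed (use x in auto)
      finally show ?thesis by (simp add: u_def mult_ac)
    next
      case False
      have xu: "x * 1 \<le> x * u" "1 * u \<le> x * u" using False x by (intro mult_left_mono mult_right_mono; simp)+
      have "norm (discrepancy k z v - discrepancy k z x) \<le> (1 + K) * (1 + \<bar>v\<bar>) ^ k + (1 + K) * (1 + \<bar>x\<bar>) ^ k"
        by (rule order_trans[OF norm_triangle_ineq4]) (intro add_mono norm_discrepancy_le z k K)
      also have "\<dots> \<le> (1 + K) * (3 * (x * u)) ^ k + (1 + K) * (3 * (x * u)) ^ k"
      proof (intro add_mono mult_left_mono power_mono)
        have "\<bar>v\<bar> \<le> x + u" using x unfolding u_def by linarith
        thus "1 + \<bar>v\<bar> \<le> 3 * (x * u)" using xu x False by linarith
        show "1 + \<bar>x\<bar> \<le> 3 * (x * u)" using xu x False by linarith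
      qed (use K in auto)
      also have "\<dots> = B * (x ^ k * u ^ k)" by (simp add: B_def power_mult_distrib)
      also have "\<dots> \<le> C * (x ^ k * u ^ (2 * k + 1))"
        using AB x False by (intro mult_mono power_increasing) (auto simp: C_def)
      also have "\<dots> \<le> C * (x ^ k * (u + u ^ (2 * k + 1) + exp (- x)))"
        using AB x u by (intro mult_left_mono) (auto simp: C_def)
      finally show ?thesis by (simp add: u_def mult_ac)
    qed
  qed
qed

text \<open>D(x) differs from its Gaussian average by the average of D(v) - D(x), which the absolute
  moments of order 1 and 2 k + 1 bound; as \<delta> \<le> 1, both are of order \<delta>.\<close>

lemma gauss_average_error:
  fixes D :: "real \<Rightarrow> complex"
  assumes D: "D \<in> borel_measurable borel" and d: "0 < \<delta>" "\<delta> \<le> 1" and A: "A \<ge> 0" "e \<ge> 0"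
    and le: "\<And>v. norm (D v - D x) \<le> A * (\<bar>v - x\<bar> + \<bar>v - x\<bar> ^ (2 * k + 1) + e)"
  shows "norm (D x) \<le> norm (LBINT v. D v * of_real (normal_density x \<delta> v)) + A * ((1 + 2 ^ k * fact k) * \<delta> + e)"
proof -
  let ?N = "normal_density x \<delta>"
  have N0: "?N v \<ge> 0" for v by simp
  have [measurable]: "D \<in> borel_measurable borel" by (rule D)
  let ?B = "\<lambda>v. A * (?N v * \<bar>v - x\<bar> ^ (2 * 0 + 1) + ?N v * \<bar>v - x\<bar> ^ (2 * k + 1) + e * ?N v)"
  have hN: "has_bochner_integral lborel ?N 1"
    using d by (simp add: has_bochner_integral_iff)
  have hB: "has_bochner_integral lborel ?B (A * (2 ^ 0 * \<delta> ^ (2 * 0 + 1) * fact 0 * sqrt (2 / pi) + 2 ^ k * \<delta> ^ (2 * k + 1) * fact k * sqrt (2 / pi) + e * 1))"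
    by (intro has_bochner_integral_mult_right has_bochner_integral_add normal_moment_abs_odd hN d)
  have leB: "norm ((D v - D x) * of_real (?N v)) \<le> ?B v" for v
  proof -
    have "norm ((D v - D x) * of_real (?N v)) = norm (D v - D x) * ?N v" by (simp add: norm_mult)
    also have "\<dots> \<le> (A * (\<bar>v - x\<bar> + \<bar>v - x\<bar> ^ (2 * k + 1) + e)) * ?N v"
      by (intro mult_right_mono le N0)
    finally show ?thesis by (simp add: algebra_simps)
  qed
  have i1: "integrable lborel (\<lambda>v. (D v - D x) * of_real (?N v))"
  proof (rule Bochner_Integration.integrable_bound)
    show "integrable lborel ?B" using hB by (rule integrable.intros)
    show "AE v in lborel. norm ((D v - D x) * of_real (?N v)) \<le> norm (?B v)"
      unfolding real_norm_def by (intro AE_I2 order_trans[OF leB abs_ge_self])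
  qed measurable
  have hx: "has_bochner_integral lborel (\<lambda>v. D x * complex_of_real (?N v)) (D x * of_real 1)"
    using hN by (intro has_bochner_integral_mult_right has_bochner_integral_of_real)
  have "(LBINT v. D v * of_real (?N v)) = (LBINT v. (D v - D x) * of_real (?N v) + D x * of_real (?N v))"
    by (rule Bochner_Integration.integral_cong) (auto simp: algebra_simps)
  also have "\<dots> = (LBINT v. (D v - D x) * of_real (?N v)) + D x"
    using i1 hx by (subst Bochner_Integration.integral_add) (auto simp: has_bochner_integral_iff)
  finally have eq: "D x = (LBINT v. D v * of_real (?N v)) - (LBINT v. (D v - D x) * of_real (?N v))" by simp
  have "norm (LBINT v. (D v - D x) * of_real (?N v)) \<le> (LBINT v. ?B v)"
    by (rule Bochner_Integration.integral_norm_bound_integral[OF i1]) (use hB leB in \<open>auto simp: has_bochner_integral_iff\<close>)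
  also have "\<dots> = A * (2 ^ 0 * \<delta> ^ (2 * 0 + 1) * fact 0 * sqrt (2 / pi) + 2 ^ k * \<delta> ^ (2 * k + 1) * fact k * sqrt (2 / pi) + e * 1)"
    using hB by (rule has_bochner_integral_integral_eq)
  also have "\<dots> \<le> A * ((1 + 2 ^ k * fact k) * \<delta> + e)"
  proof (rule mult_left_mono)
    have s: "sqrt (2 / pi) \<le> 1" using pi_gt3 by simp
    have "\<delta> ^ (2 * k + 1) \<le> \<delta> ^ 1" using d by (intro power_decreasing) auto
    hence "2 ^ k * \<delta> ^ (2 * k + 1) * fact k * sqrt (2 / pi) \<le> 2 ^ k * \<delta> * fact k * 1"
      using d s by (intro mult_mono) auto
    moreover have "\<delta> * sqrt (2 / pi) \<le> \<delta> * 1" using d s by (intro mult_left_mono) auto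
    ultimately show "2 ^ 0 * \<delta> ^ (2 * 0 + 1) * fact 0 * sqrt (2 / pi) + 2 ^ k * \<delta> ^ (2 * k + 1) * fact k * sqrt (2 / pi) + e * 1
      \<le> (1 + 2 ^ k * fact k) * \<delta> + e"
      by (simp add: algebra_simps)
  qed (rule A)
  finally have "norm (LBINT v. (D v - D x) * of_real (?N v)) \<le> A * ((1 + 2 ^ k * fact k) * \<delta> + e)" .
  moreover have "norm (D x) \<le> norm (LBINT v. D v * of_real (?N v)) + norm (LBINT v. (D v - D x) * of_real (?N v))"
    by (subst eq) (rule norm_triangle_ineq4)
  ultimately show ?thesis by linarith
qed

text \<open>Smoothing at scale \<open>\<delta>\<close> costs \<open>\<delta> x\<^sup>k\<close>, and the transform at large heights contributes \<open>1 / \<delta>\<^sup>2\<close>; both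
  have to be dominated by \<open>x\<close> to the power \<open>Re z + k - 2\<close>, which is as small as \<open>k - 3\<close>. The choice
  \<open>\<delta> = 1 / x\<^sup>3\<close> forces \<open>k \<ge> 9\<close>.\<close>

theorem omega_mean_asymptotics:
  obtains C x0 where "C \<ge> 0" "x0 \<ge> 2" "\<And>z x. norm z = 1 \<Longrightarrow> x \<ge> x0 \<Longrightarrow>
    norm (omega_mean z x - corr_prod z 1 * rGamma z * of_real x powr (z - 1)) \<le> C * x powr (Re z - 2)"
proof -
  obtain r C1 where r: "0 < r" "r \<le> 1/4" and C1: "C1 \<ge> 0" and lap:
    "\<And>z a t. norm z = 1 \<Longrightarrow> 0 < a \<Longrightarrow> a \<le> r \<Longrightarrow> norm (laplace (discrepancy 9 z) (Complex a t))
      \<le> C1 * (\<bar>t\<bar> + 8) + (C1 * a powr (- (Re z + real 9 - 3))) / (a\<^sup>2 + t\<^sup>2)"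
    by (rule laplace_discrepancy_bound[of 9]) auto
  obtain C2 where C2: "C2 \<ge> 0" "\<And>z x v. norm z = 1 \<Longrightarrow> x \<ge> 2 \<Longrightarrow>
    norm (discrepancy 9 z v - discrepancy 9 z x) \<le> C2 * x ^ 9 * (\<bar>v - x\<bar> + \<bar>v - x\<bar> ^ (2 * 9 + 1) + exp (- x))"
    by (rule discrepancy_modulus[of 9]) auto
  define H :: real where "H = 1 + 2 ^ 9 * fact 9"
  have H: "H \<ge> 0" by (simp add: H_def)
  define C where "C = 100 * C1 + 5 * C1 + C2 * (H + 6)"
  show ?thesis
  \<comment> \<open>The line of integration has abscissa a = 1 / x, which must not exceed r.\<close>
  proof (rule that[of C "max 2 (1 / r)"])
    show "C \<ge> 0" using C1 C2 H by (simp add: C_def)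
    fix z :: complex and x :: real assume z: "norm z = 1" and x': "x \<ge> max 2 (1 / r)"
    have x: "x \<ge> 2" "1 / x \<le> r"
    proof -
      show "x \<ge> 2" using x' by simp
      moreover have "1 / r \<le> x" using x' by simp
      ultimately show "1 / x \<le> r" using r by (simp add: field_simps)
    qed
    have re: "\<bar>Re z\<bar> \<le> 1" using abs_Re_le_cmod[of z] z by simp
    define c where "c = corr_prod z 1 * rGamma z"
    let ?I = "LBINT v. discrepancy 9 z v * of_real (normal_density x (1 / x ^ 3) v)"
    have sub: "subexp (discrepancy 9 z)" by (rule subexp_discrepancy[OF z]) simp
    have I: "norm ?I \<le> 100 * C1 / (1 / x ^ 3)\<^sup>2 + 5 * (C1 * (1 / x) powr (- (Re z + real 9 - 3))) / (1 / x)"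
      using x z C1 r by (intro gauss_smoothing_bound_rational[OF sub] lap) (auto simp: power_le_one one_le_power)
    have "norm (discrepancy 9 z x) \<le> norm ?I + C2 * x ^ 9 * (H * (1 / x ^ 3) + exp (- x))"
      unfolding H_def using sub x C2 z
      by (intro gauss_average_error) (auto dest: subexp_measurable simp: one_le_power)
    also have "\<dots> \<le> x ^ 9 * (C * x powr (Re z - 2))"
    proof -
      have a1: "100 * C1 / (1 / x ^ 3)\<^sup>2 = x ^ 9 * (100 * C1 / x ^ 3)"
        using x by (simp add: power_divide field_simps flip: power_mult power_add)
      \<comment> \<open>The peak contributes x^(Re z + 7), the order of x^9 times the desired error,
        so this term determines the result.\<close>
      have a2: "5 * (C1 * (1 / x) powr (- (Re z + real 9 - 3))) / (1 / x) = x ^ 9 * (5 * C1 * x powr (Re z - 2))"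
      proof -
        have "(1 / x) powr (- (Re z + real 9 - 3)) = x powr (Re z + real 9 - 3)"
        proof -
          have "1 / x = x powr (- 1)" using x by (simp add: powr_minus divide_inverse)
          thus ?thesis by (simp only: powr_powr) (simp add: add.commute)
        qed
        also have "x powr (Re z + real 9 - 3) = x powr (8 + (Re z - 2))" by (simp add: add.commute)
        also have "x powr (8 + (Re z - 2)) = x ^ 8 * x powr (Re z - 2)"
          unfolding powr_add using x by (simp add: powr_numeral)
        finally have e: "(1 / x) powr (- (Re z + real 9 - 3)) = x ^ 8 * x powr (Re z - 2)" .
        have "x ^ 9 = x * x ^ 8" using power_Suc[of x 8] by simp
        thus ?thesis unfolding e using x by simp
      qed
      have a3: "1 / x ^ 3 \<le> x powr (Re z - 2)"
      proof -
        have "1 / x ^ 3 = x powr (- 3)" using x by (simp add: powr_minus powr_numeral divide_inverse)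
        also have "\<dots> \<le> x powr (Re z - 2)" using x re by (intro powr_mono) auto
        finally show ?thesis .
      qed
      have a4: "exp (- x) \<le> 6 * (1 / x ^ 3)"
        using power_le_fact_exp[of x 3] x by (simp add: exp_minus field_simps fact_numeral)
      have "norm ?I + C2 * x ^ 9 * (H * (1 / x ^ 3) + exp (- x))
        \<le> x ^ 9 * (100 * C1 * (1 / x ^ 3)) + x ^ 9 * (5 * C1 * x powr (Re z - 2)) + x ^ 9 * (C2 * (H * (1 / x ^ 3) + 6 * (1 / x ^ 3)))"
      proof (intro add_mono)
        show "norm ?I \<le> x ^ 9 * (100 * C1 * (1 / x ^ 3)) + x ^ 9 * (5 * C1 * x powr (Re z - 2))"
          using I unfolding a1 a2 by simp
        have "C2 * x ^ 9 * (H * (1 / x ^ 3) + exp (- x)) \<le> C2 * x ^ 9 * (H * (1 / x ^ 3) + 6 * (1 / x ^ 3))"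
          using a4 C2 x by (intro mult_left_mono add_left_mono) auto
        thus "C2 * x ^ 9 * (H * (1 / x ^ 3) + exp (- x)) \<le> x ^ 9 * (C2 * (H * (1 / x ^ 3) + 6 * (1 / x ^ 3)))"
          by (simp only: mult_ac)
      qed
      also have "\<dots> = x ^ 9 * ((100 * C1 + C2 * (H + 6)) * (1 / x ^ 3) + 5 * C1 * x powr (Re z - 2))"
        by (simp add: algebra_simps add_divide_distrib)
      also have "\<dots> \<le> x ^ 9 * ((100 * C1 + C2 * (H + 6)) * x powr (Re z - 2) + 5 * C1 * x powr (Re z - 2))"
        using a3 C1 C2 H x by (intro mult_left_mono add_right_mono) auto
      also have "\<dots> = x ^ 9 * (C * x powr (Re z - 2))"
        unfolding C_def by (simp only: distrib_right add_ac)
      finally show ?thesis .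
    qed
    also have "discrepancy 9 z x = of_real (x ^ 9) * (omega_mean z x - c * of_real x powr (z - 1))"
    proof -
      have "of_real x powr (z + of_nat 9 - 1) = of_real x powr ((z - 1) + of_nat 9)" by (simp add: algebra_simps)
      also have "\<dots> = of_real x powr (z - 1) * of_real x powr of_nat 9" by (rule powr_add)
      also have "of_real x powr of_nat 9 = complex_of_real x ^ 9" using x by (intro powr_complexpow) auto
      finally show ?thesis using x by (simp add: discrepancy_def power_fun_def c_def algebra_simps)
    qed
    also have "norm \<dots> = x ^ 9 * norm (omega_mean z x - c * of_real x powr (z - 1))"
      using x by (simp add: norm_mult norm_power)
    finally show "norm (omega_mean z x - corr_prod z 1 * rGamma z * of_real x powr (z - 1)) \<le> C * x powr (Re z - 2)"
      using x by (simp add: c_def)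
  qed simp
qed

section \<open>Mod-Poisson convergence\<close>

text \<open>At s = 1 one has q = 1 / p and q / (1 - q) = 1 / (p - 1).\<close>

lemma euler_factor_eq: "euler_factor u p = corr_factor (iexp u) p 1"
proof (cases "prime p")
  case True
  hence p: "p \<ge> 2" by (rule prime_ge_2_nat)
  have q: "(of_nat p :: complex) powr (- 1) = of_real (1 / real p)"
    using p by (simp add: powr_minus divide_inverse)
  have nz: "complex_of_real (1 - 1 / real p) \<noteq> 0"
    using p by (simp only: of_real_eq_0_iff) simp
  have "iexp u * of_real (1 / real p) / (1 - of_real (1 / real p)) = iexp u / complex_of_real (real p - 1)"
  proof -
    have "iexp u * of_real (1 / real p) / (1 - of_real (1 / real p)) = iexp u * of_real ((1 / real p) / (1 - 1 / real p))"
      by simp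
    also have "(1 / real p) / (1 - 1 / real p) = 1 / (real p - 1)"
      using p by (simp add: field_simps)
    finally show ?thesis by simp
  qed
  moreover have "complex_of_real (1 - 1 / real p) powr iexp u = exp (iexp u * Ln (1 - of_real (1 / real p)))"
    using nz by (simp add: powr_def)
  ultimately show ?thesis using True
    unfolding euler_factor_def corr_factor_def local_factor_def q by simp
qed (simp add: euler_factor_def corr_factor_def)

text \<open>Passing from omega to omega' divides by \<open>iexp u\<close>; this is absorbed by z
  Gamma(z) = Gamma(z + 1).\<close>

lemma limit_fun_eq: "limit_fun u = corr_prod (iexp u) 1 * rGamma (iexp u) / iexp u"
  unfolding limit_fun_def euler_factor_eq corr_prod_def[symmetric] using rGamma_plus1[of "iexp u"]
  by (simp add: field_simps)

text \<open>The prescribed probabilities add up to 1, so M lies in {2..N} almost surely. The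
  subtracted 1 is the term n = 1 of the sum, and the division by \<open>iexp u\<close> reflects
  omega' = omega - 1.\<close>

lemma expectation_omega':
  fixes P :: "'a measure" and M :: "'a \<Rightarrow> nat" and Z :: "'a \<Rightarrow> real" and N :: nat
  assumes P: "prob_space P" and N: "N \<ge> 2"
    and M: "M \<in> measurable P (count_space UNIV)"
    and unif: "\<And>n. 2 \<le> n \<Longrightarrow> n \<le> N \<Longrightarrow> measure P {x \<in> space P. M x = n} = 1 / (real N - 1)"
    and Z: "\<And>x. x \<in> space P \<Longrightarrow> Z x = real_of_int (omega' (M x))"
  shows "(\<integral>x. iexp (u * Z x) \<partial>P) = (omega_sum (iexp u) N - 1) / (iexp u * (real N - 1))"
proof -
  interpret prob_space P by (rule P)
  define A where "A = (\<lambda>n. {x \<in> space P. M x = n})"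
  have A_meas: "A n \<in> sets P" for n
    unfolding A_def using M by measurable
  have disj: "disjoint_family_on A {2..N}" by (auto simp: disjoint_family_on_def A_def)
  have "prob (\<Union>n\<in>{2..N}. A n) = (\<Sum>n\<in>{2..N}. prob (A n))"
    by (rule finite_measure_finite_Union) (use disj A_meas in auto)
  also have "\<dots> = (\<Sum>n\<in>{2..N}. 1 / (real N - 1))"
    using unif by (intro sum.cong) (auto simp: A_def)
  also have "\<dots> = 1" using N by (simp add: of_nat_diff)
  finally have p1: "prob (\<Union>n\<in>{2..N}. A n) = 1" .
  have ae: "AE x in P. M x \<in> {2..N}"
  proof (rule AE_mp[OF AE_prob_1[OF p1]], rule AE_I2, rule impI)
    fix x assume "x \<in> (\<Union>n\<in>{2..N}. A n)"
    thus "M x \<in> {2..N}" by (auto simp: A_def)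
  qed
  define g where "g = (\<lambda>n. iexp (u * real_of_int (omega' n)))"
  have "(\<integral>x. iexp (u * Z x) \<partial>P) = (\<integral>x. g (M x) \<partial>P)"
    by (rule Bochner_Integration.integral_cong) (auto simp: g_def Z)
  also have "\<dots> = (\<integral>x. (\<Sum>n\<in>{2..N}. indicator (A n) x *\<^sub>R g n) \<partial>P)"
  proof (rule integral_cong_AE)
    show "(\<lambda>x. g (M x)) \<in> borel_measurable P"
      by (rule measurable_compose[OF M]) simp
    show "(\<lambda>x. \<Sum>n\<in>{2..N}. indicator (A n) x *\<^sub>R g n) \<in> borel_measurable P"
      using A_meas by measurable
    show "AE x in P. g (M x) = (\<Sum>n\<in>{2..N}. indicator (A n) x *\<^sub>R g n)"
      using ae AE_space
    proof eventually_elim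
      case (elim x)
      have "(\<Sum>n\<in>{2..N}. indicator (A n) x *\<^sub>R g n) = (\<Sum>n\<in>{2..N}. if n = M x then g n else 0)"
        using elim by (intro sum.cong) (auto simp: A_def indicator_def)
      thus ?case using elim by (simp add: sum.delta)
    qed
  qed
  also have "\<dots> = (\<Sum>n\<in>{2..N}. \<integral>x. indicator (A n) x *\<^sub>R g n \<partial>P)"
    using A_meas by (intro Bochner_Integration.integral_sum integrable_scaleR_left integrable_real_indicator) (auto simp: emeasure_eq_measure)
  also have "\<dots> = (\<Sum>n\<in>{2..N}. (1 / (real N - 1)) *\<^sub>R g n)"
  proof (rule sum.cong)
    fix n assume n: "n \<in> {2..N}"
    have "(\<integral>x. indicator (A n) x *\<^sub>R g n \<partial>P) = (\<integral>x. indicator (A n) x \<partial>P) *\<^sub>R g n"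
      using A_meas by (intro integral_scaleR_left integrable_real_indicator) (auto simp: emeasure_eq_measure)
    also have "(\<integral>x. indicator (A n) x \<partial>P) = prob (A n)"
      using A_meas sets.sets_into_space by (simp add: Int_absorb2)
    also have "prob (A n) = 1 / (real N - 1)" using unif n by (simp add: A_def)
    finally show "(\<integral>x. indicator (A n) x *\<^sub>R g n \<partial>P) = (1 / (real N - 1)) *\<^sub>R g n" .
  qed simp
  also have "\<dots> = (\<Sum>n\<in>{2..N}. omega_coeff (iexp u) n) / (iexp u * (real N - 1))"
  proof -
    have "(1 / (real N - 1)) *\<^sub>R g n = omega_coeff (iexp u) n / (iexp u * (real N - 1))" if "n \<ge> 2" for n
    proof -
      have "g n = exp (of_nat (omega n) * (\<i> * u) - \<i> * u)"
        by (simp add: g_def omega'_def algebra_simps)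
      also have "\<dots> = iexp u ^ omega n / iexp u" by (simp add: exp_diff exp_of_nat_mult)
      finally show ?thesis using that by (simp add: omega_coeff_def scaleR_conv_of_real divide_inverse mult_ac)
    qed
    thus ?thesis by (simp add: sum_divide_distrib)
  qed
  also have "(\<Sum>n\<in>{2..N}. omega_coeff (iexp u) n) = omega_sum (iexp u) N - 1"
  proof -
    have "{1..N} = insert 1 {2..N}" using N by auto
    hence "omega_sum (iexp u) N = omega_coeff (iexp u) 1 + (\<Sum>n\<in>{2..N}. omega_coeff (iexp u) n)"
      unfolding omega_sum_def by simp
    moreover have "omega_coeff (iexp u) 1 = 1" by (simp add: omega_coeff_def omega_def)
    ultimately show ?thesis by simp
  qed
  finally show ?thesis .
qed

lemma omega_mean_ln: "N > 0 \<Longrightarrow> omega_mean z (ln (real N)) = omega_sum z N / of_nat N"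
  by (simp add: omega_mean_def exp_minus divide_inverse)

definition poisson_ratio :: "nat \<Rightarrow> real \<Rightarrow> complex" where
  "poisson_ratio N u = exp (of_real (ln (ln (real N))) * (1 - iexp u)) * ((omega_sum (iexp u) N - 1) / (iexp u * (real N - 1)))"

text \<open>The normalising factor W has modulus x^(1 - Re z) with x = ln N, which turns the error
  x^(Re z - 2) of the mean into 1 / x for every z. The second summand comes from the missing n = 1
  and from N - 1 in place of N; there |W| \<le> x^2 is enough.\<close>

lemma poisson_ratio_bound:
  obtains C K N0 where "N0 \<ge> 3"
    "\<And>N u. N \<ge> N0 \<Longrightarrow> norm (poisson_ratio N u - limit_fun u) \<le> C / ln (real N) + (K + ln (real N) ^ 2) / (real N - 1)"
proof -
  obtain C x0 where C: "C \<ge> 0" "x0 \<ge> 2" "\<And>z x. norm z = 1 \<Longrightarrow> x \<ge> x0 \<Longrightarrow>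
    norm (omega_mean z x - corr_prod z 1 * rGamma z * of_real x powr (z - 1)) \<le> C * x powr (Re z - 2)"
    by (rule omega_mean_asymptotics) blast
  obtain K where K: "K \<ge> 0" "\<And>z. norm z = 1 \<Longrightarrow> norm (corr_prod z 1 * rGamma z) \<le> K"
    using main_coeff_bounded by blast
  define N0 where "N0 = max 3 (nat \<lceil>exp x0\<rceil>)"
  show ?thesis
  proof (rule that[of N0 C "K + C"])
    fix N :: nat and u :: real assume N: "N \<ge> N0"
    define x where "x = ln (real N)"
    define z where "z = iexp u"
    have N3: "N \<ge> 3" using N by (simp add: N0_def)
    have "exp x0 \<le> real N" using N unfolding N0_def by linarith
    hence x: "x \<ge> x0" unfolding x_def using N3 by (subst ln_ge_iff) auto
    have x2: "x \<ge> 2" using x C by simp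
    have z: "norm z = 1" "z \<noteq> 0" by (simp_all add: z_def)
    have re: "\<bar>Re z\<bar> \<le> 1" using abs_Re_le_cmod[of z] z by simp
    define f where "f = omega_mean z x"
    define c where "c = corr_prod z 1 * rGamma z"
    define W where "W = of_real x powr (1 - z)"
    have nW: "norm W = x powr (1 - Re z)" using x2 by (simp add: W_def norm_powr_real_powr)
    have W1: "W * of_real x powr (z - 1) = 1"
      unfolding W_def powr_add[symmetric] using x2 by simp
    have W: "exp (of_real (ln x) * (1 - z)) = W"
      using x2 by (simp add: W_def powr_def Ln_of_real mult.commute)
    have Wf: "norm (W * f - c) \<le> C / x"
    proof -
      have "W * f - c = W * (f - c * of_real x powr (z - 1))"
        using W1 by (simp add: algebra_simps)
      also have "norm \<dots> \<le> x powr (1 - Re z) * (C * x powr (Re z - 2))"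
        unfolding norm_mult nW f_def c_def using C z x by (intro mult_left_mono) auto
      also have "\<dots> = C * x powr (1 - Re z + (Re z - 2))" by (simp only: powr_add mult_ac)
      also have "\<dots> = C / x" using x2 by (simp add: powr_minus divide_inverse)
      finally show ?thesis .
    qed
    have Wfn: "norm (W * f) \<le> K + C"
    proof -
      have "C / x \<le> C / 1" using x2 C by (intro divide_left_mono) auto
      moreover have "norm c \<le> K" unfolding c_def by (rule K(2)[OF z(1)])
      ultimately show ?thesis using Wf norm_triangle_ineq[of "W * f - c" c] by simp
    qed
    have nW2: "norm W \<le> x ^ 2"
    proof -
      have "x powr (1 - Re z) \<le> x powr 2" using x2 re by (intro powr_mono) auto
      thus ?thesis using nW x2 by (simp add: powr_numeral)
    qed
    have os: "omega_sum z N = of_nat N * f" using N3 by (simp add: f_def x_def omega_mean_ln)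
    have M0: "of_real (real N - 1) \<noteq> (0 :: complex)" using N3 by (subst of_real_eq_0_iff) simp
    have e1: "poisson_ratio N u = W * ((of_nat N * f - 1) / (z * of_real (real N - 1)))"
      by (simp only: poisson_ratio_def z_def[symmetric] x_def[symmetric] W os)
    have e2: "of_nat N = (of_real (real N - 1) + 1 :: complex)" by simp
    \<comment> \<open>Writing N = (N - 1) + 1 separates the mean over N terms from the change of
      denominator.\<close>
    have "poisson_ratio N u - limit_fun u = (W * f - c) / z + (W * f - W) / (z * of_real (real N - 1))"
      unfolding e1 limit_fun_eq z_def[symmetric] c_def[symmetric] e2
      using M0 z(2) by (simp add: field_simps del: of_real_diff)
    also have "norm \<dots> \<le> C / x + (K + C + x ^ 2) / (real N - 1)"
    proof (rule norm_triangle_mono)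
      show "norm ((W * f - c) / z) \<le> C / x" using Wf z by (simp add: norm_divide)
      have "norm (W * f - W) \<le> K + C + x ^ 2"
        using norm_triangle_ineq4[of "W * f" W] Wfn nW2 by linarith
      moreover have "norm (z * of_real (real N - 1)) = real N - 1"
        unfolding norm_mult norm_of_real using z N3 by simp
      ultimately show "norm ((W * f - W) / (z * of_real (real N - 1))) \<le> (K + C + x ^ 2) / (real N - 1)"
        unfolding norm_divide using N3 by (simp add: divide_right_mono)
    qed
    finally show "norm (poisson_ratio N u - limit_fun u) \<le> C / ln (real N) + (K + C + ln (real N) ^ 2) / (real N - 1)"
      by (simp add: x_def)
  qed (simp add: N0_def)
qed

lemma poisson_ratio_uniform: "uniform_limit UNIV poisson_ratio limit_fun sequentially"
proof -
  obtain C K N0 where b: "N0 \<ge> 3"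
    "\<And>N u. N \<ge> N0 \<Longrightarrow> norm (poisson_ratio N u - limit_fun u) \<le> C / ln (real N) + (K + ln (real N) ^ 2) / (real N - 1)"
    by (rule poisson_ratio_bound) blast
  have lim: "(\<lambda>N. C / ln (real N) + (K + ln (real N) ^ 2) / (real N - 1)) \<longlonglongrightarrow> 0"
    by real_asymp
  show ?thesis
  proof (rule uniform_limitI)
    fix e :: real assume "e > 0"
    hence "\<forall>\<^sub>F N in sequentially. C / ln (real N) + (K + ln (real N) ^ 2) / (real N - 1) < e"
      using order_tendstoD(2)[OF lim] by blast
    thus "\<forall>\<^sub>F N in sequentially. \<forall>u\<in>UNIV. dist (poisson_ratio N u) (limit_fun u) < e"
      using eventually_ge_at_top[of N0]
    proof eventually_elim
      case (elim N)
      thus ?case using b(2)[of N] unfolding dist_norm by (meson order_le_less_trans)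
    qed
  qed
qed

theorem corollary4p15:
  fixes P :: "nat \<Rightarrow> 'a measure" and M :: "nat \<Rightarrow> 'a \<Rightarrow> nat" and Z :: "nat \<Rightarrow> 'a \<Rightarrow> real"
  assumes "\<And>N. N \<ge> 2 \<Longrightarrow> prob_space (P N)"
    and "\<And>N. N \<ge> 2 \<Longrightarrow> M N \<in> measurable (P N) (count_space UNIV)"
    and "\<And>N n. N \<ge> 2 \<Longrightarrow> 2 \<le> n \<Longrightarrow> n \<le> N \<Longrightarrow>
           measure (P N) {x \<in> space (P N). M N x = n} = 1 / (real N - 1)"
    and "\<And>N x. N \<ge> 2 \<Longrightarrow> x \<in> space (P N) \<Longrightarrow> Z N x = real_of_int (omega' (M N x))"
  shows "(\<forall>u. convergent_prod (euler_factor u)) \<and>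
         strongly_mod_poisson P Z (\<lambda>N. ln (ln (real N))) limit_fun"
proof
  show "\<forall>u. convergent_prod (euler_factor u)"
  proof
    fix u
    have "convergent_prod (\<lambda>n. corr_factor (iexp u) n 1)" by (rule corr_factor_convergent) auto
    thus "convergent_prod (euler_factor u)" by (simp add: euler_factor_eq[abs_def])
  qed
  define F where "F = (\<lambda>N u. exp (complex_of_real (ln (ln (real N))) * (1 - iexp u)) * integral\<^sup>L (P N) (\<lambda>x. iexp (u * Z N x)))"
  have "F N u = poisson_ratio N u" if "N \<ge> 2" for N u
    unfolding F_def poisson_ratio_def
    by (subst expectation_omega'[where M = "M N" and N = N]) (use assms that in auto)
  hence ev: "\<forall>\<^sub>F N in sequentially. \<forall>u\<in>UNIV. F N u = poisson_ratio N u"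
    by (intro eventually_mono[OF eventually_ge_at_top[of "2::nat"]]) simp
  have unif: "uniform_limit UNIV F limit_fun sequentially"
    by (rule uniform_limit_cong[THEN iffD2, OF ev _ poisson_ratio_uniform]) simp
  have meas: "Z N \<in> borel_measurable (P N)" if "N \<ge> 2" for N
  proof -
    have "(\<lambda>x. real_of_int (omega' (M N x))) \<in> borel_measurable (P N)"
      by (rule measurable_compose[OF assms(2)[OF that]]) simp
    thus ?thesis by (rule measurable_cong[THEN iffD1, rotated]) (simp add: assms(4)[OF that])
  qed
  show "strongly_mod_poisson P Z (\<lambda>N. ln (ln (real N))) limit_fun"
    unfolding strongly_mod_poisson_def Let_def F_def[symmetric]
  proof (intro conjI allI)
    show "\<forall>\<^sub>F N in sequentially. prob_space (P N) \<and> Z N \<in> borel_measurable (P N)"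
      using eventually_ge_at_top[of 2] by eventually_elim (use assms meas in auto)
    show "\<forall>\<^sub>F N in sequentially. ln (ln (real N)) > 0" by real_asymp
    fix u
    show "(\<lambda>N. F N u) \<longlonglongrightarrow> limit_fun u" using tendsto_uniform_limitI[OF unif] by simp
    \<comment> \<open>The estimate is uniform in u, so the whole line serves as
      neighbourhood.\<close>
    show "\<exists>U. open U \<and> u \<in> U \<and> uniform_limit U F limit_fun sequentially"
      using unif by (intro exI[of _ UNIV]) auto
  qed
qed

end
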